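(* Consider the stochastic contextual matching market and the BARB algorithm described in the context (with $\eta = R\sqrt{d\log\left((1+TB_x^2/\lambda)T^2\right)}+\lambda^{1/2}B_\theta$). Assume that the cumulative distribution function $F$ of the minimum difference $\delta_{\min}$ satisfies: there exist constants $\Delta_0>0$ and $c>0$ such that $F(\Delta)\le c\Delta$ for all $\Delta\le\Delta_0$. Then, when $T$ is sufficiently large, the regret of BARB satisfies $Reg_i(T)=\tilde O(T^{2/3})$ for all $i\in[N]$, where $\tilde O$ hides polylogarithmic factors in $T$ and problem-dependent constants.
   Context: Market: $N$ players $p_1,\dots,p_N$ and $K\ge N$ arms $a_1,\dots,a_K$, horizon $T$. Each arm $a_j$ has a fixed, strict, known preference order $\succ_{a_j}$ over players. Each player $p_i$ has an unknown parameter $\theta_i\in\mathbb{R}^d$ with $\|\theta_i\|_2\le B_\theta$. At each round $t$, every arm $a_j$ has a context $x_j(t)\in\mathbb{R}^d$ with $\|x_j(t)\|_2\le B_x$ a.s., revealed before matching; utility $U_{i,j}(t)=\theta_i^\top x_j(t)$; $B_y:=2B_\theta B_x\le 1$. Stochastic contexts: the tuple $(x_1(t),\dots,x_K(t))$ is drawn independently across rounds from a fixed unknown distribution. In each round a matching $\mu_t$ is chosen; if $p_i$ is matched to $a_j$ one observes $y_i(t)=U_{i,j}(t)+\epsilon_{i,j}(t)$ with i.i.d. mean-zero noise, conditionally $R$-subgaussian given the past; unmatched players get $y_i(t)=0$. A matching $\mu$ is stable at time $t$ if there is no pair $(p_i,a_j)$ with $p_i\succ_{a_j}\mu(a_j)$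 and $U_{i,j}(t)>U_{i,\mu(p_i)}(t)$; $\mathcal{S}_t$ is the set of stable matchings and $U_i^*(t)=\max_{\mu\in\mathcal{S}_t}U_{i,\mu(i)}(t)$. Regret: $Reg_i(T)=\sum_{t=1}^T U_i^*(t)-\mathbb{E}[\sum_{t=1}^T y_i(t)]$. Minimum difference of a context realization: $\delta_{\min}=\min_{i}\min_{j\ne j'}|\theta_i^\top(x_j-x_{j'})|$. BARB algorithm (inputs $T$, arm preferences, $d$, $\eta$, initial candidate gap $\Delta_1>0$, ridge parameter $\lambda>0$): global round counter $t$ starts at $1$. For batches $k=1,2,\dots$: $\xi_k=\Delta_k/\eta$, reset $V_i=\lambda I_d$, $\hat\theta_i=0$, counter $N_k=0$. Each round: observe contexts. If some $(i,j)$ has $\|x_j\|_{V_i^{-1}}>\xi_k$, compute a maximum cardinality matching on the bipartite graph of all such pairs, match covered players accordingly (others unmatched), and update for matched players $V_i=\lambda I+\sum_s x_{i_s}x_{i_s}^\top$, $\hat\theta_i=V_i^{-1}\sum_s x_{i_s}y_{i,i_s}$ over that player's exploration rounds in the current batch. Otherwise set $\hat U_{i,j}=\hat\theta_i^\top x_j$, play the output of player-proposing Gale–Shapley on $\hat U$ and the arms' preferences, and increment $N_k$ if some player's minimal gap between consecutive values among its top $N+1$ sorted estimated utilities is $\le 2\Delta_k$. After each round increment $t$ and stop if $t>T$; if $N_k>\frac{3\log T}{16\Delta_k^2}$, set $\Delta_{k+1}=\Delta_k/\sqrt2$ and start the next batch. *)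

theory Defs
  imports "HOL-Analysis.Analysis" "HOL-Probability.Probability"
begin

(* Players: finite linearly ordered type 'n (N = CARD('n)); arms: finite linearly
   ordered type 'k (K = CARD('k)); contexts live in (real, 'd) vec (d = CARD('d)).
   A context realization of all arms is x :: ((real, 'd) vec, 'k) vec, with x $ j the context of arm j.
   Arm preferences: arank j :: 'n => nat, injective; p \<succ>_{a_j} p' iff arank j p < arank j p'.
   A matching is a partial map from players to arms. *)

type_synonym ('n, 'k) matching = "'n \<Rightarrow> 'k option"

definition is_matching :: "(('n::{finite,linorder}), ('k::{finite,linorder})) matching \<Rightarrow> bool" where
  "is_matching \<mu> \<longleftrightarrow> (\<forall>i i' j. \<mu> i = Some j \<and> \<mu> i' = Some j \<longrightarrow> i = i')"

definition util :: "(('n::{finite,linorder}) \<Rightarrow> (real, ('d::finite)) vec) \<Rightarrow> ((real, 'd) vec, ('k::{finite,linorder})) vec \<Rightarrow> 'n \<Rightarrow> 'k \<Rightarrow> real" where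
  "util \<theta> x i j = \<theta> i \<bullet> (x $ j)"

(* stability w.r.t. utilities U and arm ranks; an unmatched agent prefers any partner *)
definition stable :: "(('k::{finite,linorder}) \<Rightarrow> ('n::{finite,linorder}) \<Rightarrow> nat) \<Rightarrow> ('n \<Rightarrow> 'k \<Rightarrow> real) \<Rightarrow> ('n, 'k) matching \<Rightarrow> bool" where
  "stable arank U \<mu> \<longleftrightarrow> is_matching \<mu> \<and>
     \<not> (\<exists>i j. (\<forall>i'. \<mu> i' = Some j \<longrightarrow> arank j i < arank j i') \<and>
              (case \<mu> i of None \<Rightarrow> True | Some j' \<Rightarrow> U i j > U i j'))"

definition match_val :: "(('n::{finite,linorder}) \<Rightarrow> ('k::{finite,linorder}) \<Rightarrow> real) \<Rightarrow> ('n, 'k) matching \<Rightarrow> 'n \<Rightarrow> real" where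
  "match_val U \<mu> i = (case \<mu> i of None \<Rightarrow> 0 | Some j \<Rightarrow> U i j)"

definition Ustar :: "(('k::{finite,linorder}) \<Rightarrow> ('n::{finite,linorder}) \<Rightarrow> nat) \<Rightarrow> ('n \<Rightarrow> (real, ('d::finite)) vec) \<Rightarrow> ((real, 'd) vec, 'k) vec \<Rightarrow> 'n \<Rightarrow> real" where
  "Ustar arank \<theta> x i = Max {match_val (util \<theta> x) \<mu> i | \<mu>. stable arank (util \<theta> x) \<mu>}"

definition delta_min :: "(('n::{finite,linorder}) \<Rightarrow> (real, ('d::finite)) vec) \<Rightarrow> ((real, 'd) vec, ('k::{finite,linorder})) vec \<Rightarrow> real" where
  "delta_min \<theta> x = Min {\<bar>\<theta> i \<bullet> (x $ j - x $ j')\<bar> | i j j'. j \<noteq> j'}"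

definition max_card_matching :: "(('n::{finite,linorder}) \<times> ('k::{finite,linorder})) set \<Rightarrow> ('n, 'k) matching \<Rightarrow> bool" where
  "max_card_matching E \<mu> \<longleftrightarrow> is_matching \<mu> \<and> (\<forall>i j. \<mu> i = Some j \<longrightarrow> (i, j) \<in> E) \<and>
     (\<forall>\<mu>'. is_matching \<mu>' \<and> (\<forall>i j. \<mu>' i = Some j \<longrightarrow> (i, j) \<in> E) \<longrightarrow>
        card {i. \<mu>' i \<noteq> None} \<le> card {i. \<mu> i \<noteq> None})"

definition pbetter :: "(('n::{finite,linorder}) \<Rightarrow> ('k::{finite,linorder}) \<Rightarrow> real) \<Rightarrow> 'n \<Rightarrow> 'k \<Rightarrow> 'k \<Rightarrow> bool" where
  "pbetter Uh i j j' \<longleftrightarrow> Uh i j > Uh i j' \<or> (Uh i j = Uh i j' \<and> j < j')"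

definition best_arm :: "(('n::{finite,linorder}) \<Rightarrow> ('k::{finite,linorder}) \<Rightarrow> real) \<Rightarrow> 'n \<Rightarrow> 'k set \<Rightarrow> 'k" where
  "best_arm Uh i S = (THE j. j \<in> S \<and> (\<forall>j'\<in>S. j' \<noteq> j \<longrightarrow> pbetter Uh i j j'))"

(* state: rej i = arms that have rejected player i; hold j = player tentatively held by arm j.
   One step: the smallest free player that has not been rejected by every arm proposes to
   its best arm among those that have not rejected it; the arm keeps its preferred proposer. *)
definition gs_step :: "(('k::{finite,linorder}) \<Rightarrow> ('n::{finite,linorder}) \<Rightarrow> nat) \<Rightarrow> ('n \<Rightarrow> 'k \<Rightarrow> real) \<Rightarrow>
    ('n \<Rightarrow> 'k set) \<times> ('k \<Rightarrow> 'n option) \<Rightarrow> ('n \<Rightarrow> 'k set) \<times> ('k \<Rightarrow> 'n option)" where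
  "gs_step arank Uh st = (case st of (rej, hold) \<Rightarrow>
     (let F = {i. (\<forall>j. hold j \<noteq> Some i) \<and> rej i \<noteq> UNIV} in
      if F = {} then (rej, hold) else
      (let i = Min F; j = best_arm Uh i (- rej i) in
       (case hold j of
          None \<Rightarrow> (rej, hold(j := Some i))
        | Some i' \<Rightarrow> if arank j i < arank j i'
                     then (rej(i' := insert j (rej i')), hold(j := Some i))
                     else (rej(i := insert j (rej i)), hold)))))"

(* (N+1)*K steps suffice to reach the terminal state; later steps are no-ops *)
definition gale_shapley :: "(('k::{finite,linorder}) \<Rightarrow> ('n::{finite,linorder}) \<Rightarrow> nat) \<Rightarrow> ('n \<Rightarrow> 'k \<Rightarrow> real) \<Rightarrow> ('n, 'k) matching" where
  "gale_shapley arank Uh =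
     (let hold = snd ((gs_step arank Uh ^^ ((CARD('n) + 1) * CARD('k))) (\<lambda>_. {}, \<lambda>_. None)) in
      (\<lambda>i. if \<exists>j. hold j = Some i then Some (THE j. hold j = Some i) else None))"

definition barb_eta :: "nat \<Rightarrow> nat \<Rightarrow> real \<Rightarrow> real \<Rightarrow> real \<Rightarrow> real \<Rightarrow> real" where
  "barb_eta d T R lam Bth Bx =
     R * sqrt (real d * ln ((1 + real T * Bx\<^sup>2 / lam) * (real T)\<^sup>2)) + sqrt lam * Bth"

definition gram :: "real \<Rightarrow> (((real, ('d::finite)) vec) \<times> real) list \<Rightarrow> ((real, 'd) vec, 'd) vec" where
  "gram lam D = mat lam + sum_list (map (\<lambda>(x, y). (\<chi> a b. x $ a * x $ b)) D)"

definition ridge_est :: "real \<Rightarrow> (((real, ('d::finite)) vec) \<times> real) list \<Rightarrow> (real, 'd) vec" where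
  "ridge_est lam D = matrix_inv (gram lam D) *v sum_list (map (\<lambda>(x, y). y *\<^sub>R x) D)"

definition wnorm :: "((real, ('d::finite)) vec, 'd) vec \<Rightarrow> (real, 'd) vec \<Rightarrow> real" where
  "wnorm A x = sqrt (x \<bullet> (A *v x))"

definition small_gap :: "nat \<Rightarrow> (('n::{finite,linorder}) \<Rightarrow> ('k::{finite,linorder}) \<Rightarrow> real) \<Rightarrow> 'n \<Rightarrow> real \<Rightarrow> bool" where
  "small_gap N Uh i Del =
     (let L = take (N + 1) (rev (sort (map (Uh i) (sorted_list_of_set (UNIV :: 'k set))))) in
      \<exists>m. m + 1 < length L \<and> L ! m - L ! (m + 1) \<le> 2 * Del)"

(* state: (Delta_k, N_k, exploration data of each player in the current batch) *)
type_synonym ('n, 'd) barb_state = "real \<times> nat \<times> ('n \<Rightarrow> (((real, 'd) vec) \<times> real) list)"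

(* one round of BARB: input the contexts x and the noise array e of this round (e (i,j) is the
   noise seen if player i is matched to arm j); output the matching played, the observations y,
   and the new state.  T is the horizon, passed to the algorithm. *)
definition barb_round ::
  "nat \<Rightarrow> real \<Rightarrow> real \<Rightarrow> real \<Rightarrow> real \<Rightarrow> (('k::{finite,linorder}) \<Rightarrow> ('n::{finite,linorder}) \<Rightarrow> nat) \<Rightarrow>
   (('n \<times> 'k) set \<Rightarrow> ('n, 'k) matching) \<Rightarrow> ('n \<Rightarrow> (real, ('d::finite)) vec) \<Rightarrow>
   (((real, 'd) vec, 'k) vec) \<times> ('n \<times> 'k \<Rightarrow> real) \<Rightarrow> ('n, 'd) barb_state \<Rightarrow>
   ('n, 'k) matching \<times> ('n \<Rightarrow> real) \<times> ('n, 'd) barb_state" where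
  "barb_round T R lam Bth Bx arank mcm \<theta> xe st =
    (case xe of (x, e) \<Rightarrow> case st of (Del, Nk, D) \<Rightarrow>
     (let eta = barb_eta CARD('d) T R lam Bth Bx;
          xi = Del / eta;
          E = {(i, j). wnorm (matrix_inv (gram lam (D i))) (x $ j) > xi};
          yof = (\<lambda>\<mu> i. case \<mu> i of None \<Rightarrow> 0 | Some j \<Rightarrow> util \<theta> x i j + e (i, j))
      in if E \<noteq> {} then
           (let \<mu> = mcm E; y = yof \<mu>;
                D' = (\<lambda>i. case \<mu> i of None \<Rightarrow> D i | Some j \<Rightarrow> D i @ [(x $ j, y i)])
            in (\<mu>, y, (Del, Nk, D')))
         else
           (let Uh = (\<lambda>i j. ridge_est lam (D i) \<bullet> (x $ j));
                \<mu> = gale_shapley arank Uh; y = yof \<mu>;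
                Nk' = (if \<exists>i. small_gap CARD('n) Uh i Del then Nk + 1 else Nk)
            in if real Nk' > 3 * ln (real T) / (16 * Del\<^sup>2)
               then (\<mu>, y, (Del / sqrt 2, 0, (\<lambda>_. [])))
               else (\<mu>, y, (Del, Nk', D)))))"

(* state before round t+1 (after t rounds), given the per-round randomness omega 1, omega 2, ... *)
primrec barb_hist ::
  "nat \<Rightarrow> real \<Rightarrow> real \<Rightarrow> real \<Rightarrow> real \<Rightarrow> real \<Rightarrow> (('k::{finite,linorder}) \<Rightarrow> ('n::{finite,linorder}) \<Rightarrow> nat) \<Rightarrow>
   (('n \<times> 'k) set \<Rightarrow> ('n, 'k) matching) \<Rightarrow> ('n \<Rightarrow> (real, ('d::finite)) vec) \<Rightarrow>
   (nat \<Rightarrow> (((real, 'd) vec, 'k) vec) \<times> ('n \<times> 'k \<Rightarrow> real)) \<Rightarrow> nat \<Rightarrow> ('n, 'd) barb_state" where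
  "barb_hist T R lam Bth Bx Del1 arank mcm \<theta> \<omega> 0 = (Del1, 0, (\<lambda>_. []))"
| "barb_hist T R lam Bth Bx Del1 arank mcm \<theta> \<omega> (Suc t) =
     snd (snd (barb_round T R lam Bth Bx arank mcm \<theta> (\<omega> (Suc t))
                 (barb_hist T R lam Bth Bx Del1 arank mcm \<theta> \<omega> t)))"

(* observation y_i(t) in round t >= 1 *)
definition barb_obs ::
  "nat \<Rightarrow> real \<Rightarrow> real \<Rightarrow> real \<Rightarrow> real \<Rightarrow> real \<Rightarrow> (('k::{finite,linorder}) \<Rightarrow> ('n::{finite,linorder}) \<Rightarrow> nat) \<Rightarrow>
   (('n \<times> 'k) set \<Rightarrow> ('n, 'k) matching) \<Rightarrow> ('n \<Rightarrow> (real, ('d::finite)) vec) \<Rightarrow>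
   (nat \<Rightarrow> (((real, 'd) vec, 'k) vec) \<times> ('n \<times> 'k \<Rightarrow> real)) \<Rightarrow> nat \<Rightarrow> 'n \<Rightarrow> real" where
  "barb_obs T R lam Bth Bx Del1 arank mcm \<theta> \<omega> t i =
     fst (snd (barb_round T R lam Bth Bx arank mcm \<theta> (\<omega> t)
                 (barb_hist T R lam Bth Bx Del1 arank mcm \<theta> \<omega> (t - 1)))) i"

definition round_measure :: "(((real, ('d::finite)) vec, ('k::{finite,linorder})) vec) measure \<Rightarrow> real measure \<Rightarrow> ((((real, 'd) vec, 'k) vec) \<times> (('n::{finite,linorder}) \<times> 'k \<Rightarrow> real)) measure" where
  "round_measure Dx \<nu> = Dx \<Otimes>\<^sub>M PiM UNIV (\<lambda>_. \<nu>)"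

definition barb_regret ::
  "nat \<Rightarrow> real \<Rightarrow> real \<Rightarrow> real \<Rightarrow> real \<Rightarrow> real \<Rightarrow> (('k::{finite,linorder}) \<Rightarrow> ('n::{finite,linorder}) \<Rightarrow> nat) \<Rightarrow>
   (('n \<times> 'k) set \<Rightarrow> ('n, 'k) matching) \<Rightarrow> ('n \<Rightarrow> (real, ('d::finite)) vec) \<Rightarrow>
   (((real, 'd) vec, 'k) vec) measure \<Rightarrow> real measure \<Rightarrow> 'n \<Rightarrow> real" where
  "barb_regret T R lam Bth Bx Del1 arank mcm \<theta> Dx \<nu> i =
     (let M = PiM {1..T} (\<lambda>_. round_measure Dx \<nu>) in
      (\<integral>\<omega>. (\<Sum>t\<in>{1..T}. Ustar arank \<theta> (fst (\<omega> t)) i) \<partial>M)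
      - (\<integral>\<omega>. (\<Sum>t\<in>{1..T}. barb_obs T R lam Bth Bx Del1 arank mcm \<theta> \<omega> t i) \<partial>M))"

end

theory Submission
  imports Defs
begin

text \<open>
  A round costs regret only if the players explore, if the estimates of the current batch are
  inaccurate, or if the round is flagged because some player has a small estimated gap: with accurate
  estimates and without small gaps every player ranks its \<open>N\<close> best arms correctly, and player-proposing
  Gale--Shapley never goes beyond the first \<open>N\<close> arms of a list. In a batch with candidate gap \<open>\<Delta>\<close> the
  elliptical potential bounds the number of exploration rounds by a polylogarithmic multiple of
  \<open>1 / \<Delta>\<^sup>2\<close>, and the stopping rule of the batch does the same for the flagged rounds. As \<open>1 / \<Delta>\<^sup>2\<close>
  doubles from batch to batch, the last gap governs the total. A batch with gap \<open>\<Delta> \<le> D\<close>, where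
  \<open>D = T powr (- 1 / 3)\<close>, ends only after about \<open>1 / \<Delta>\<^sup>2\<close> flagged rounds; with accurate estimates
  these satisfy \<open>delta_min \<le> 4 * D\<close>, so only \<open>O(T * D) = O(T powr (2 / 3))\<close> of them are expected.

  The regret is linear in the failure events, so the confidence bound is needed only for each fixed
  round, without a maximal inequality. The exponential supermartingale of the noise is set back to
  \<open>1\<close> when a batch starts, hence its expectation is at most one plus the expected number of batches,
  which is logarithmic. Integrating it against a Gaussian in the dual variable gives the
  self-normalised bound.
\<close>

section \<open>Gale--Shapley\<close>

text \<open>The exponent \<open>- 1 / 3\<close> balances \<open>1 / D0\<^sup>2\<close> against
  \<open>T * D0\<close>. Two obstacles shape the rest. First, each batch discards its data, so the
  supermartingale restarts; every restart is charged 1, and the number of restarts must be bounded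
  before any probability is estimated. That bound is deterministic: \<open>count_inv\<close>, with
  at most \<open>T\<close> flagged rounds inserted, already bounds the inverse squared gap by a
  polynomial in \<open>T\<close>. Second, the Gaussian mixture is not evaluated exactly. The Gram
  form is at most \<open>L * (norm w)\<^sup>2\<close> with \<open>L = lam + T * Bx\<^sup>2\<close>,
  so comparing the two Gaussian masses costs \<open>L / lam\<close> to the power
  \<open>d / 2\<close>. The logarithm in \<open>barb_eta\<close> fits this: exponentiating half of
  the threshold pays the cost and leaves a gain of \<open>T ^ d\<close>, hence a failure probability
  of order \<open>ln T / T\<close> in each round. The lists in the state carry no sigma-algebra;
  measurability is tracked through the Gram matrix and the response vector, the only quantities that
  the algorithm reads from them.\<close>

lemma pbetter_trans:
  "pbetter Uh i a b \<Longrightarrow> pbetter Uh i b c \<Longrightarrow> pbetter Uh i a c"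
  unfolding pbetter_def by auto

lemma pbetter_asym: "pbetter Uh i a b \<Longrightarrow> \<not> pbetter Uh i b a"
  unfolding pbetter_def by auto

lemma pbetter_total: "a \<noteq> b \<Longrightarrow> pbetter Uh i a b \<or> pbetter Uh i b a"
  unfolding pbetter_def by (metis linorder_neqE)

lemma ex_pbetter_best:
  assumes "finite S" "S \<noteq> {}"
  shows "\<exists>j\<in>S. \<forall>j'\<in>S. j' \<noteq> j \<longrightarrow> pbetter Uh i j j'"
  using assms
proof (induction S rule: finite_ne_induct)
  case (singleton x)
  then show ?case by simp
next
  case (insert x F)
  then obtain j where j: "j \<in> F" "\<forall>j'\<in>F. j' \<noteq> j \<longrightarrow> pbetter Uh i j j'" by blast
  show ?case
  proof (cases "pbetter Uh i x j")
    case True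
    have "\<forall>j'\<in>insert x F. j' \<noteq> x \<longrightarrow> pbetter Uh i x j'"
      using True j(2) pbetter_trans by (metis insert_iff)
    then show ?thesis by blast
  next
    case False
    have "x \<noteq> j" using insert j by auto
    then have "pbetter Uh i j x" using False pbetter_total by blast
    then have "\<forall>j'\<in>insert x F. j' \<noteq> j \<longrightarrow> pbetter Uh i j j'" using j(2) by auto
    then show ?thesis using j(1) by blast
  qed
qed

lemma best_arm_best:
  fixes S :: "'k::{finite,linorder} set"
  assumes "S \<noteq> {}"
  shows "best_arm Uh i S \<in> S"
    and "j' \<in> S \<Longrightarrow> j' \<noteq> best_arm Uh i S \<Longrightarrow> pbetter Uh i (best_arm Uh i S) j'"
proof -
  have "\<exists>!j. j \<in> S \<and> (\<forall>j'\<in>S. j' \<noteq> j \<longrightarrow> pbetter Uh i j j')"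
    using ex_pbetter_best[of S Uh i] assms pbetter_asym finite by metis
  from theI'[OF this] show "best_arm Uh i S \<in> S"
    and "j' \<in> S \<Longrightarrow> j' \<noteq> best_arm Uh i S \<Longrightarrow> pbetter Uh i (best_arm Uh i S) j'"
    unfolding best_arm_def by blast+
qed

text \<open>The fourth clause persists because arms only trade up; it yields both the bound on the
  number of rejections and stability. The parameter \<open>P\<close> is trivially true in the
  stability proof and excludes the partner under a given stable matching in the optimality
  proof.\<close>

definition gs_inv where
  "gs_inv arank Uh P st \<longleftrightarrow>
     (\<forall>i j. snd st j = Some i \<longrightarrow> j \<notin> fst st i) \<and>
     (\<forall>i j j'. snd st j = Some i \<longrightarrow> j' \<notin> fst st i \<longrightarrow> j' \<noteq> j \<longrightarrow> pbetter Uh i j j') \<and>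
     (\<forall>i j j'. snd st j = Some i \<longrightarrow> snd st j' = Some i \<longrightarrow> j = j') \<and>
     (\<forall>i j. j \<in> fst st i \<longrightarrow> (\<exists>i'. snd st j = Some i' \<and> arank j i' < (arank j i :: nat))) \<and>
     (\<forall>i j. j \<in> fst st i \<longrightarrow> P i j)"

lemma gs_invI:
  assumes "\<And>i j. hold j = Some i \<Longrightarrow> j \<notin> rej i"
    and "\<And>i j j'. hold j = Some i \<Longrightarrow> j' \<notin> rej i \<Longrightarrow> j' \<noteq> j \<Longrightarrow> pbetter Uh i j j'"
    and "\<And>i j j'. hold j = Some i \<Longrightarrow> hold j' = Some i \<Longrightarrow> j = j'"
    and "\<And>i j. j \<in> rej i \<Longrightarrow> \<exists>i'. hold j = Some i' \<and> arank j i' < (arank j i :: nat)"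
    and "\<And>i j. j \<in> rej i \<Longrightarrow> P i j"
  shows "gs_inv arank Uh P (rej, hold)"
  unfolding gs_inv_def fst_conv snd_conv
  by (intro conjI allI impI; (rule assms; assumption))

lemma gs_invD:
  assumes "gs_inv arank Uh P (rej, hold)"
  shows "hold j = Some i \<Longrightarrow> j \<notin> rej i"
    and "hold j = Some i \<Longrightarrow> j' \<notin> rej i \<Longrightarrow> j' \<noteq> j \<Longrightarrow> pbetter Uh i j j'"
    and "hold j = Some i \<Longrightarrow> hold j' = Some i \<Longrightarrow> j = j'"
    and "j \<in> rej i \<Longrightarrow> \<exists>i'. hold j = Some i' \<and> arank j i' < (arank j i :: nat)"
    and "j \<in> rej i \<Longrightarrow> P i j"
  using assms unfolding gs_inv_def fst_conv snd_conv by blast+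

text \<open>Every arm that has rejected \<open>i\<close> holds another player, and distinct arms
  hold distinct players. Hence only the first \<open>N\<close> arms of a player's list ever
  matter.\<close>

lemma gs_inv_card_rej:
  fixes rej :: "'n::{finite,linorder} \<Rightarrow> 'k::{finite,linorder} set"
  assumes "gs_inv arank Uh P (rej, hold)"
  shows "card (rej i) \<le> CARD('n) - 1"
proof -
  have ex: "\<forall>j\<in>rej i. \<exists>i'. hold j = Some i' \<and> i' \<noteq> i"
    using gs_invD(4)[OF assms] by blast
  define f where "f j = (THE i'. hold j = Some i')" for j
  have f: "hold j = Some (f j) \<and> f j \<noteq> i" if j: "j \<in> rej i" for j
  proof -
    obtain i' where "hold j = Some i'" "i' \<noteq> i" using ex j by blast
    then show ?thesis unfolding f_def by simp
  qed
  have inj: "inj_on f (rej i)"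
    using f gs_invD(3)[OF assms] unfolding inj_on_def by metis
  have "f ` rej i \<subseteq> UNIV - {i}" using f by auto
  then have "card (rej i) \<le> card (UNIV - {i})"
    using inj by (metis card_inj_on_le finite)
  then show ?thesis by (simp add: card_Diff_singleton)
qed

text \<open>The predicate \<open>P i j\<close> is a property of every rejection of \<open>i\<close> by \<open>j\<close>. It is
  inherited when \<open>j\<close> rejects \<open>i\<close> in favour of a player \<open>i'\<close> who ranks \<open>j\<close> first outside
  a small set of arms with that property.\<close>

lemma gs_inv_step:
  fixes st :: "('n::{finite,linorder} \<Rightarrow> 'k::{finite,linorder} set) \<times> ('k \<Rightarrow> 'n option)"
  assumes inv: "gs_inv arank Uh P st" and inj: "\<And>j. inj (arank j)"
    and P: "\<And>i i' j S. \<lbrakk>i \<noteq> i'; arank j i' < arank j i; card S \<le> CARD('n) - 1; j \<notin> S;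
              \<forall>j'. j' \<notin> S \<longrightarrow> j' \<noteq> j \<longrightarrow> pbetter Uh i' j j'; \<forall>j'\<in>S. P i' j'\<rbrakk> \<Longrightarrow> P i j"
  shows "gs_inv arank Uh P (gs_step arank Uh st)"
proof -
  obtain rej hold where st: "st = (rej, hold)" by (cases st)
  define F where "F = {i. (\<forall>j. hold j \<noteq> Some i) \<and> rej i \<noteq> UNIV}"
  show ?thesis
  proof (cases "F = {}")
    case True
    then have "gs_step arank Uh st = st" unfolding gs_step_def st F_def by simp
    then show ?thesis using inv by simp
  next
    case False
    define i where "i = Min F"
    define j where "j = best_arm Uh i (- rej i)"
    have "i \<in> F" unfolding i_def using False by (intro Min_in) auto
    then have free: "\<And>j. hold j \<noteq> Some i" and ne: "- rej i \<noteq> {}" unfolding F_def by auto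
    have jn: "j \<notin> rej i" and jb: "\<And>j'. j' \<notin> rej i \<Longrightarrow> j' \<noteq> j \<Longrightarrow> pbetter Uh i j j'"
      using best_arm_best[OF ne, where Uh=Uh and i=i] unfolding j_def by auto
    have eq: "gs_step arank Uh st = (case hold j of
          None \<Rightarrow> (rej, hold(j := Some i))
        | Some i' \<Rightarrow> if arank j i < arank j i'
                     then (rej(i' := insert j (rej i')), hold(j := Some i))
                     else (rej(i := insert j (rej i)), hold))"
      unfolding gs_step_def st prod.case Let_def F_def[symmetric] i_def[symmetric] j_def[symmetric]
      using False by simp
    note I = gs_invD[OF inv[unfolded st]]
    note cr = gs_inv_card_rej[OF inv[unfolded st]]
    show ?thesis
    proof (cases "hold j")
      case None
      have "gs_inv arank Uh P (rej, hold(j := Some i))"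
      proof (rule gs_invI)
        show "\<exists>i'. (hold(j := Some i)) b = Some i' \<and> arank b i' < arank b a"
          if "b \<in> rej a" for a b
          using I(4)[OF that] None by auto
      qed (use I(1-3,5) free jn jb in \<open>auto split: if_splits\<close>)
      then show ?thesis using eq None by simp
    next
      case (Some i')
      have ii: "i' \<noteq> i" using Some free by auto
      show ?thesis
      proof (cases "arank j i < arank j i'")
        case True
        have "P i' j"
          by (rule P[where i'=i and S="rej i"]) (use ii True cr jn jb I in auto)
        then have "gs_inv arank Uh P (rej(i' := insert j (rej i')), hold(j := Some i))"
        proof (intro gs_invI)
          show "\<exists>i''. (hold(j := Some i)) b = Some i'' \<and> arank b i'' < arank b a"
            if "b \<in> (rej(i' := insert j (rej i'))) a" for a b
          proof (cases "b = j")
            case bj: True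
            have "arank j i < arank j a"
            proof (cases "a = i'")
              case False
              then have "j \<in> rej a" using that bj by simp
              then show ?thesis using I(4) Some True by fastforce
            qed (use True in simp)
            then show ?thesis using bj by simp
          next
            case False
            then have "b \<in> rej a" using that by (simp split: if_splits)
            then show ?thesis using I(4) False by simp
          qed
          show "b \<notin> (rej(i' := insert j (rej i'))) a" if "(hold(j := Some i)) b = Some a" for a b
            using that I(1) jn ii by (auto split: if_splits)
          show "pbetter Uh a b b'" if "(hold(j := Some i)) b = Some a"
            "b' \<notin> (rej(i' := insert j (rej i'))) a" "b' \<noteq> b" for a b b'
            using that I(2) jb ii by (auto split: if_splits)
          show "b = b'" if "(hold(j := Some i)) b = Some a" "(hold(j := Some i)) b' = Some a" for a b b'
            using that I(3) free by (auto split: if_splits)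
          show "P a b" if "P i' j" "b \<in> (rej(i' := insert j (rej i'))) a" for a b
            using that I(5) by (auto split: if_splits)
        qed
        then show ?thesis using eq Some True by simp
      next
        case False
        have lt: "arank j i' < arank j i"
          using False ii inj[of j] by (meson inj_eq linorder_neqE_nat)
        have "P i j"
          by (rule P[where i'=i' and S="rej i'"]) (use ii lt cr I Some in auto)
        then have "gs_inv arank Uh P (rej(i := insert j (rej i)), hold)"
        proof (intro gs_invI)
          show "\<exists>i''. hold b = Some i'' \<and> arank b i'' < arank b a"
            if "b \<in> (rej(i := insert j (rej i))) a" for a b
            using that I(4) Some lt by (auto split: if_splits)
          show "b \<notin> (rej(i := insert j (rej i))) a" if "hold b = Some a" for a b
            using that I(1) free by (auto split: if_splits)
          show "pbetter Uh a b b'" if "hold b = Some a"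
            "b' \<notin> (rej(i := insert j (rej i))) a" "b' \<noteq> b" for a b b'
            using that I(2) free by (auto split: if_splits)
          show "b = b'" if "hold b = Some a" "hold b' = Some a" for a b b'
            using that I(3) by blast
          show "P a b" if "P i j" "b \<in> (rej(i := insert j (rej i))) a" for a b
            using that I(5) by (auto split: if_splits)
        qed
        then show ?thesis using eq Some False by simp
      qed
    qed
  qed
qed

text \<open>The potential counts rejections and occupied arms: a proposal to an empty arm occupies
  it, any other proposal causes exactly one rejection.\<close>

lemma gs_step_progress:
  fixes st :: "('n::{finite,linorder} \<Rightarrow> 'k::{finite,linorder} set) \<times> ('k \<Rightarrow> 'n option)"
  assumes inv: "gs_inv arank Uh P st" 
    and ne: "\<exists>i. (\<forall>j. snd st j \<noteq> Some i) \<and> fst st i \<noteq> UNIV"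
  shows "(\<Sum>i\<in>UNIV. card (fst (gs_step arank Uh st) i)) + card {j. snd (gs_step arank Uh st) j \<noteq> None}
     = Suc ((\<Sum>i\<in>UNIV. card (fst st i)) + card {j. snd st j \<noteq> None})"
proof -
  obtain rej hold where st: "st = (rej, hold)" by (cases st)
  define F where "F = {i. (\<forall>j. hold j \<noteq> Some i) \<and> rej i \<noteq> UNIV}"
  have Fne: "F \<noteq> {}" using ne unfolding F_def st by auto
  define i where "i = Min F"
  define j where "j = best_arm Uh i (- rej i)"
  have "i \<in> F" unfolding i_def using Fne by (intro Min_in) auto
  then have free: "\<And>j. hold j \<noteq> Some i" and ne: "- rej i \<noteq> {}" unfolding F_def by auto
  have jn: "j \<notin> rej i" using best_arm_best[OF ne, where Uh=Uh and i=i] unfolding j_def by auto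
  have eq: "gs_step arank Uh st = (case hold j of
        None \<Rightarrow> (rej, hold(j := Some i))
      | Some i' \<Rightarrow> if arank j i < arank j i'
                   then (rej(i' := insert j (rej i')), hold(j := Some i))
                   else (rej(i := insert j (rej i)), hold))"
    unfolding gs_step_def st prod.case Let_def F_def[symmetric] i_def[symmetric] j_def[symmetric]
    using Fne by simp
  have sums: "(\<Sum>i\<in>UNIV. card ((rej(a := insert j (rej a))) i)) = Suc (\<Sum>i\<in>UNIV. card (rej i))"
    if "j \<notin> rej a" for a
  proof -
    have "(\<Sum>i\<in>UNIV. card ((rej(a := insert j (rej a))) i))
      = card (insert j (rej a)) + (\<Sum>i\<in>UNIV - {a}. card ((rej(a := insert j (rej a))) i))"
      by (subst sum.remove[of _ a]) auto
    also have "(\<Sum>i\<in>UNIV - {a}. card ((rej(a := insert j (rej a))) i)) = (\<Sum>i\<in>UNIV - {a}. card (rej i))"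
      by (intro sum.cong) auto
    also have "card (insert j (rej a)) = Suc (card (rej a))" using that by simp
    finally show ?thesis by (subst (2) sum.remove[of _ a]) auto
  qed
  show ?thesis
  proof (cases "hold j")
    case None
    have "{j'. (hold(j := Some i)) j' \<noteq> None} = insert j {j'. hold j' \<noteq> None}" by auto
    then show ?thesis using eq None by (simp add: st)
  next
    case (Some i')
    have "{j'. (hold(j := Some i)) j' \<noteq> None} = {j'. hold j' \<noteq> None}" using Some by auto
    moreover have "j \<notin> rej i'" using gs_invD(1)[OF inv[unfolded st]] Some by blast
    ultimately show ?thesis using eq Some jn sums by (simp add: st)
  qed
qed

definition gs_final where
  "gs_final arank (Uh :: 'n::{finite,linorder} \<Rightarrow> 'k::{finite,linorder} \<Rightarrow> real) =
     (gs_step arank Uh ^^ ((CARD('n) + 1) * CARD('k))) (\<lambda>_. {}, \<lambda>_. None)"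

text \<open>While the procedure is active the potential is at least the number of steps. It is also
  below \<open>(N + 1) * K\<close>, since the active player has fewer than \<open>K\<close>
  rejections. At the end a free player would have been rejected by all \<open>K\<close> arms, but at
  most \<open>N - 1 < K\<close> rejections are possible.\<close>

lemma gs_final_complete:
  fixes Uh :: "'n::{finite,linorder} \<Rightarrow> 'k::{finite,linorder} \<Rightarrow> real"
  assumes NK: "CARD('n) \<le> CARD('k)" and inj: "\<And>j. inj (arank j)"
    and P: "\<And>i i' j S. \<lbrakk>i \<noteq> i'; arank j i' < arank j i; card S \<le> CARD('n) - 1; j \<notin> S;
              \<forall>j'. j' \<notin> S \<longrightarrow> j' \<noteq> j \<longrightarrow> pbetter Uh i' j j'; \<forall>j'\<in>S. P i' j'\<rbrakk> \<Longrightarrow> P i j"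
  shows "gs_inv arank Uh P (gs_final arank Uh)"
    and "\<exists>j. snd (gs_final arank Uh) j = Some i"
proof -
  define s where "s n = (gs_step arank Uh ^^ n) (\<lambda>_. {}, \<lambda>_. None)" for n
  have s0: "s 0 = (\<lambda>_. {}, \<lambda>_. None)" and sS: "s (Suc n) = gs_step arank Uh (s n)" for n
    unfolding s_def by auto
  have inv: "gs_inv arank Uh P (s n)" for n
  proof (induction n)
    case 0
    then show ?case by (simp add: s0 gs_inv_def)
  next
    case (Suc n)
    then show ?case unfolding sS by (rule gs_inv_step[OF _ inj P])
  qed
  define act where "act n \<longleftrightarrow> (\<exists>i. (\<forall>j. snd (s n) j \<noteq> Some i) \<and> fst (s n) i \<noteq> UNIV)" for n
  have stop: "s (Suc n) = s n" if "\<not> act n" for n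
    using that unfolding sS act_def gs_step_def by (cases "s n") auto
  define pot where "pot n = (\<Sum>i\<in>UNIV. card (fst (s n) i)) + card {j. snd (s n) j \<noteq> None}" for n
  have prog: "pot (Suc n) = Suc (pot n)" if "act n" for n
    unfolding pot_def sS using gs_step_progress[OF inv] that unfolding act_def by blast
  have grow: "\<not> act n \<or> n \<le> pot n" for n
  proof (induction n)
    case (Suc n)
    show ?case
    proof (cases "act n")
      case True
      then show ?thesis using prog[of n] Suc by auto
    next
      case False
      then have "\<not> act (Suc n)" using stop[of n] unfolding act_def by simp
      then show ?thesis by simp
    qed
  qed auto
  let ?m = "(CARD('n) + 1) * CARD('k)"
  have "\<not> act ?m"
  proof
    assume a: "act ?m"
    have "(\<Sum>i\<in>UNIV. card (fst (s ?m) i)) < (\<Sum>i\<in>(UNIV::'n set). CARD('k))"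
    proof (rule sum_strict_mono_ex1)
      show "\<forall>i\<in>UNIV. card (fst (s ?m) i) \<le> CARD('k)" by (simp add: card_mono)
      obtain i where "fst (s ?m) i \<noteq> UNIV" using a unfolding act_def by blast
      then show "\<exists>i\<in>UNIV. card (fst (s ?m) i) < CARD('k)"
        by (metis UNIV_I finite_class.finite_UNIV psubset_card_mono top.not_eq_extremum)
    qed simp
    moreover have "card {j. snd (s ?m) j \<noteq> None} \<le> CARD('k)" by (simp add: card_mono)
    ultimately have "pot ?m < ?m" unfolding pot_def by simp
    then show False using grow[of ?m] a by simp
  qed
  have f: "gs_final arank Uh = s ?m" unfolding gs_final_def s_def by simp
  show I: "gs_inv arank Uh P (gs_final arank Uh)" using inv f by simp
  obtain rej hold where rh: "s ?m = (rej, hold)" by (cases "s ?m")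
  have "card (rej i) \<le> CARD('n) - 1" using gs_inv_card_rej I f rh by metis
  moreover have "CARD('n) > 0" by simp
  ultimately have "card (rej i) < CARD('k)" using NK by linarith
  then have "rej i \<noteq> UNIV" by auto
  then show "\<exists>j. snd (gs_final arank Uh) j = Some i"
    using \<open>\<not> act ?m\<close> unfolding act_def f rh by auto
qed

lemma gale_shapley_iff:
  fixes Uh :: "'n::{finite,linorder} \<Rightarrow> 'k::{finite,linorder} \<Rightarrow> real"
  assumes "CARD('n) \<le> CARD('k)" "\<And>j. inj (arank j)"
  shows "gale_shapley arank Uh i = Some j \<longleftrightarrow> snd (gs_final arank Uh) j = Some i"
proof -
  obtain rej hold where rh: "gs_final arank Uh = (rej, hold)" by (cases "gs_final arank Uh")
  have I: "gs_inv arank Uh (\<lambda>_ _. True) (rej, hold)"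
    unfolding rh[symmetric] by (rule gs_final_complete(1)[OF assms TrueI])
  have "\<exists>j. snd (gs_final arank Uh) j = Some i" by (rule gs_final_complete(2)[OF assms TrueI])
  then obtain j0 where j0: "hold j0 = Some i" unfolding rh by auto
  have u: "hold j' = Some i \<Longrightarrow> j' = j0" for j' using gs_invD(3)[OF I] j0 by blast
  have "(THE j. hold j = Some i) = j0" using j0 u by blast
  then have "gale_shapley arank Uh i = Some j0"
    unfolding gale_shapley_def Let_def gs_final_def[symmetric] rh snd_conv using j0 by auto
  then show ?thesis using j0 u unfolding rh snd_conv by (metis option.inject)
qed

text \<open>A player strictly prefers to its own arm only arms that rejected it, and each of these
  holds someone it ranks higher. This also makes the set under \<open>Max\<close> in
  \<open>Ustar\<close> nonempty.\<close>

lemma gale_shapley_stable: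
  fixes U :: "'n::{finite,linorder} \<Rightarrow> 'k::{finite,linorder} \<Rightarrow> real"
  assumes "CARD('n) \<le> CARD('k)" "\<And>j. inj (arank j)"
  shows "stable arank U (gale_shapley arank U)"
proof -
  obtain rej hold where rh: "gs_final arank U = (rej, hold)" by (cases "gs_final arank U")
  have I: "gs_inv arank U (\<lambda>_ _. True) (rej, hold)"
    unfolding rh[symmetric] by (rule gs_final_complete(1)[OF assms TrueI])
  have "\<exists>j. snd (gs_final arank U) j = Some i" for i by (rule gs_final_complete(2)[OF assms TrueI])
  then have ex: "\<exists>j. hold j = Some i" for i unfolding rh by simp
  have iff: "gale_shapley arank U i = Some j \<longleftrightarrow> hold j = Some i" for i j
    using gale_shapley_iff[OF assms, where Uh=U] rh by simp
  show ?thesis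
    unfolding stable_def
  proof (intro conjI notI)
    show "is_matching (gale_shapley arank U)" unfolding is_matching_def iff by auto
    assume "\<exists>i j. (\<forall>i'. gale_shapley arank U i' = Some j \<longrightarrow> arank j i < arank j i') \<and>
       (case gale_shapley arank U i of None \<Rightarrow> True | Some j' \<Rightarrow> U i j' < U i j)"
    then obtain i j where b: "\<forall>i'. gale_shapley arank U i' = Some j \<longrightarrow> arank j i < arank j i'"
      "case gale_shapley arank U i of None \<Rightarrow> True | Some j' \<Rightarrow> U i j' < U i j" by blast
    obtain j' where j': "hold j' = Some i" using ex by blast
    then have lt: "U i j' < U i j" using b(2) iff by (metis option.simps(5))
    then have "\<not> pbetter U i j' j" unfolding pbetter_def by auto
    then have "j \<in> rej i" using gs_invD(2)[OF I j'] lt by auto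
    then obtain i' where "hold j = Some i'" "arank j i' < arank j i" using gs_invD(4)[OF I] by blast
    then show False using b(1) iff[of i' j] by auto
  qed
qed

text \<open>If \<open>i\<close> is unmatched then, as \<open>N \<le> K\<close>, some arm is free as
  well, and the two form a blocking pair. So the default value 0 of \<open>match_val\<close> never
  arises for a stable matching.\<close>

lemma stable_total:
  fixes \<mu> :: "('n::{finite,linorder}, 'k::{finite,linorder}) matching"
  assumes NK: "CARD('n) \<le> CARD('k)" and st: "stable arank U \<mu>"
  shows "\<mu> i \<noteq> None"
proof
  assume n: "\<mu> i = None"
  have "(\<exists>j. \<forall>i'. \<mu> i' \<noteq> Some j)"
  proof (rule ccontr)
    assume "\<not> ?thesis"
    then have "\<forall>j. \<exists>i'. \<mu> i' = Some j" by blast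
    then obtain g where g: "\<And>j. \<mu> (g j) = Some j" by metis
    have "inj g" by (metis g injI option.inject)
    moreover have "range g \<subseteq> UNIV - {i}" 
    proof
      fix a assume "a \<in> range g"
      then obtain j where "a = g j" by blast
      then show "a \<in> UNIV - {i}" using g[of j] n by auto
    qed
    ultimately have "CARD('k) \<le> card (UNIV - {i})" by (intro card_inj_on_le[of g]) auto
    moreover have "card (UNIV - {i}) < CARD('n)" by (simp add: card_Diff_singleton)
    ultimately show False using NK by linarith
  qed
  then obtain j where "\<forall>i'. \<mu> i' \<noteq> Some j" by blast
  then have "(\<forall>i'. \<mu> i' = Some j \<longrightarrow> arank j i < arank j i') \<and>
      (case \<mu> i of None \<Rightarrow> True | Some j' \<Rightarrow> U i j > U i j')" using n by simp
  then show False using st unfolding stable_def by blast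
qed

text \<open>The classical optimality argument with two utilities: the run uses \<open>Uh\<close>,
  stability refers to \<open>U\<close>. If \<open>j = \<mu> i\<close> rejected \<open>i\<close> for
  \<open>i'\<close>, then \<open>i'\<close> has not been rejected by its own partner under
  \<open>\<mu>\<close>, so \<open>i'\<close> and \<open>j\<close> would block \<open>\<mu>\<close>.
  By \<open>gs_inv_card_rej\<close> the run only compares a best arm outside at most
  \<open>N - 1\<close> arms with the remaining ones, so \<open>sep\<close> demands agreement there
  and nowhere else.\<close>

lemma gale_shapley_optimal:
  fixes U Uh :: "'n::{finite,linorder} \<Rightarrow> 'k::{finite,linorder} \<Rightarrow> real"
  assumes NK: "CARD('n) \<le> CARD('k)" and inj: "\<And>j. inj (arank j)"
    and sep: "\<And>i j j' S. \<lbrakk>card S \<le> CARD('n) - 1; j \<notin> S; \<forall>j'. j' \<notin> S \<longrightarrow> j' \<noteq> j \<longrightarrow> pbetter Uh i j j';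
                j' \<notin> S; j' \<noteq> j\<rbrakk> \<Longrightarrow> U i j > U i j'"
    and st: "stable arank U \<mu>"
  shows "match_val U \<mu> i \<le> match_val U (gale_shapley arank Uh) i"
proof -
  define P where "P i j \<longleftrightarrow> \<mu> i \<noteq> Some j" for i j
  have P: "P i j" if a: "i \<noteq> i'" "arank j i' < arank j i" "card S \<le> CARD('n) - 1" "j \<notin> S"
              "\<forall>j'. j' \<notin> S \<longrightarrow> j' \<noteq> j \<longrightarrow> pbetter Uh i' j j'" "\<forall>j'\<in>S. P i' j'" for i i' j S
    unfolding P_def
  proof
    assume m: "\<mu> i = Some j"
    have mt: "is_matching \<mu>" using st unfolding stable_def by simp
    obtain j' where j': "\<mu> i' = Some j'" using stable_total[OF NK st] by blast
    have "j' \<noteq> j" using m j' mt a(1) unfolding is_matching_def by blast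
    moreover have "j' \<notin> S" using a(6) j' unfolding P_def by auto
    ultimately have lt: "U i' j > U i' j'" using sep a(3-5) by blast
    have "\<forall>i''. \<mu> i'' = Some j \<longrightarrow> arank j i' < arank j i''"
      using mt m a(2) unfolding is_matching_def by metis
    then have "(\<forall>i''. \<mu> i'' = Some j \<longrightarrow> arank j i' < arank j i'') \<and>
      (case \<mu> i' of None \<Rightarrow> True | Some j' \<Rightarrow> U i' j > U i' j')" using lt j' by simp
    then show False using st unfolding stable_def by blast
  qed
  obtain rej hold where rh: "gs_final arank Uh = (rej, hold)" by (cases "gs_final arank Uh")
  have I: "gs_inv arank Uh P (rej, hold)"
    unfolding rh[symmetric] by (rule gs_final_complete(1)[OF NK inj]) (rule P)
  have "\<exists>j. snd (gs_final arank Uh) j = Some i"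
    by (rule gs_final_complete(2)[OF NK inj]) (rule P)
  then obtain j where j: "hold j = Some i" unfolding rh by auto
  have g: "gale_shapley arank Uh i = Some j" using j gale_shapley_iff[OF NK inj, where Uh=Uh] rh by simp
  obtain j' where j': "\<mu> i = Some j'" using stable_total[OF NK st] by blast
  have "j' \<notin> rej i" using gs_invD(5)[OF I] j' unfolding P_def by blast
  moreover have "j \<notin> rej i" "\<forall>j'. j' \<notin> rej i \<longrightarrow> j' \<noteq> j \<longrightarrow> pbetter Uh i j j'"
    using gs_invD(1,2)[OF I j] by auto
  ultimately have "U i j' \<le> U i j"
    using sep[OF gs_inv_card_rej[OF I]] by (cases "j' = j") (auto intro: less_imp_le)
  then show ?thesis unfolding match_val_def g j' by simp
qed

text \<open>The run sees utilities only through the preference order, of which there are finitely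
  many. This gives its measurability later.\<close>

lemma gale_shapley_cong:
  assumes "pbetter Uh = pbetter Uh'"
  shows "gale_shapley arank Uh = gale_shapley arank Uh'"
proof -
  have "best_arm Uh = best_arm Uh'" unfolding best_arm_def assms ..
  then have "gs_step arank Uh = gs_step arank Uh'" unfolding gs_step_def by (rule ssubst) (rule refl)
  then show ?thesis unfolding gale_shapley_def by simp
qed

section \<open>Order statistics\<close>

text \<open>In a descending list an upward closed predicate holds exactly on an initial
  segment.\<close>

lemma sorted_desc_nth_iff:
  fixes xs :: "'a::linorder list"
  assumes "sorted_wrt (\<ge>) xs" "\<And>x y. P x \<Longrightarrow> x \<le> y \<Longrightarrow> P y" "q < length xs"
  shows "P (xs ! q) \<longleftrightarrow> q < length (filter P xs)"
  using assms(1,3)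
proof (induction xs arbitrary: q)
  case (Cons x xs)
  show ?case
  proof (cases "P x")
    case True
    then show ?thesis using Cons by (cases q) auto
  next
    case False
    then have "\<not> P y" if "y \<in> set (x # xs)" for y
      using Cons.prems(1) assms(2) that by auto
    then show ?thesis using Cons.prems(2) by (metis filter_False length_0_conv not_less_zero nth_mem)
  qed
qed simp

definition desc_vals :: "('k::{finite,linorder} \<Rightarrow> real) \<Rightarrow> real list" where
  "desc_vals f = rev (sort (map f (sorted_list_of_set UNIV)))"

lemma length_desc_vals [simp]: "length (desc_vals (f :: 'k::{finite,linorder} \<Rightarrow> real)) = CARD('k)"
  unfolding desc_vals_def by simp

text \<open>Order statistics by counting: positions in a sorted list are traded for cardinalities of
  level sets, which serve the combinatorial arguments and measurability alike.\<close>

lemma desc_vals_nth_iff: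
  fixes f :: "'k::{finite,linorder} \<Rightarrow> real"
  assumes "\<And>x y. P x \<Longrightarrow> x \<le> y \<Longrightarrow> P y" "q < CARD('k)"
  shows "P (desc_vals f ! q) \<longleftrightarrow> q < card {j. P (f j)}"
proof -
  let ?xs = "map f (sorted_list_of_set UNIV)"
  have "sorted_wrt (\<ge>) (desc_vals f)"
    unfolding desc_vals_def sorted_wrt_rev by simp
  then have "P (desc_vals f ! q) \<longleftrightarrow> q < length (filter P (desc_vals f))"
    using assms by (intro sorted_desc_nth_iff) auto
  also have "mset (desc_vals f) = mset ?xs" unfolding desc_vals_def by simp
  then have "length (filter P (desc_vals f)) = length (filter P ?xs)" by (metis mset_filter size_mset)
  also have "\<dots> = length (filter (P \<circ> f) (sorted_list_of_set UNIV))"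
    by (simp add: filter_map)
  also have "\<dots> = card (set (filter (P \<circ> f) (sorted_list_of_set UNIV)))"
    by (intro distinct_card[symmetric]) simp
  also have "set (filter (P \<circ> f) (sorted_list_of_set UNIV)) = {j. P (f j)}" by simp
  finally show ?thesis .
qed

lemma small_gap_iff:
  fixes Uh :: "'n::{finite,linorder} \<Rightarrow> 'k::{finite,linorder} \<Rightarrow> real"
  shows "small_gap N Uh i Del \<longleftrightarrow>
    (\<exists>m. m + 1 < CARD('k) \<and> m < N \<and> desc_vals (Uh i) ! m - desc_vals (Uh i) ! (m + 1) \<le> 2 * Del)"
proof -
  have *: "m + 1 < length (take (N + 1) (desc_vals (Uh i))) \<longleftrightarrow> m + 1 < CARD('k) \<and> m < N" for m
    by auto
  have "small_gap N Uh i Del \<longleftrightarrow> (\<exists>m. m + 1 < length (take (N + 1) (desc_vals (Uh i))) \<and>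
      take (N + 1) (desc_vals (Uh i)) ! m - take (N + 1) (desc_vals (Uh i)) ! (m + 1) \<le> 2 * Del)"
    unfolding small_gap_def Let_def desc_vals_def ..
  then show ?thesis unfolding * by (metis add_less_mono1 less_SucI nth_take Suc_eq_plus1)
qed

text \<open>Let \<open>p\<close> arms be strictly better than \<open>j\<close>. They lie in
  \<open>S\<close>, so \<open>p < N\<close> and the gap after position \<open>p\<close> is among
  those inspected; this is where the top \<open>N + 1\<close> values are needed. The entry at
  \<open>p\<close> is at most \<open>Uh i j\<close> and the next one at least
  \<open>Uh i j'\<close>, so the inspected gap is no larger than the difference in question.\<close>

lemma not_small_gap_separated:
  fixes Uh :: "'n::{finite,linorder} \<Rightarrow> 'k::{finite,linorder} \<Rightarrow> real"
  assumes ng: "\<not> small_gap CARD('n) Uh i Del" and S: "card S \<le> CARD('n) - 1"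
    and best: "j \<notin> S" "\<forall>j'. j' \<notin> S \<longrightarrow> j' \<noteq> j \<longrightarrow> pbetter Uh i j j'" and j': "j' \<notin> S" "j' \<noteq> j"
  shows "Uh i j - Uh i j' > 2 * Del"
proof (rule ccontr)
  assume n: "\<not> ?thesis"
  define p where "p = card {a. Uh i a > Uh i j}"
  have "{a. Uh i a > Uh i j} \<subseteq> S"
  proof
    fix a assume "a \<in> {a. Uh i a > Uh i j}"
    then show "a \<in> S" using best(2) unfolding pbetter_def by force
  qed
  then have "p \<le> card S" unfolding p_def by (intro card_mono) auto
  moreover have "CARD('n) > 0" by simp
  ultimately have pn: "p < CARD('n)" using S by linarith
  have le: "Uh i j' \<le> Uh i j" using best(2) j' unfolding pbetter_def by force
  have "insert j (insert j' {a. Uh i a > Uh i j}) \<subseteq> {a. Uh i a \<ge> Uh i j'}" using le by auto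
  then have "card (insert j (insert j' {a. Uh i a > Uh i j})) \<le> card {a. Uh i a \<ge> Uh i j'}"
    by (intro card_mono) auto
  moreover have "card (insert j (insert j' {a. Uh i a > Uh i j})) = p + 2"
    using j'(2) le unfolding p_def by (subst card_insert_disjoint; auto simp: card_insert_if)
  ultimately have c2: "p + 1 < card {a. Uh i a \<ge> Uh i j'}" by simp
  also have "\<dots> \<le> CARD('k)" by (intro card_mono) auto
  finally have pk: "p + 1 < CARD('k)" .
  have "desc_vals (Uh i) ! (p + 1) \<ge> Uh i j'"
    using desc_vals_nth_iff[of "\<lambda>z. z \<ge> Uh i j'" "p + 1" "Uh i"] pk c2 by auto
  moreover have "\<not> desc_vals (Uh i) ! p > Uh i j"
    using desc_vals_nth_iff[of "\<lambda>z. z > Uh i j" p "Uh i"] pk unfolding p_def by auto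
  ultimately have "desc_vals (Uh i) ! p - desc_vals (Uh i) ! (p + 1) \<le> 2 * Del" using n by linarith
  then show False using ng pk pn unfolding small_gap_iff by blast
qed

text \<open>At least \<open>m + 2\<close> arms reach the lower value of the gap and at most
  \<open>m\<close> exceed the upper one, so two arms lie in between. Counting arms in place of
  entries handles ties.\<close>

lemma small_gap_close_pair:
  fixes Uh :: "'n::{finite,linorder} \<Rightarrow> 'k::{finite,linorder} \<Rightarrow> real"
  assumes "small_gap N Uh i Del"
  shows "\<exists>j j'. j \<noteq> j' \<and> \<bar>Uh i j - Uh i j'\<bar> \<le> 2 * Del"
proof -
  obtain m where m: "m + 1 < CARD('k)" "desc_vals (Uh i) ! m - desc_vals (Uh i) ! (m + 1) \<le> 2 * Del"
    using assms unfolding small_gap_iff by blast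
  define v where "v = desc_vals (Uh i) ! m"
  define v' where "v' = desc_vals (Uh i) ! (m + 1)"
  have 1: "m + 1 < card {j. v' \<le> Uh i j}"
    using desc_vals_nth_iff[of "\<lambda>z. v' \<le> z" "m + 1" "Uh i"] m unfolding v'_def by auto
  have 2: "\<not> m < card {j. v < Uh i j}"
    using desc_vals_nth_iff[of "\<lambda>z. v < z" "m" "Uh i"] m unfolding v_def by auto
  have "card {j. v' \<le> Uh i j} \<le> card ({j. v' \<le> Uh i j \<and> Uh i j \<le> v} \<union> {j. v < Uh i j})"
    by (intro card_mono) auto
  also have "\<dots> \<le> card {j. v' \<le> Uh i j \<and> Uh i j \<le> v} + card {j. v < Uh i j}" by (rule card_Un_le)
  finally have "\<not> card {j. v' \<le> Uh i j \<and> Uh i j \<le> v} \<le> Suc 0" using 1 2 by linarith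
  then obtain j j' where "v' \<le> Uh i j \<and> Uh i j \<le> v" "v' \<le> Uh i j' \<and> Uh i j' \<le> v" "j \<noteq> j'"
    using card_le_Suc0_iff_eq[of "{j. v' \<le> Uh i j \<and> Uh i j \<le> v}"] by auto
  moreover then have "\<bar>Uh i j - Uh i j'\<bar> \<le> 2 * Del" using m(2) unfolding v_def v'_def by linarith
  ultimately show ?thesis by blast
qed

lemma finite_delta_min_set:
  "finite {\<bar>(\<theta> :: 'n::{finite,linorder} \<Rightarrow> (real, 'd::finite) vec) i \<bullet> (x $ j - x $ j')\<bar> | i (j::'k::{finite,linorder}) j'. j \<noteq> j'}"
proof (rule finite_subset)
  show "{\<bar>\<theta> i \<bullet> (x $ j - x $ j')\<bar> | i j j'. j \<noteq> j'} \<subseteq> (\<lambda>(i, j, j'). \<bar>\<theta> i \<bullet> (x $ j - x $ j')\<bar>) ` UNIV"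
  proof
    fix v assume "v \<in> {\<bar>\<theta> i \<bullet> (x $ j - x $ j')\<bar> | i j j'. j \<noteq> j'}"
    then obtain i j j' where "v = (\<lambda>(i, j, j'). \<bar>\<theta> i \<bullet> (x $ j - x $ j')\<bar>) (i, j, j')" by auto
    then show "v \<in> (\<lambda>(i, j, j'). \<bar>\<theta> i \<bullet> (x $ j - x $ j')\<bar>) ` UNIV" by (rule image_eqI) simp
  qed
qed simp

text \<open>The 4 is the estimated gap \<open>2 * Del\<close> plus an estimation error
  \<open>Del\<close> for each of the two arms.\<close>

lemma small_gap_delta_min:
  assumes "small_gap N Uh i Del" "\<And>j. \<bar>Uh i j - util \<theta> x i j\<bar> \<le> Del"
  shows "delta_min \<theta> x \<le> 4 * Del"
proof -
  obtain j j' where jj: "j \<noteq> j'" "\<bar>Uh i j - Uh i j'\<bar> \<le> 2 * Del" using small_gap_close_pair[OF assms(1)] by blast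
  have "delta_min \<theta> x \<le> \<bar>\<theta> i \<bullet> (x $ j - x $ j')\<bar>"
    unfolding delta_min_def using jj(1) by (intro Min_le finite_delta_min_set) blast
  also have "\<dots> = \<bar>util \<theta> x i j - util \<theta> x i j'\<bar>" unfolding util_def by (simp add: inner_diff_right)
  also have "\<dots> \<le> 4 * Del" using assms(2)[of j] assms(2)[of j'] jj(2) by linarith
  finally show ?thesis .
qed

lemma finite_stable_vals: "finite {match_val (U :: 'n::{finite,linorder} \<Rightarrow> 'k::{finite,linorder} \<Rightarrow> real) \<mu> i | \<mu>. stable arank U \<mu>}"
proof (rule finite_subset)
  show "{match_val U \<mu> i | \<mu>. stable arank U \<mu>} \<subseteq> (\<lambda>\<mu>. match_val U \<mu> i) ` UNIV" by blast
qed simp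

lemma Ustar_attained:
  fixes \<theta> :: "'n::{finite,linorder} \<Rightarrow> (real, 'd::finite) vec" and x :: "((real, 'd) vec, 'k::{finite,linorder}) vec"
  assumes "CARD('n) \<le> CARD('k)" "\<And>j. inj (arank j)"
  obtains \<mu> where "stable arank (util \<theta> x) \<mu>" "Ustar arank \<theta> x i = match_val (util \<theta> x) \<mu> i"
proof -
  have "Ustar arank \<theta> x i \<in> {match_val (util \<theta> x) \<mu> i | \<mu>. stable arank (util \<theta> x) \<mu>}"
    unfolding Ustar_def
  proof (rule Max_in[OF finite_stable_vals])
    have "stable arank (util \<theta> x) (gale_shapley arank (util \<theta> x))" by (rule gale_shapley_stable[OF assms])
    then show "{match_val (util \<theta> x) \<mu> i | \<mu>. stable arank (util \<theta> x) \<mu>} \<noteq> {}" by blast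
  qed
  then show ?thesis using that by blast
qed

lemma Ustar_le_no_small_gap:
  fixes \<theta> :: "'n::{finite,linorder} \<Rightarrow> (real, 'd::finite) vec" and x :: "((real, 'd) vec, 'k::{finite,linorder}) vec"
  assumes NK: "CARD('n) \<le> CARD('k)" and inj: "\<And>j. inj (arank j)"
    and close: "\<And>i j. \<bar>Uh i j - util \<theta> x i j\<bar> \<le> Del"
    and ng: "\<And>i. \<not> small_gap CARD('n) Uh i Del"
  shows "Ustar arank \<theta> x i \<le> match_val (util \<theta> x) (gale_shapley arank Uh) i"
proof -
  obtain \<mu> where \<mu>: "stable arank (util \<theta> x) \<mu>" "Ustar arank \<theta> x i = match_val (util \<theta> x) \<mu> i"
    by (rule Ustar_attained[OF NK inj])
  \<comment> \<open>An estimated gap above \<open>2 * Del\<close> keeps its sign under an error of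
    at most \<open>Del\<close> for each arm.\<close>
  have "util \<theta> x i j > util \<theta> x i j'"
    if "card S \<le> CARD('n) - 1" "j \<notin> S" "\<forall>j'. j' \<notin> S \<longrightarrow> j' \<noteq> j \<longrightarrow> pbetter Uh i j j'" "j' \<notin> S" "j' \<noteq> j"
    for i j j' S
    using not_small_gap_separated[OF ng that] close[of i j] close[of i j'] by linarith
  then show ?thesis unfolding \<mu>(2) by (rule gale_shapley_optimal[OF NK inj _ \<mu>(1)])
qed

section \<open>The regularised Gram matrix\<close>

definition outer :: "(real, 'd::finite) vec \<Rightarrow> ((real, 'd) vec, 'd) vec" where
  "outer x = (\<chi> a b. x $ a * x $ b)"

definition resp :: "(((real, 'd::finite) vec) \<times> real) list \<Rightarrow> (real, 'd) vec" where
  "resp D = sum_list (map (\<lambda>(x, y). y *\<^sub>R x) D)"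

lemma gram_Nil [simp]: "gram lam [] = mat lam"
  unfolding gram_def by simp

lemma gram_snoc [simp]: "gram lam (D @ [p]) = gram lam D + outer (fst p)"
  unfolding gram_def outer_def by (cases p) simp

lemma resp_Nil [simp]: "resp [] = 0"
  unfolding resp_def by simp

lemma resp_snoc [simp]: "resp (D @ [(x, y)]) = resp D + y *\<^sub>R x"
  unfolding resp_def by simp

lemma ridge_est_eq: "ridge_est lam D = matrix_inv (gram lam D) *v resp D"
  unfolding ridge_est_def resp_def ..

lemma rank_one_mult_vec:
  fixes x y u :: "(real, 'd::finite) vec"
  shows "(\<chi> a b. y $ a * x $ b) *v u = (x \<bullet> u) *\<^sub>R y"
  unfolding matrix_vector_mult_def inner_vec_def vec_eq_iff
  by (simp add: sum_distrib_right sum_distrib_left mult_ac)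

lemma outer_mult_vec: "outer x *v w = (x \<bullet> w) *\<^sub>R x"
  unfolding outer_def by (rule rank_one_mult_vec)

lemma mat_mult_vec: "mat (lam::real) *v w = lam *\<^sub>R (w :: (real, 'd::finite) vec)"
  unfolding mat_def matrix_vector_mult_def vec_eq_iff
  by (simp add: if_distrib[of "\<lambda>z. z * _"] cong: if_cong)

lemma inner_gram:
  "u \<bullet> (gram lam D *v w) = lam * (u \<bullet> w) + (\<Sum>p\<leftarrow>D. (fst p \<bullet> u) * (fst p \<bullet> w))"
proof (induction D rule: rev_induct)
  case Nil
  then show ?case by (simp add: mat_mult_vec)
next
  case (snoc p D)
  then show ?case
    by (simp add: matrix_vector_mult_add_rdistrib outer_mult_vec inner_add_right inner_commute)
qed

lemma gram_sym: "u \<bullet> (gram lam D *v w) = w \<bullet> (gram lam D *v u)"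
  unfolding inner_gram by (simp add: inner_commute mult.commute)

lemma gram_quad_lower: "lam * (norm w)\<^sup>2 \<le> w \<bullet> (gram lam D *v w)"
proof -
  have "0 \<le> (\<Sum>p\<leftarrow>D. (fst p \<bullet> w) * (fst p \<bullet> w))" by (intro sum_list_nonneg) auto
  then show ?thesis unfolding inner_gram by (simp add: power2_norm_eq_inner)
qed

lemma gram_quad_upper:
  fixes B :: real
  assumes "\<And>p. p \<in> set D \<Longrightarrow> norm (fst p) \<le> B"
  shows "w \<bullet> (gram lam D *v w) \<le> (lam + real (length D) * B\<^sup>2) * (norm w)\<^sup>2"
  using assms
proof (induction D rule: rev_induct)
  case Nil
  then show ?case by (simp add: mat_mult_vec power2_norm_eq_inner)
next
  case (snoc p D)
  have "norm (fst p) \<le> B" using snoc.prems by simp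
  then have "\<bar>fst p \<bullet> w\<bar> \<le> B * norm w"
    by (meson Cauchy_Schwarz_ineq2 mult_right_mono norm_ge_zero order_trans)
  then have "\<bar>fst p \<bullet> w\<bar>\<^sup>2 \<le> (B * norm w)\<^sup>2" by (intro power_mono) auto
  then have "(fst p \<bullet> w) * (fst p \<bullet> w) \<le> B\<^sup>2 * (norm w)\<^sup>2"
    by (simp add: power2_eq_square mult_ac)
  moreover have "w \<bullet> (gram lam D *v w) \<le> (lam + real (length D) * B\<^sup>2) * (norm w)\<^sup>2"
    using snoc by simp
  ultimately show ?case
    by (simp add: matrix_vector_mult_add_rdistrib outer_mult_vec inner_add_right inner_commute algebra_simps)
qed

lemma gram_invertible:
  assumes "lam > 0"
  shows "invertible (gram lam D)"
proof -
  have "w = 0" if "gram lam D *v w = 0" for w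
  proof -
    have "lam * (norm w)\<^sup>2 \<le> 0" using gram_quad_lower[of lam w D] that by simp
    then show ?thesis using assms by (simp add: mult_le_0_iff)
  qed
  then show ?thesis unfolding invertible_left_inverse matrix_left_invertible_ker by blast
qed

lemma matrix_inv_props:
  fixes A :: "((real, 'd::finite) vec, 'd) vec"
  assumes "invertible A"
  shows "A ** matrix_inv A = mat 1" "matrix_inv A ** A = mat 1"
  using someI_ex[OF assms[unfolded invertible_def]] unfolding matrix_inv_def by auto

lemma gram_inv_cancel:
  assumes "lam > 0"
  shows "gram lam D *v (matrix_inv (gram lam D) *v w) = w"
    and "matrix_inv (gram lam D) *v (gram lam D *v w) = w"
  using matrix_inv_props[OF gram_invertible[OF assms, of D]]
  by (simp_all add: matrix_vector_mul_assoc)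

abbreviation gram_inv where "gram_inv lam D \<equiv> matrix_inv (gram lam D)"

lemma inner_gram_inv:
  assumes "lam > 0"
  shows "u \<bullet> (gram_inv lam D *v w) = (gram_inv lam D *v u) \<bullet> (gram lam D *v (gram_inv lam D *v w))"
proof -
  have "u \<bullet> (gram_inv lam D *v w) = (gram_inv lam D *v w) \<bullet> (gram lam D *v (gram_inv lam D *v u))"
    using gram_inv_cancel(1)[OF assms, of D u] by (simp add: inner_commute)
  then show ?thesis using gram_sym by metis
qed

lemma gram_inv_nonneg:
  assumes "lam > 0"
  shows "0 \<le> w \<bullet> (gram_inv lam D *v w)"
proof -
  have "0 \<le> lam * (norm (gram_inv lam D *v w))\<^sup>2" using assms by simp
  also have "\<dots> \<le> w \<bullet> (gram_inv lam D *v w)"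
    unfolding inner_gram_inv[OF assms] by (rule gram_quad_lower)
  finally show ?thesis .
qed

lemma wnorm_gram_inv_sq:
  assumes "lam > 0"
  shows "(wnorm (gram_inv lam D) w)\<^sup>2 = w \<bullet> (gram_inv lam D *v w)"
  unfolding wnorm_def using gram_inv_nonneg[OF assms] by simp

lemma wnorm_gram_inv_nonneg: "lam > 0 \<Longrightarrow> 0 \<le> wnorm (gram_inv lam D) w"
  unfolding wnorm_def using gram_inv_nonneg by simp

lemma gram_cauchy_schwarz:
  assumes "lam > 0"
  shows "(z \<bullet> (gram lam D *v w))\<^sup>2 \<le> (z \<bullet> (gram lam D *v z)) * (w \<bullet> (gram lam D *v w))"
proof (cases "w = 0")
  case False
  define b where "b = w \<bullet> (gram lam D *v w)"
  define c where "c = z \<bullet> (gram lam D *v w)"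
  have "0 < lam * (norm w)\<^sup>2" using assms False by simp
  then have b: "b > 0" using gram_quad_lower[of lam w D] unfolding b_def by linarith
  \<comment> \<open>The component of \<open>z\<close> orthogonal to \<open>w\<close> in the Gram
    inner product.\<close>
  define v where "v = z - (c / b) *\<^sub>R w"
  have "0 \<le> lam * (norm v)\<^sup>2" using assms by simp
  also have "\<dots> \<le> v \<bullet> (gram lam D *v v)" by (rule gram_quad_lower)
  also have "\<dots> = z \<bullet> (gram lam D *v z) - (c / b) * c - (c / b) * c + (c / b) * (c / b) * b"
    unfolding v_def using gram_sym[of w lam D z]
    by (simp add: matrix_vector_mult_diff_distrib inner_diff_left inner_diff_right
        matrix_vector_mult_scaleR b_def c_def algebra_simps)
  also have "\<dots> = z \<bullet> (gram lam D *v z) - c\<^sup>2 / b" using b by (simp add: power2_eq_square)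
  finally show ?thesis using b unfolding b_def[symmetric] c_def[symmetric] by (simp add: field_simps)
qed simp

lemma gram_inv_cauchy_schwarz:
  assumes "lam > 0"
  shows "\<bar>u \<bullet> (gram_inv lam D *v w)\<bar> \<le> wnorm (gram_inv lam D) u * wnorm (gram_inv lam D) w"
proof -
  have "(u \<bullet> (gram_inv lam D *v w))\<^sup>2 \<le> (wnorm (gram_inv lam D) u)\<^sup>2 * (wnorm (gram_inv lam D) w)\<^sup>2"
    unfolding wnorm_gram_inv_sq[OF assms] inner_gram_inv[OF assms] by (rule gram_cauchy_schwarz[OF assms])
  then have "\<bar>u \<bullet> (gram_inv lam D *v w)\<bar>\<^sup>2 \<le> (wnorm (gram_inv lam D) u * wnorm (gram_inv lam D) w)\<^sup>2"
    by (simp add: power_mult_distrib)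
  then show ?thesis
    using wnorm_gram_inv_nonneg[OF assms] by (meson mult_nonneg_nonneg power2_le_imp_le)
qed

text \<open>The inverse Gram form is at most \<open>1 / lam\<close> times the squared norm. With
  \<open>z\<close> the image of \<open>w\<close> under the inverse,
  \<open>lam * (norm z)\<^sup>2\<close> is at most the inner product of \<open>w\<close> and
  \<open>z\<close>, so \<open>lam * norm z \<le> norm w\<close>; no spectral decomposition is
  involved.\<close>

lemma wnorm_gram_inv_le:
  assumes "lam > 0"
  shows "sqrt lam * wnorm (gram_inv lam D) w \<le> norm w"
proof -
  define z where "z = gram_inv lam D *v w"
  have 1: "lam * (norm z)\<^sup>2 \<le> w \<bullet> z"
    unfolding z_def inner_gram_inv[OF assms, of w D w] by (rule gram_quad_lower)
  have 2: "w \<bullet> z \<le> norm w * norm z" by (rule norm_cauchy_schwarz)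
  have "lam * (w \<bullet> z) \<le> (norm w)\<^sup>2"
  proof (cases "z = 0")
    case False
    then have "lam * norm z \<le> norm w" using 1 2
      by (simp add: power2_eq_square) (metis mult.assoc mult_le_cancel_right_pos order_trans zero_less_norm_iff)
    then have "lam * norm z * norm w \<le> norm w * norm w" by (intro mult_right_mono) auto
    moreover have "lam * (w \<bullet> z) \<le> lam * (norm w * norm z)" using 2 assms by simp
    ultimately show ?thesis by (simp add: power2_eq_square mult_ac)
  qed simp
  then have "(sqrt lam * wnorm (gram_inv lam D) w)\<^sup>2 \<le> (norm w)\<^sup>2"
    using assms by (simp add: power_mult_distrib wnorm_gram_inv_sq z_def)
  then show ?thesis by (rule power2_le_imp_le) simp
qed

text \<open>The sum of noise times context over the data, as \<open>noise_sum_snoc\<close> shows. It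
  is expressed through \<open>resp\<close> and \<open>gram\<close> so that it is measurable as soon
  as they are.\<close>

definition noise_sum :: "real \<Rightarrow> (real, 'd::finite) vec \<Rightarrow> (((real, 'd) vec) \<times> real) list \<Rightarrow> (real, 'd) vec" where
  "noise_sum lam th D = resp D - gram lam D *v th + lam *\<^sub>R th"

lemma noise_sum_Nil [simp]: "noise_sum lam th [] = 0"
  unfolding noise_sum_def by (simp add: mat_mult_vec)

lemma noise_sum_snoc [simp]:
  "noise_sum lam th (D @ [(x, y)]) = noise_sum lam th D + (y - th \<bullet> x) *\<^sub>R x"
  unfolding noise_sum_def
  by (simp add: matrix_vector_mult_add_rdistrib outer_mult_vec scaleR_diff_left inner_commute)

text \<open>The error is the inverse Gram matrix applied to \<open>noise_sum\<close> minus
  \<open>lam\<close> times the same matrix applied to \<open>th\<close>. Cauchy-Schwarz in the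
  inverse Gram form splits off \<open>wnorm\<close> of \<open>x\<close>; the second term is the
  regularisation bias, of weighted size at most \<open>sqrt lam * norm th\<close>.\<close>

lemma ridge_est_error:
  assumes "lam > 0"
  shows "\<bar>(ridge_est lam D - th) \<bullet> x\<bar> \<le>
    wnorm (gram_inv lam D) x * (wnorm (gram_inv lam D) (noise_sum lam th D) + sqrt lam * norm th)"
proof -
  let ?W = "gram_inv lam D"
  have "ridge_est lam D - th = ?W *v resp D - ?W *v (gram lam D *v th)"
    unfolding ridge_est_eq gram_inv_cancel(2)[OF assms] ..
  also have "\<dots> = ?W *v (noise_sum lam th D) - lam *\<^sub>R (?W *v th)"
    unfolding noise_sum_def
    by (simp add: matrix_vector_mult_diff_distrib matrix_vector_right_distrib matrix_vector_mult_scaleR)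
  finally have "(ridge_est lam D - th) \<bullet> x = x \<bullet> (?W *v (noise_sum lam th D)) - lam * (x \<bullet> (?W *v th))"
    by (simp add: inner_diff_right inner_commute[of _ x])
  moreover have "\<bar>lam * (x \<bullet> (?W *v th))\<bar> \<le> wnorm ?W x * (sqrt lam * norm th)"
  proof -
    have "\<bar>lam * (x \<bullet> (?W *v th))\<bar> \<le> lam * (wnorm ?W x * wnorm ?W th)"
      using gram_inv_cauchy_schwarz[OF assms, of x D th] assms by (simp add: abs_mult)
    also have "\<dots> = wnorm ?W x * (sqrt lam * (sqrt lam * wnorm ?W th))"
      using assms by simp
    also have "\<dots> \<le> wnorm ?W x * (sqrt lam * norm th)"
      using wnorm_gram_inv_le[OF assms, of D th] wnorm_gram_inv_nonneg[OF assms, of D x] assms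
      by (intro mult_left_mono) auto
    finally show ?thesis .
  qed
  ultimately show ?thesis
    using gram_inv_cauchy_schwarz[OF assms, of x D "noise_sum lam th D"] by (simp add: distrib_left)
qed

subsection \<open>Determinants\<close>

text \<open>A rotation takes \<open>x\<close> to a multiple of a coordinate axis. The matrix then
  becomes the identity with a single column replaced, and \<open>cramer_lemma\<close> reads off its
  determinant.\<close>

lemma det_one_plus_rank_one:
  fixes x y :: "(real, 'd::finite) vec"
  shows "det (mat 1 + (\<chi> a b. y $ a * x $ b)) = 1 + x \<bullet> y"
proof -
  obtain k :: 'd where True by simp
  obtain f where f: "orthogonal_transformation f" "f x = norm x *\<^sub>R axis k (1::real)"
    using orthogonal_transformation_exists[of x "norm x *\<^sub>R axis k (1::real)"] by (auto simp: norm_axis_1)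
  define Q where "Q = matrix f"
  have fQ: "f w = Q *v w" for w
    unfolding Q_def using f(1) by (simp add: matrix_works orthogonal_transformation_linear)
  have Q: "transpose Q ** Q = mat 1" "Q ** transpose Q = mat 1"
    using f(1) unfolding orthogonal_transformation_matrix Q_def orthogonal_matrix_def by auto
  have dQ: "det Q * det (transpose Q) = 1" by (metis Q(2) det_I det_mul)
  let ?A = "mat 1 + (\<chi> a b. y $ a * x $ b) :: ((real, 'd) vec, 'd) vec"
  \<comment> \<open>The column that replaces column \<open>k\<close> of the identity after the
    rotation.\<close>
  define z where "z = axis k 1 + norm x *\<^sub>R (Q *v y)"
  have "Q ** ?A ** transpose Q = (\<chi> i j. if j = k then (mat 1 *v z) $ i else mat 1 $ i $ j)"
  proof -
    have "(Q ** ?A ** transpose Q) *v w = (\<chi> i j. if j = k then (mat 1 *v z) $ i else mat 1 $ i $ j) *v w" for w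
    proof -
      have xQ: "x \<bullet> (transpose Q *v w) = norm x * w $ k"
      proof -
        have "x \<bullet> (transpose Q *v w) = (Q *v x) \<bullet> w"
          by (metis dot_lmul_matrix inner_commute transpose_matrix_vector)
        also have "\<dots> = norm x * w $ k" using f(2) fQ by (simp add: inner_axis')
        finally show ?thesis .
      qed
      have "(Q ** ?A ** transpose Q) *v w = Q *v (?A *v (transpose Q *v w))"
        by (simp only: matrix_vector_mul_assoc matrix_mul_assoc)
      also have "\<dots> = Q *v (transpose Q *v w) + Q *v ((norm x * w $ k) *\<^sub>R y)"
        by (simp add: matrix_vector_mult_add_rdistrib rank_one_mult_vec xQ matrix_vector_right_distrib
            del: transpose_matrix_vector)
      also have "\<dots> = w + (norm x * w $ k) *\<^sub>R (Q *v y)"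
        using Q(2) by (simp add: matrix_vector_mul_assoc matrix_vector_mult_scaleR del: transpose_matrix_vector)
      also have "\<dots> = (\<chi> i j. if j = k then (mat 1 *v z) $ i else mat 1 $ i $ j) *v w"
      proof (subst vec_eq_iff, intro allI)
        fix i
        have "((\<chi> i j. if j = k then (mat 1 *v z) $ i else mat 1 $ i $ j) *v w) $ i
          = (\<Sum>j\<in>UNIV. (if j = k then z $ i else mat 1 $ i $ j) * w $ j)"
          unfolding matrix_vector_mul_lid by (simp add: matrix_vector_mult_def)
        also have "\<dots> = (\<Sum>j\<in>UNIV. (if j = k then (norm x *\<^sub>R (Q *v y)) $ i * w $ j else 0) + mat 1 $ i $ j * w $ j)"
          by (intro sum.cong refl) (auto simp: z_def axis_def mat_def algebra_simps)
        also have "\<dots> = (norm x *\<^sub>R (Q *v y)) $ i * w $ k + (mat 1 *v w) $ i"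
          unfolding sum.distrib matrix_vector_mult_def[of "mat 1" w] by simp
        finally show "(w + (norm x * w $ k) *\<^sub>R (Q *v y)) $ i =
          ((\<chi> i j. if j = k then (mat 1 *v z) $ i else mat 1 $ i $ j) *v w) $ i" by simp
      qed
      finally show ?thesis .
    qed
    then show ?thesis by (subst matrix_eq) blast
  qed
  then have "det (Q ** ?A ** transpose Q) = z $ k" by (simp only: cramer_lemma det_I mult_1_right)
  moreover have "det (Q ** ?A ** transpose Q) = det ?A" using dQ by (simp add: det_mul mult_ac)
  moreover have "z $ k = 1 + x \<bullet> y"
  proof -
    have "x \<bullet> y = f x \<bullet> f y" using f(1) unfolding orthogonal_transformation_def by simp
    then show ?thesis unfolding z_def using f(2) fQ by (simp add: inner_axis')
  qed
  ultimately show ?thesis by simp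
qed

text \<open>Factoring out the old Gram matrix leaves the identity plus a rank-one matrix. This is
  the growth step of the elliptical potential.\<close>

lemma det_gram_snoc:
  assumes "lam > 0"
  shows "det (gram lam (D @ [p])) = det (gram lam D) * (1 + (wnorm (gram_inv lam D) (fst p))\<^sup>2)"
proof -
  let ?x = "fst p" and ?y = "gram_inv lam D *v fst p"
  have "gram lam (D @ [p]) = gram lam D ** (mat 1 + (\<chi> a b. ?y $ a * ?x $ b))"
  proof (subst matrix_eq, intro allI)
    fix w
    have "(gram lam D ** (mat 1 + (\<chi> a b. ?y $ a * ?x $ b))) *v w
      = gram lam D *v ((mat 1 + (\<chi> a b. ?y $ a * ?x $ b)) *v w)"
      by (simp add: matrix_vector_mul_assoc)
    also have "\<dots> = gram lam D *v w + (?x \<bullet> w) *\<^sub>R ?x"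
      by (simp add: matrix_vector_mult_add_rdistrib rank_one_mult_vec matrix_vector_right_distrib
          matrix_vector_mult_scaleR gram_inv_cancel[OF assms])
    finally show "gram lam (D @ [p]) *v w = (gram lam D ** (mat 1 + (\<chi> a b. ?y $ a * ?x $ b))) *v w"
      by (simp add: matrix_vector_mult_add_rdistrib outer_mult_vec)
  qed
  then show ?thesis by (simp only: det_mul det_one_plus_rank_one wnorm_gram_inv_sq[OF assms])
qed

lemma gram_entry_bound:
  fixes B :: real
  assumes "\<And>p. p \<in> set D \<Longrightarrow> norm (fst p) \<le> B" "lam > 0"
  shows "\<bar>gram lam D $ a $ b\<bar> \<le> lam + real (length D) * B\<^sup>2"
  using assms(1)
proof (induction D rule: rev_induct)
  case Nil
  then show ?case using assms(2) by (simp add: mat_def)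
next
  case (snoc p D)
  have "norm (fst p) \<le> B" using snoc.prems by simp
  then have "\<bar>fst p $ a\<bar> \<le> B" "\<bar>fst p $ b\<bar> \<le> B"
    using component_le_norm_cart order_trans by blast+
  then have "\<bar>fst p $ a * fst p $ b\<bar> \<le> B * B"
    unfolding abs_mult by (intro mult_mono) auto
  moreover have "\<bar>gram lam D $ a $ b\<bar> \<le> lam + real (length D) * B\<^sup>2" using snoc by simp
  ultimately show ?case
    by (simp add: outer_def power2_eq_square algebra_simps)
qed

text \<open>Termwise bound of the Leibniz expansion. The factor \<open>fact d\<close>, absent from
  the sharp bound, only adds the constant \<open>ln (fact d)\<close> to \<open>Lpot\<close>.\<close>

lemma det_gram_upper:
  fixes D :: "(((real, 'd::finite) vec) \<times> real) list" and B :: real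
  assumes "\<And>p. p \<in> set D \<Longrightarrow> norm (fst p) \<le> B" "lam > 0"
  shows "det (gram lam D) \<le> fact CARD('d) * (lam + real (length D) * B\<^sup>2) ^ CARD('d)"
proof -
  let ?L = "lam + real (length D) * B\<^sup>2"
  have "\<bar>det (gram lam D)\<bar> \<le> (\<Sum>p\<in>{p. p permutes (UNIV::'d set)}. \<bar>of_int (sign p) * (\<Prod>i\<in>UNIV. gram lam D $ i $ p i)\<bar>)"
    unfolding det_def by (rule sum_abs)
  also have "\<dots> \<le> (\<Sum>p\<in>{p. p permutes (UNIV::'d set)}. ?L ^ CARD('d))"
  proof (intro sum_mono)
    fix p :: "'d \<Rightarrow> 'd"
    have "\<bar>real_of_int (sign p)\<bar> = 1" by (simp add: sign_def)
    moreover have "(\<Prod>i\<in>UNIV. \<bar>gram lam D $ i $ p i\<bar>) \<le> (\<Prod>i\<in>(UNIV::'d set). ?L)"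
      by (intro prod_mono) (auto intro: gram_entry_bound[OF assms])
    ultimately show "\<bar>of_int (sign p) * (\<Prod>i\<in>UNIV. gram lam D $ i $ p i)\<bar> \<le> ?L ^ CARD('d)"
      by (simp add: abs_mult abs_prod)
  qed
  also have "\<dots> = fact CARD('d) * ?L ^ CARD('d)"
    by (simp add: card_permutations)
  finally show ?thesis by linarith
qed

section \<open>Gaussian mixtures\<close>

text \<open>The integral is never evaluated: it cancels in \<open>prob_inaccurate\<close>, for which
  positivity, finiteness and its scaling behaviour suffice.\<close>

definition gauss_mass :: "'a::euclidean_space itself \<Rightarrow> real \<Rightarrow> ennreal" where
  "gauss_mass _ a = (\<integral>\<^sup>+w. ennreal (exp (- a * (norm (w::'a))\<^sup>2)) \<partial>lborel)"

lemma gauss_mass_finite: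
  assumes "a > 0"
  shows "gauss_mass TYPE('a::euclidean_space) a < \<infinity>"
proof -
  have 1: "(\<integral>\<^sup>+x. ennreal (exp (- a * x\<^sup>2)) \<partial>lborel) < \<infinity>"
  proof -
    \<comment> \<open>The standard deviation for which the normal density is proportional to
      \<open>exp (- a * x\<^sup>2)\<close>.\<close>
    define s where "s = 1 / sqrt (2 * a)"
    have s: "s > 0" "2 * s\<^sup>2 = 1 / a" unfolding s_def using assms by (auto simp: power_divide)
    have "integrable lborel (\<lambda>x. sqrt (2 * pi * s\<^sup>2) * normal_density 0 s x)"
      using s by (intro integrable_mult_right) auto
    also have "(\<lambda>x. sqrt (2 * pi * s\<^sup>2) * normal_density 0 s x) = (\<lambda>x. exp (- a * x\<^sup>2))"
      unfolding normal_density_def using s assms by (intro ext) (simp add: field_simps)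
    finally have "integrable lborel (\<lambda>x. exp (- a * x\<^sup>2))" .
    then show ?thesis by (subst nn_integral_eq_integral) auto
  qed
  have "(\<lambda>w::'a. ennreal (exp (- a * (norm w)\<^sup>2))) = (\<lambda>w. \<Prod>b\<in>Basis. ennreal (exp (- a * (w \<bullet> b)\<^sup>2)))"
  proof
    fix w :: 'a
    have "(norm w)\<^sup>2 = (\<Sum>b\<in>Basis. (w \<bullet> b)\<^sup>2)"
      unfolding power2_norm_eq_inner euclidean_inner[of w w] by (simp add: power2_eq_square)
    then have "exp (- a * (norm w)\<^sup>2) = (\<Prod>b\<in>Basis. exp (- a * (w \<bullet> b)\<^sup>2))"
      by (simp add: sum_distrib_left flip: exp_sum sum_negf)
    then show "ennreal (exp (- a * (norm w)\<^sup>2)) = (\<Prod>b\<in>Basis. ennreal (exp (- a * (w \<bullet> b)\<^sup>2)))"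
      by (simp add: prod_ennreal)
  qed
  then have "gauss_mass TYPE('a) a = (\<integral>\<^sup>+w. (\<Prod>b\<in>Basis. ennreal (exp (- a * ((w::'a) \<bullet> b)\<^sup>2))) \<partial>lborel)"
    unfolding gauss_mass_def by simp
  also have "\<dots> = (\<Prod>b\<in>(Basis::'a set). (\<integral>\<^sup>+x. ennreal (exp (- a * x\<^sup>2)) \<partial>lborel))"
    by (rule nn_integral_lborel_prod) auto
  also have "\<dots> < \<infinity>" using 1 by (simp add: power_less_top_ennreal)
  finally show ?thesis .
qed

lemma gauss_mass_pos: "gauss_mass TYPE('a::euclidean_space) a > 0"
proof -
  have "gauss_mass TYPE('a) a \<noteq> 0"
  proof
    assume "gauss_mass TYPE('a) a = 0"
    then have "AE w in (lborel::'a measure). ennreal (exp (- a * (norm w)\<^sup>2)) = 0"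
      unfolding gauss_mass_def by (subst (asm) nn_integral_0_iff_AE) auto
    then have "AE w in (lborel::'a measure). False" by (simp add: ennreal_eq_0_iff)
    then have "UNIV \<in> null_sets (lborel::'a measure)" by (subst (asm) AE_iff_null) auto
    then show False by (simp add: null_sets_def)
  qed
  then show ?thesis by (simp add: zero_less_iff_neq_zero)
qed

lemma gauss_mass_scale:
  assumes "r > 0"
  shows "gauss_mass TYPE('a::euclidean_space) a = ennreal (r ^ DIM('a)) * gauss_mass TYPE('a) (a * r\<^sup>2)"
proof -
  let ?f = "\<lambda>w::'a. ennreal (exp (- a * (norm w)\<^sup>2))"
  have "gauss_mass TYPE('a) a = (\<integral>\<^sup>+w. ?f w \<partial>(density (distr lborel borel (\<lambda>x. 0 + r *\<^sub>R x)) (\<lambda>_. \<bar>r\<bar>^DIM('a))))"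
    unfolding gauss_mass_def using lborel_affine[of r "0::'a"] assms by simp
  also have "\<dots> = (\<integral>\<^sup>+w. ennreal (r ^ DIM('a)) * ?f (r *\<^sub>R w) \<partial>lborel)"
    using assms by (simp add: nn_integral_density nn_integral_distr)
  also have "\<dots> = ennreal (r ^ DIM('a)) * (\<integral>\<^sup>+w. ?f (r *\<^sub>R w) \<partial>lborel)"
    by (rule nn_integral_cmult) simp
  also have "(\<lambda>w. ?f (r *\<^sub>R w)) = (\<lambda>w. ennreal (exp (- (a * r\<^sup>2) * (norm w)\<^sup>2)))"
    by (simp add: power_mult_distrib mult_ac)
  finally show ?thesis unfolding gauss_mass_def .
qed

text \<open>For \<open>V\<close> a Gram matrix the bracket is the sum of the squared inner products
  of \<open>u\<close> with the contexts in the data. With \<open>S\<close> the noise sum this is the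
  usual exponential supermartingale in direction \<open>u\<close>.\<close>

definition tilt :: "real \<Rightarrow> real \<Rightarrow> (real, 'd::finite) vec \<Rightarrow> ((real, 'd) vec, 'd) vec \<Rightarrow> (real, 'd) vec \<Rightarrow> real" where
  "tilt R lam S V u = exp (u \<bullet> S - R\<^sup>2 / 2 * (u \<bullet> (V *v u) - lam * (norm u)\<^sup>2))"

text \<open>Completing the square and translating the Lebesgue measure.\<close>

lemma gauss_mixture_lower:
  fixes S :: "(real, 'd::finite) vec"
  assumes lam: "lam > 0" and R: "R > 0"
    and L: "\<And>w. w \<bullet> (gram lam D *v w) \<le> L * (norm w)\<^sup>2"
  shows "ennreal (exp ((wnorm (gram_inv lam D) S)\<^sup>2 / (2 * R\<^sup>2))) * gauss_mass TYPE((real, 'd) vec) (R\<^sup>2 / 2 * L)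
    \<le> (\<integral>\<^sup>+u. ennreal (tilt R lam S (gram lam D) u) * ennreal (exp (- (R\<^sup>2 * lam / 2) * (norm u)\<^sup>2)) \<partial>lborel)"
proof -
  let ?V = "gram lam D"
  \<comment> \<open>The maximiser of the exponent in \<open>?F\<close> below; shifting by it removes
    the linear term.\<close>
  define w0 where "w0 = (1 / R\<^sup>2) *\<^sub>R (gram_inv lam D *v S)"
  define q where "q = (wnorm (gram_inv lam D) S)\<^sup>2"
  have V0: "?V *v w0 = (1 / R\<^sup>2) *\<^sub>R S"
    unfolding w0_def by (simp add: matrix_vector_mult_scaleR gram_inv_cancel[OF lam])
  have w0S: "w0 \<bullet> S = q / R\<^sup>2"
    unfolding w0_def q_def wnorm_gram_inv_sq[OF lam] by (simp add: inner_commute)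
  let ?F = "\<lambda>u. exp (u \<bullet> S - R\<^sup>2 / 2 * (u \<bullet> (?V *v u)))"
  have F: "?F (w0 + w) = exp (q / (2 * R\<^sup>2)) * exp (- (R\<^sup>2 / 2) * (w \<bullet> (?V *v w)))" for w
  proof -
    have "(w0 + w) \<bullet> (?V *v (w0 + w)) = w0 \<bullet> (?V *v w0) + 2 * (w \<bullet> (?V *v w0)) + w \<bullet> (?V *v w)"
      using gram_sym[of w0 lam D w] by (simp add: matrix_vector_right_distrib inner_add_left inner_add_right)
    also have "\<dots> = q / R\<^sup>2 / R\<^sup>2 + 2 * (w \<bullet> S) / R\<^sup>2 + w \<bullet> (?V *v w)"
      unfolding V0 by (simp add: w0S)
    finally have eq: "(w0 + w) \<bullet> (?V *v (w0 + w)) = q / R\<^sup>2 / R\<^sup>2 + 2 * (w \<bullet> S) / R\<^sup>2 + w \<bullet> (?V *v w)" .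
    have "(w0 + w) \<bullet> S - R\<^sup>2 / 2 * ((w0 + w) \<bullet> (?V *v (w0 + w)))
      = q / (2 * R\<^sup>2) + - (R\<^sup>2 / 2) * (w \<bullet> (?V *v w))"
      unfolding eq using R by (simp add: inner_add_left w0S field_simps)
    then show ?thesis by (simp only: exp_add)
  qed
  have meas: "(\<lambda>w. ennreal (?F w)) \<in> borel_measurable borel"
    by (intro measurable_compose[OF _ measurable_ennreal] borel_measurable_continuous_onI continuous_intros
        linear_continuous_on matrix_vector_mul_bounded_linear)
  have "ennreal (exp (q / (2 * R\<^sup>2))) * gauss_mass TYPE((real, 'd) vec) (R\<^sup>2 / 2 * L)
     = (\<integral>\<^sup>+w. ennreal (exp (q / (2 * R\<^sup>2))) * ennreal (exp (- (R\<^sup>2 / 2 * L) * (norm (w::(real,'d) vec))\<^sup>2)) \<partial>lborel)"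
    unfolding gauss_mass_def by (intro nn_integral_cmult[symmetric]) simp
  \<comment> \<open>Replacing the Gram form by its upper bound \<open>L * (norm w)\<^sup>2\<close>
    avoids a Gaussian integral with a general covariance.\<close>
  also have "\<dots> \<le> (\<integral>\<^sup>+w. ennreal (?F (w0 + w)) \<partial>lborel)"
  proof (intro nn_integral_mono)
    fix w :: "(real, 'd) vec"
    have "R\<^sup>2 / 2 * (w \<bullet> (?V *v w)) \<le> R\<^sup>2 / 2 * (L * (norm w)\<^sup>2)"
      using L[of w] by (intro mult_left_mono) auto
    then have "exp (- (R\<^sup>2 / 2 * L) * (norm w)\<^sup>2) \<le> exp (- (R\<^sup>2 / 2) * (w \<bullet> (?V *v w)))" by simp
    then show "ennreal (exp (q / (2 * R\<^sup>2))) * ennreal (exp (- (R\<^sup>2 / 2 * L) * (norm w)\<^sup>2)) \<le> ennreal (?F (w0 + w))"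
      unfolding F ennreal_mult'[OF exp_ge_zero] by (intro mult_left_mono ennreal_leI) auto
  qed
  also have "\<dots> = (\<integral>\<^sup>+u. ennreal (?F u) \<partial>(distr lborel borel ((+) w0)))"
    by (rule nn_integral_distr[symmetric]) (use meas in auto)
  also have "\<dots> = (\<integral>\<^sup>+u. ennreal (?F u) \<partial>lborel)" unfolding lborel_distr_plus ..
  \<comment> \<open>The Gaussian weight cancels the \<open>lam\<close> term that \<open>tilt\<close>
    takes out of the quadratic form.\<close>
  also have "(\<lambda>u. ennreal (?F u)) =
     (\<lambda>u. ennreal (tilt R lam S ?V u) * ennreal (exp (- (R\<^sup>2 * lam / 2) * (norm u)\<^sup>2)))"
    unfolding tilt_def by (simp add: algebra_simps flip: ennreal_mult' exp_add)
  finally show ?thesis unfolding q_def .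
qed

text \<open>With \<open>r\<^sup>2 = L / lam\<close> the threshold is
  \<open>R\<^sup>2 * 2 * d * ln (r * T)\<close>, so the exponential in
  \<open>gauss_mixture_lower\<close> is at least \<open>(r * T) ^ d\<close>. Rescaling the mass by
  \<open>r\<close> uses up the factor \<open>r ^ d\<close> and leaves \<open>T ^ d\<close>.\<close>

lemma gauss_mixture_bad:
  fixes S :: "(real, 'd::finite) vec" and B :: real
  assumes lam: "lam > 0" and R: "R > 0" and T: "T > 0"
    and D: "\<And>p. p \<in> set D \<Longrightarrow> norm (fst p) \<le> B" "length D \<le> T"
    and bad: "(wnorm (gram_inv lam D) S)\<^sup>2 > R\<^sup>2 * (real CARD('d) * ln ((1 + real T * B\<^sup>2 / lam) * (real T)\<^sup>2))"
  shows "ennreal (real T ^ CARD('d)) * gauss_mass TYPE((real, 'd) vec) (R\<^sup>2 * lam / 2)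
    \<le> (\<integral>\<^sup>+u. ennreal (tilt R lam S (gram lam D) u) * ennreal (exp (- (R\<^sup>2 * lam / 2) * (norm u)\<^sup>2)) \<partial>lborel)"
proof -
  define L where "L = lam + real T * B\<^sup>2"
  have L: "w \<bullet> (gram lam D *v w) \<le> L * (norm w)\<^sup>2" for w
  proof -
    have "w \<bullet> (gram lam D *v w) \<le> (lam + real (length D) * B\<^sup>2) * (norm w)\<^sup>2"
      by (rule gram_quad_upper[OF D(1)])
    also have "\<dots> \<le> L * (norm w)\<^sup>2"
      unfolding L_def using D(2) by (intro mult_right_mono add_left_mono) auto
    finally show ?thesis .
  qed
  define r where "r = sqrt (L / lam)"
  have L0: "L > 0" unfolding L_def using lam by (intro add_pos_nonneg) auto
  have r: "r > 0" "r\<^sup>2 = L / lam" unfolding r_def using L0 lam by auto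
  have L': "1 + real T * B\<^sup>2 / lam = r\<^sup>2" unfolding r L_def using lam by (simp add: field_simps)
  have "real CARD('d) * ln ((r * real T)\<^sup>2) \<le> (wnorm (gram_inv lam D) S)\<^sup>2 / R\<^sup>2"
    using bad R unfolding L' by (simp add: field_simps power_mult_distrib)
  moreover have "ln ((r * real T)\<^sup>2) = 2 * ln (r * real T)" using r T by (simp add: ln_realpow)
  ultimately have "real CARD('d) * ln (r * real T) \<le> (wnorm (gram_inv lam D) S)\<^sup>2 / (2 * R\<^sup>2)"
    by (simp add: field_simps)
  then have "exp (real CARD('d) * ln (r * real T)) \<le> exp ((wnorm (gram_inv lam D) S)\<^sup>2 / (2 * R\<^sup>2))" by simp
  moreover have "exp (real CARD('d) * ln (r * real T)) = (r * real T) ^ CARD('d)"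
    using r T by (simp add: exp_of_nat_mult)
  ultimately have e: "real T ^ CARD('d) * r ^ CARD('d) \<le> exp ((wnorm (gram_inv lam D) S)\<^sup>2 / (2 * R\<^sup>2))"
    by (simp add: power_mult_distrib mult.commute)
  have "ennreal (real T ^ CARD('d)) * gauss_mass TYPE((real, 'd) vec) (R\<^sup>2 * lam / 2)
    = ennreal (real T ^ CARD('d)) * (ennreal (r ^ CARD('d)) * gauss_mass TYPE((real, 'd) vec) (R\<^sup>2 * lam / 2 * r\<^sup>2))"
    by (subst gauss_mass_scale[OF r(1)]) simp
  also have "R\<^sup>2 * lam / 2 * r\<^sup>2 = R\<^sup>2 / 2 * L" unfolding r using lam by simp
  also have "ennreal (real T ^ CARD('d)) * (ennreal (r ^ CARD('d)) * gauss_mass TYPE((real, 'd) vec) (R\<^sup>2 / 2 * L))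
     = ennreal (real T ^ CARD('d) * r ^ CARD('d)) * gauss_mass TYPE((real, 'd) vec) (R\<^sup>2 / 2 * L)"
    using r by (simp add: ennreal_mult' mult.assoc)
  also have "\<dots> \<le> ennreal (exp ((wnorm (gram_inv lam D) S)\<^sup>2 / (2 * R\<^sup>2))) * gauss_mass TYPE((real, 'd) vec) (R\<^sup>2 / 2 * L)"
    by (intro mult_right_mono ennreal_leI e) simp
  also note gauss_mixture_lower[OF lam R L]
  finally show ?thesis .
qed

section \<open>Measurability of the Gram quantities\<close>

text \<open>\<open>matrix_inv\<close> is defined by choice; Cramer's rule turns its action into
  ratios of determinants, which are polynomials in the entries and hence measurable.\<close>

lemma matrix_inv_cramer:
  fixes A :: "((real, 'd::finite) vec, 'd) vec"
  assumes "invertible A"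
  shows "matrix_inv A *v b = (\<chi> k. det (\<chi> i j. if j = k then b $ i else A $ i $ j) / det A)"
proof -
  have "det A \<noteq> 0" using assms invertible_det_nz by blast
  moreover have "A *v (matrix_inv A *v b) = b"
    using matrix_inv_props[OF assms] by (simp add: matrix_vector_mul_assoc)
  ultimately show ?thesis using cramer by blast
qed

lemma borel_measurable_vec_nth [measurable (raw)]:
  fixes f :: "'a \<Rightarrow> ('b::euclidean_space, 'd::finite) vec"
  assumes "f \<in> borel_measurable M"
  shows "(\<lambda>w. f w $ i) \<in> borel_measurable M"
  by (rule borel_measurable_continuous_onI[THEN measurable_compose[OF assms]]) (intro continuous_intros)

lemma borel_measurable_vec_lambda:
  fixes f :: "'a \<Rightarrow> 'd::finite \<Rightarrow> 'b::euclidean_space"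
  assumes "\<And>i. (\<lambda>w. f w i) \<in> borel_measurable M"
  shows "(\<lambda>w. (\<chi> i. f w i)) \<in> borel_measurable M"
proof -
  have "(\<chi> i. f w i) = (\<Sum>i\<in>UNIV. axis i (f w i))" for w
    by (simp add: vec_eq_iff axis_def)
  moreover have "(\<lambda>w. axis i (f w i)) \<in> borel_measurable M" for i
  proof (rule measurable_compose[OF assms])
    have "bounded_linear (axis i :: 'b \<Rightarrow> ('b, 'd) vec)"
      by (rule linear_conv_bounded_linear[THEN iffD1], rule linearI) (auto simp: vec_eq_iff axis_def)
    then show "(axis i :: 'b \<Rightarrow> ('b, 'd) vec) \<in> borel_measurable borel"
      by (intro borel_measurable_continuous_onI linear_continuous_on)
  qed
  ultimately show ?thesis by simp
qed

lemma borel_measurable_det: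
  fixes A :: "'a \<Rightarrow> ((real, 'd::finite) vec, 'd) vec"
  assumes "\<And>i j. (\<lambda>w. A w $ i $ j) \<in> borel_measurable M"
  shows "(\<lambda>w. det (A w)) \<in> borel_measurable M"
  unfolding det_def using assms by measurable

lemma borel_measurable_matrix_vector_mult:
  fixes A :: "'a \<Rightarrow> ((real, 'd::finite) vec, 'd) vec"
  assumes [measurable]: "A \<in> borel_measurable M" "b \<in> borel_measurable M"
  shows "(\<lambda>w. A w *v b w) \<in> borel_measurable M"
  unfolding matrix_vector_mult_def by (intro borel_measurable_vec_lambda) measurable

lemma borel_measurable_matrix_inv_mult:
  fixes A :: "'a \<Rightarrow> ((real, 'd::finite) vec, 'd) vec"
  assumes A [measurable]: "A \<in> borel_measurable M" and b [measurable]: "b \<in> borel_measurable M"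
    and inv: "\<And>w. invertible (A w)"
  shows "(\<lambda>w. matrix_inv (A w) *v b w) \<in> borel_measurable M"
  unfolding matrix_inv_cramer[OF inv]
proof (intro borel_measurable_vec_lambda borel_measurable_divide borel_measurable_det)
  fix i j k
  show "(\<lambda>w. (\<chi> i j. if j = k then b w $ i else A w $ i $ j) $ i $ j) \<in> borel_measurable M"
    by (cases "j = k") simp_all
qed simp_all

section \<open>The algorithm along one trajectory\<close>

locale barb_env =
  fixes \<theta> :: "('n::{finite,linorder}) \<Rightarrow> (real, 'd::finite) vec"
    and arank :: "('k::{finite,linorder}) \<Rightarrow> 'n \<Rightarrow> nat"
    and mcm :: "('n \<times> 'k) set \<Rightarrow> ('n, 'k) matching"
    and Bth Bx R lam Del1 :: real
    and T N d :: nat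
  assumes N_eq: "N = CARD('n)" and d_eq: "d = CARD('d)"
    and NK: "CARD('n) \<le> CARD('k)"
    and rank_strict: "\<And>j. inj (arank j)"
    and theta_bound: "\<And>i. norm (\<theta> i) \<le> Bth"
    and By: "2 * Bth * Bx \<le> 1"
    and R_pos: "R > 0"
    and lam_pos: "lam > 0" and Del1_pos: "Del1 > 0"
    and mcm_spec: "\<And>E. max_card_matching E (mcm E)"
    and T2: "T \<ge> 2"
begin

definition "conf = real d * ln ((1 + real T * Bx\<^sup>2 / lam) * (real T)\<^sup>2)"

definition "eta = barb_eta d T R lam Bth Bx"

definition edges :: "('n, 'd) barb_state \<Rightarrow> ((real, 'd) vec, 'k) vec \<Rightarrow> ('n \<times> 'k) set" where
  "edges st x = {(i, j). wnorm (gram_inv lam (snd (snd st) i)) (x $ j) > fst st / eta}"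

definition Uhat :: "('n, 'd) barb_state \<Rightarrow> ((real, 'd) vec, 'k) vec \<Rightarrow> 'n \<Rightarrow> 'k \<Rightarrow> real" where
  "Uhat st x i j = ridge_est lam (snd (snd st) i) \<bullet> (x $ j)"

definition mu :: "('n, 'd) barb_state \<Rightarrow> ((real, 'd) vec, 'k) vec \<Rightarrow> ('n, 'k) matching" where
  "mu st x = (if edges st x \<noteq> {} then mcm (edges st x) else gale_shapley arank (Uhat st x))"

definition flagged :: "('n, 'd) barb_state \<Rightarrow> ((real, 'd) vec, 'k) vec \<Rightarrow> bool" where
  "flagged st x \<longleftrightarrow> edges st x = {} \<and> (\<exists>i. small_gap CARD('n) (Uhat st x) i (fst st))"

definition batch_size :: "real \<Rightarrow> real" where
  "batch_size Del = 3 * ln (real T) / (16 * Del\<^sup>2)"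

definition count' :: "('n, 'd) barb_state \<Rightarrow> ((real, 'd) vec, 'k) vec \<Rightarrow> nat" where
  "count' st x = (if flagged st x then fst (snd st) + 1 else fst (snd st))"

definition data' :: "('n, 'd) barb_state \<Rightarrow> ((real, 'd) vec, 'k) vec \<Rightarrow> ('n \<times> 'k \<Rightarrow> real) \<Rightarrow> 'n \<Rightarrow> ((real, 'd) vec \<times> real) list" where
  "data' st x e i = (case mu st x i of None \<Rightarrow> snd (snd st) i
      | Some j \<Rightarrow> snd (snd st) i @ [(x $ j, util \<theta> x i j + e (i, j))])"

definition next_state :: "('n, 'd) barb_state \<Rightarrow> ((real, 'd) vec, 'k) vec \<Rightarrow> ('n \<times> 'k \<Rightarrow> real) \<Rightarrow> ('n, 'd) barb_state" where
  "next_state st x e =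
    (if edges st x \<noteq> {} then (fst st, fst (snd st), data' st x e)
     else if real (count' st x) > batch_size (fst st) then (fst st / sqrt 2, 0, \<lambda>_. [])
     else (fst st, count' st x, snd (snd st)))"

lemma barb_round_eq:
  "barb_round T R lam Bth Bx arank mcm \<theta> (x, e) st =
    (mu st x, \<lambda>i. case mu st x i of None \<Rightarrow> 0 | Some j \<Rightarrow> util \<theta> x i j + e (i, j), next_state st x e)"
proof -
  obtain Del Nk D where st: "st = (Del, Nk, D)" by (cases st) auto
  have eta: "barb_eta CARD('d) T R lam Bth Bx = eta" unfolding eta_def d_eq[symmetric] ..
  have E: "{(i, j). Del / eta < wnorm (gram_inv lam (D i)) (x $ j)} = edges st x"
    unfolding edges_def st by simp
  have U: "(\<lambda>i j. ridge_est lam (D i) \<bullet> (x $ j)) = Uhat st x"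
    unfolding Uhat_def st by (simp add: fun_eq_iff)
  show ?thesis
  proof (cases "edges st x = {}")
    case True
    then have "count' st x = (if \<exists>i. small_gap CARD('n) (Uhat st x) i Del then Nk + 1 else Nk)"
      unfolding count'_def flagged_def by (simp add: st)
    then show ?thesis
      using True unfolding barb_round_def st prod.case Let_def eta E[unfolded st] U[unfolded st]
      by (simp add: mu_def next_state_def batch_size_def)
  next
    case False
    then show ?thesis
      unfolding barb_round_def st prod.case Let_def eta E[unfolded st] U[unfolded st]
      by (auto simp: mu_def next_state_def data'_def fun_eq_iff split: option.split)
  qed
qed

abbreviation "hist \<equiv> barb_hist T R lam Bth Bx Del1 arank mcm \<theta>"

lemma hist_Suc: "hist \<omega> (Suc t) = next_state (hist \<omega> t) (fst (\<omega> (Suc t))) (snd (\<omega> (Suc t)))"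
  using barb_round_eq[of "fst (\<omega> (Suc t))" "snd (\<omega> (Suc t))" "hist \<omega> t"] by simp

text \<open>The state is adapted. \<open>hist_upd\<close> uses this whenever a later round is
  resampled.\<close>

lemma hist_cong:
  assumes "\<And>s. 1 \<le> s \<Longrightarrow> s \<le> t \<Longrightarrow> \<omega> s = \<omega>' s"
  shows "hist \<omega> t = hist \<omega>' t"
  using assms by (induction t) auto

lemma T_pos: "real T > 0" "ln (real T) > 0"
  using T2 by auto

lemma Bth_nonneg: "0 \<le> Bth"
  using theta_bound norm_ge_zero order_trans by blast

lemma conf_pos: "conf > 0"
proof -
  have "(1 + real T * Bx\<^sup>2 / lam) * (real T)\<^sup>2 \<ge> 1 * 2\<^sup>2"
    using T2 lam_pos by (intro mult_mono power_mono) auto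
  moreover have "d > 0" using d_eq by simp
  ultimately show ?thesis unfolding conf_def by simp
qed

lemma eta_eq: "eta = R * sqrt conf + sqrt lam * Bth"
  unfolding eta_def barb_eta_def conf_def ..

lemma eta_pos: "eta > 0"
  unfolding eta_eq using conf_pos R_pos lam_pos Bth_nonneg by (intro add_pos_nonneg) auto

subsection \<open>Exploitation with accurate estimates\<close>

text \<open>Only the noise is random: its threshold accounts for the summand
  \<open>R * sqrt conf\<close> of \<open>eta\<close>, while the summand
  \<open>sqrt lam * Bth\<close> covers the deterministic ridge bias.\<close>

definition accurate :: "('n, 'd) barb_state \<Rightarrow> bool" where
  "accurate st \<longleftrightarrow> (\<forall>i. (wnorm (gram_inv lam (snd (snd st) i)) (noise_sum lam (\<theta> i) (snd (snd st) i)))\<^sup>2 \<le> R\<^sup>2 * conf)"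

text \<open>Without edges every weighted context norm is at most \<open>fst st / eta\<close>, and
  accuracy bounds the bracket of \<open>ridge_est_error\<close> by \<open>eta\<close>.\<close>

lemma accurate_close:
  assumes acc: "accurate st" and E: "edges st x = {}" and Del: "fst st > 0"
  shows "\<bar>Uhat st x i j - util \<theta> x i j\<bar> \<le> fst st"
proof -
  let ?D = "snd (snd st) i"
  let ?W = "gram_inv lam ?D"
  have "(wnorm ?W (noise_sum lam (\<theta> i) ?D))\<^sup>2 \<le> (R * sqrt conf)\<^sup>2"
    using acc conf_pos unfolding accurate_def by (simp add: power_mult_distrib)
  then have n: "wnorm ?W (noise_sum lam (\<theta> i) ?D) \<le> R * sqrt conf"
    by (rule power2_le_imp_le) (use R_pos conf_pos in auto)
  have w: "wnorm ?W (x $ j) \<le> fst st / eta"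
    using E unfolding edges_def by (auto simp: not_less[symmetric])
  have "\<bar>Uhat st x i j - util \<theta> x i j\<bar> = \<bar>(ridge_est lam ?D - \<theta> i) \<bullet> (x $ j)\<bar>"
    unfolding Uhat_def util_def by (simp add: inner_diff_left)
  also have "\<dots> \<le> wnorm ?W (x $ j) * (wnorm ?W (noise_sum lam (\<theta> i) ?D) + sqrt lam * norm (\<theta> i))"
    by (rule ridge_est_error[OF lam_pos])
  also have "\<dots> \<le> fst st / eta * eta"
  proof (rule mult_mono[OF w])
    show "wnorm ?W (noise_sum lam (\<theta> i) ?D) + sqrt lam * norm (\<theta> i) \<le> eta"
      unfolding eta_eq using n theta_bound[of i] lam_pos by (intro add_mono mult_left_mono) auto
    show "0 \<le> wnorm ?W (noise_sum lam (\<theta> i) ?D) + sqrt lam * norm (\<theta> i)"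
      using wnorm_gram_inv_nonneg[OF lam_pos, of ?D "noise_sum lam (\<theta> i) ?D"] lam_pos by simp
    show "0 \<le> fst st / eta" using Del eta_pos by simp
  qed
  also have "\<dots> = fst st" using eta_pos by simp
  finally show ?thesis .
qed

lemma flagged_delta_min:
  assumes "accurate st" "flagged st x" "fst st > 0"
  shows "delta_min \<theta> x \<le> 4 * fst st"
proof -
  obtain i where "small_gap CARD('n) (Uhat st x) i (fst st)" and E: "edges st x = {}"
    using assms(2) unfolding flagged_def by blast
  then show ?thesis
    using small_gap_delta_min accurate_close[OF assms(1) E assms(3)] by blast
qed

text \<open>The \<open>1 / 2\<close> comes from \<open>By\<close>; a single round therefore costs at
  most 1.\<close>

lemma match_val_bound:
  assumes x: "\<And>j. norm (x $ j) \<le> Bx"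
  shows "\<bar>match_val (util \<theta> x) \<mu> i\<bar> \<le> 1 / 2"
proof (cases "\<mu> i")
  case (Some j)
  have "\<bar>util \<theta> x i j\<bar> \<le> norm (\<theta> i) * norm (x $ j)"
    unfolding util_def by (rule Cauchy_Schwarz_ineq2)
  also have "\<dots> \<le> Bth * Bx" using theta_bound x Bth_nonneg by (intro mult_mono) auto
  finally show ?thesis using Some By unfolding match_val_def by simp
qed (simp add: match_val_def)

lemma round_regret:
  assumes x: "\<And>j. norm (x $ j) \<le> Bx" and Del: "fst st > 0"
  shows "Ustar arank \<theta> x i - match_val (util \<theta> x) (mu st x) i
    \<le> of_bool (edges st x \<noteq> {}) + of_bool (flagged st x) + of_bool (\<not> accurate st)"
proof (cases "edges st x = {} \<and> \<not> flagged st x \<and> accurate st")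
  case True
  then have "Ustar arank \<theta> x i \<le> match_val (util \<theta> x) (gale_shapley arank (Uhat st x)) i"
    using accurate_close[OF _ _ Del] unfolding flagged_def
    by (intro Ustar_le_no_small_gap[OF NK rank_strict]) auto
  then show ?thesis using True unfolding mu_def by simp
next
  case False
  obtain \<mu> where "stable arank (util \<theta> x) \<mu>"
    and \<mu>: "Ustar arank \<theta> x i = match_val (util \<theta> x) \<mu> i"
    by (rule Ustar_attained[OF NK rank_strict])
  have "Ustar arank \<theta> x i - match_val (util \<theta> x) (mu st x) i \<le> 1"
    unfolding \<mu> using match_val_bound[OF x, of \<mu> i] match_val_bound[OF x, of "mu st x" i] by linarith
  then show ?thesis using False by auto
qed

subsection \<open>Counting exploration and flagged rounds\<close>

text \<open>\<open>Lpot\<close> bounds the logarithm of the Gram determinant relative to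
  \<open>lam ^ d\<close>. \<open>Qexp\<close> and \<open>Qflag\<close>, divided by the squared gap,
  bound the exploration rounds and the flagged rounds of one batch. The summand
  \<open>Del1\<^sup>2\<close> of \<open>Qflag\<close> pays for the one flagged round that overshoots
  \<open>batch_size\<close>, since gaps never exceed \<open>Del1\<close>.\<close>

definition "Lpot = ln (fact d) + real d * ln (1 + real T * Bx\<^sup>2 / lam)"
definition "Qexp = real N * Lpot * (Del1\<^sup>2 + eta\<^sup>2)"
definition "Qflag = 3 * ln (real T) / 16 + Del1\<^sup>2"

text \<open>The determinant clause is the elliptical potential: an exploration round multiplies the
  determinant of a matched player by at least \<open>1 + (fst st / eta)\<^sup>2\<close>.\<close>

definition state_ok :: "nat \<Rightarrow> ('n, 'd) barb_state \<Rightarrow> bool" where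
  "state_ok t st \<longleftrightarrow> fst st > 0 \<and> fst st \<le> Del1 \<and> real (fst (snd st)) \<le> batch_size (fst st) \<and>
    (\<forall>i. length (snd (snd st) i) \<le> t \<and> (\<forall>p\<in>set (snd (snd st) i). norm (fst p) \<le> Bx) \<and>
      lam ^ d * (1 + (fst st / eta)\<^sup>2) ^ length (snd (snd st) i) \<le> det (gram lam (snd (snd st) i)))"

lemma det_mat: "det (mat lam :: ((real, 'd) vec, 'd) vec) = lam ^ d"
  by (subst det_diagonal) (auto simp: mat_def d_eq)

lemma Lpot_nonneg: "Lpot \<ge> 0"
  unfolding Lpot_def using lam_pos by (intro add_nonneg_nonneg mult_nonneg_nonneg ln_ge_zero) auto

text \<open>The geometric growth recorded in \<open>state_ok\<close> meets the polynomial bound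
  \<open>det_gram_upper\<close>; taking logarithms leaves \<open>n * ln (1 + z) \<le> Lpot\<close>.
  The gap is not assumed small compared with \<open>eta\<close>, which is why
  \<open>Del1\<^sup>2\<close> is added to \<open>eta\<^sup>2\<close>.\<close>

lemma length_data_bound:
  assumes ok: "state_ok t st" and t: "t \<le> T"
  shows "real (length (snd (snd st) i)) \<le> Lpot * (Del1\<^sup>2 + eta\<^sup>2) / (fst st)\<^sup>2"
proof -
  let ?D = "snd (snd st) i"
  define n where "n = length ?D"
  define z where "z = (fst st / eta)\<^sup>2"
  have Del: "0 < fst st" "fst st \<le> Del1" using ok unfolding state_ok_def by auto
  have z: "z > 0" unfolding z_def using Del eta_pos by simp
  have "lam ^ d * (1 + z) ^ n \<le> det (gram lam ?D)" using ok unfolding state_ok_def z_def n_def by blast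
  also have "\<dots> \<le> fact d * (lam + real n * Bx\<^sup>2) ^ d"
    unfolding n_def using det_gram_upper[of "snd (snd st) i" Bx lam] ok lam_pos by (auto simp: state_ok_def d_eq[symmetric])
  also have "\<dots> \<le> fact d * (lam + real T * Bx\<^sup>2) ^ d"
  proof -
    have "n \<le> T" using ok t unfolding state_ok_def n_def by (meson order_trans)
    then show ?thesis using lam_pos by (intro mult_left_mono power_mono add_left_mono mult_right_mono) auto
  qed
  also have "lam + real T * Bx\<^sup>2 = lam * (1 + real T * Bx\<^sup>2 / lam)" using lam_pos by (simp add: field_simps)
  also have "fact d * (lam * (1 + real T * Bx\<^sup>2 / lam)) ^ d = lam ^ d * (fact d * (1 + real T * Bx\<^sup>2 / lam) ^ d)"
    by (simp add: power_mult_distrib)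
  finally have "(1 + z) ^ n \<le> fact d * (1 + real T * Bx\<^sup>2 / lam) ^ d" using lam_pos by simp
  moreover have p: "1 + real T * Bx\<^sup>2 / lam > 0" using lam_pos by (intro add_pos_nonneg) auto
  ultimately have "ln ((1 + z) ^ n) \<le> ln (fact d * (1 + real T * Bx\<^sup>2 / lam) ^ d)"
    using z by (intro ln_mono) auto
  also have "\<dots> = Lpot" unfolding Lpot_def using p by (simp add: ln_mult ln_realpow)
  finally have 1: "real n * ln (1 + z) \<le> Lpot" using z by (simp add: ln_realpow)
  \<comment> \<open>The logarithm is needed from below; the upper bound
    \<open>ln a \<le> a - 1\<close> at the reciprocal provides it.\<close>
  have "ln (1 / (1 + z)) \<le> 1 / (1 + z) - 1" using z by (intro ln_le_minus_one) auto
  then have 2: "z / (1 + z) \<le> ln (1 + z)" using z by (simp add: ln_div field_simps)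
  have "real n * (z / (1 + z)) \<le> Lpot" using mult_left_mono[OF 2, of "real n"] 1 by linarith
  then have "real n \<le> Lpot * ((1 + z) / z)" using z by (simp add: field_simps)
  also have "(1 + z) / z = ((fst st)\<^sup>2 + eta\<^sup>2) / (fst st)\<^sup>2"
    unfolding z_def using Del eta_pos by (simp add: field_simps power_divide)
  also have "Lpot * (((fst st)\<^sup>2 + eta\<^sup>2) / (fst st)\<^sup>2) \<le> Lpot * ((Del1\<^sup>2 + eta\<^sup>2) / (fst st)\<^sup>2)"
    using Del Lpot_nonneg by (intro mult_left_mono divide_right_mono add_right_mono power_mono) auto
  finally show ?thesis unfolding n_def by simp
qed

lemma total_data_bound:
  assumes "state_ok t st" "t \<le> T"
  shows "(\<Sum>i\<in>UNIV. real (length (snd (snd st) i))) \<le> Qexp / (fst st)\<^sup>2"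
proof -
  have "(\<Sum>i\<in>UNIV. real (length (snd (snd st) i))) \<le> (\<Sum>i\<in>(UNIV::'n set). Lpot * (Del1\<^sup>2 + eta\<^sup>2) / (fst st)\<^sup>2)"
    by (intro sum_mono length_data_bound[OF assms])
  then show ?thesis unfolding Qexp_def N_eq[symmetric] by (simp flip: N_eq)
qed

text \<open>A single edge is itself a matching, so a maximum one is nonempty. Every exploration
  round thus adds a data point, which lets the data lengths count these rounds.\<close>

lemma mcm_covers:
  assumes "E \<noteq> {}"
  shows "\<exists>i j. mcm E i = Some j"
proof (rule ccontr)
  assume n: "\<not> ?thesis"
  obtain i j where ij: "(i, j) \<in> E" using assms by auto
  define \<mu> where "\<mu> = (\<lambda>a. if a = i then Some j else None)"
  have "card {a. \<mu> a \<noteq> None} \<le> card {a. mcm E a \<noteq> None}"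
    using mcm_spec[of E] ij unfolding max_card_matching_def \<mu>_def is_matching_def by (auto split: if_splits)
  moreover have "{a. mcm E a \<noteq> None} = {}" using n by auto
  moreover have "{a. \<mu> a \<noteq> None} = {i}" unfolding \<mu>_def by auto
  ultimately show False by simp
qed

lemma mcm_edges: "mcm E i = Some j \<Longrightarrow> (i, j) \<in> E"
  using mcm_spec[of E] unfolding max_card_matching_def by blast

lemma batch_size_nonneg: "batch_size Del \<ge> 0"
  unfolding batch_size_def using T_pos by simp

lemma state_ok_next:
  assumes ok: "state_ok t st" and x: "\<And>j. norm (x $ j) \<le> Bx"
  shows "state_ok (Suc t) (next_state st x e)"
proof (cases "edges st x = {}")
  case True
  show ?thesis
  proof (cases "real (count' st x) > batch_size (fst st)")
    case True
    have "fst st / sqrt 2 \<le> fst st" using ok unfolding state_ok_def by (simp add: field_simps)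
    then have "fst st / sqrt 2 \<le> Del1" using ok unfolding state_ok_def by linarith
    then show ?thesis
      using ok True \<open>edges st x = {}\<close> batch_size_nonneg unfolding state_ok_def next_state_def
      by (simp add: det_mat)
  next
    case False
    then show ?thesis using ok True unfolding state_ok_def next_state_def by (auto intro: le_SucI)
  qed
next
  case False
  have Del: "0 < fst st" using ok unfolding state_ok_def by auto
  let ?c = "1 + (fst st / eta)\<^sup>2"
  have "length (data' st x e i) \<le> Suc t \<and> (\<forall>p\<in>set (data' st x e i). norm (fst p) \<le> Bx) \<and>
      lam ^ d * ?c ^ length (data' st x e i) \<le> det (gram lam (data' st x e i))" for i
  proof (cases "mu st x i")
    case None
    then show ?thesis using ok unfolding data'_def state_ok_def by (auto intro: le_SucI)
  next
    case (Some j)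
    let ?D = "snd (snd st) i"
    \<comment> \<open>A matched pair is an edge, so its weighted norm exceeds the exploration
      threshold, as the determinant clause requires.\<close>
    have "(i, j) \<in> edges st x" using Some False mcm_edges unfolding mu_def by auto
    then have "fst st / eta \<le> wnorm (gram_inv lam ?D) (x $ j)" unfolding edges_def by auto
    then have "?c \<le> 1 + (wnorm (gram_inv lam ?D) (x $ j))\<^sup>2"
      using Del eta_pos by (intro add_left_mono power_mono) auto
    moreover have h: "lam ^ d * ?c ^ length ?D \<le> det (gram lam ?D)" using ok unfolding state_ok_def by blast
    moreover have "0 \<le> lam ^ d * ?c ^ length ?D" using lam_pos by (intro mult_nonneg_nonneg) auto
    ultimately have "lam ^ d * ?c ^ length ?D * ?c \<le> det (gram lam ?D) * (1 + (wnorm (gram_inv lam ?D) (x $ j))\<^sup>2)"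
      by (intro mult_mono) auto
    then have "lam ^ d * ?c ^ length (data' st x e i) \<le> det (gram lam (data' st x e i))"
      unfolding data'_def Some option.case det_gram_snoc[OF lam_pos] by (simp add: mult_ac)
    then show ?thesis using ok Some x unfolding data'_def state_ok_def by auto
  qed
  then show ?thesis using False ok unfolding next_state_def state_ok_def by auto
qed

text \<open>\<open>X\<close>, \<open>f\<close> and \<open>g\<close> count the exploration rounds, the flagged rounds, and the flagged rounds
  whose candidate gap is at most \<open>D0\<close>. The inverse square of the gap doubles from batch to batch,
  so the contributions of the finished batches sum up to at most that of the current one.\<close>

definition count_inv :: "real \<Rightarrow> nat \<Rightarrow> nat \<Rightarrow> nat \<Rightarrow> ('n, 'd) barb_state \<Rightarrow> bool" where
  "count_inv D0 X f g st \<longleftrightarrow>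
    real X \<le> Qexp / (fst st)\<^sup>2 + (\<Sum>i\<in>UNIV. real (length (snd (snd st) i))) \<and>
    real f \<le> Qflag / (fst st)\<^sup>2 + real (fst (snd st)) \<and>
    (fst st \<le> D0 \<longrightarrow> fst (snd st) \<le> g) \<and>
    1 / (fst st)\<^sup>2 \<le> 1 / Del1\<^sup>2 + 2 / D0\<^sup>2 + 32 / (3 * ln (real T)) * real g"

text \<open>The point is a reset, where the weight \<open>w = 1 / (fst st)\<^sup>2\<close> doubles.
  The account \<open>Qexp * w\<close> of the closed batches and the at most \<open>Qexp * w\<close>
  data of the ending one add up to \<open>Qexp * (2 * w)\<close>. For the last clause: if the gap is
  above \<open>D0\<close>, then \<open>2 * w \<le> 2 / D0\<^sup>2\<close>; otherwise the ending
  batch had more than \<open>3 * ln T / 16 * w\<close> flagged rounds, all counted by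
  \<open>g\<close>.\<close>

lemma count_inv_next:
  assumes inv: "count_inv D0 X f g st" and ok: "state_ok t st" and t: "t \<le> T" and D0: "D0 > 0"
  shows "count_inv D0 (X + of_bool (edges st x \<noteq> {})) (f + of_bool (flagged st x))
      (g + of_bool (flagged st x \<and> fst st \<le> D0)) (next_state st x e)"
proof (cases "edges st x = {}")
  case False
  have nf: "\<not> flagged st x" using False unfolding flagged_def by simp
  obtain i j where ij: "mu st x i = Some j" using mcm_covers[OF False] False unfolding mu_def by auto
  have le: "length (snd (snd st) a) \<le> length (data' st x e a)" for a
    unfolding data'_def by (simp split: option.split)
  have "length (snd (snd st) i) < length (data' st x e i)" unfolding data'_def ij by simp
  then have "(\<Sum>i\<in>UNIV. length (snd (snd st) i)) < (\<Sum>i\<in>UNIV. length (data' st x e i))"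
    using le by (intro sum_strict_mono_ex1) auto
  then have "(\<Sum>i\<in>UNIV. real (length (snd (snd st) i))) + 1 \<le> (\<Sum>i\<in>UNIV. real (length (data' st x e i)))"
    unfolding of_nat_sum[symmetric] by linarith
  then show ?thesis
    using inv nf False unfolding count_inv_def next_state_def by auto
next
  case True
  have Del: "0 < fst st" "fst st \<le> Del1" using ok unfolding state_ok_def by auto
  define w where "w = 1 / (fst st)\<^sup>2"
  have w: "w > 0" "1 \<le> Del1\<^sup>2 * w"
    unfolding w_def using Del by (auto simp: divide_simps intro!: power_mono)
  let ?N = "fst (snd st)"
  have N: "count' st x = ?N + of_bool (flagged st x)" unfolding count'_def by simp
  have N': "real ?N \<le> 3 * ln (real T) / 16 * w"
    using ok unfolding state_ok_def batch_size_def w_def by simp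
  have I: "real X \<le> Qexp * w + (\<Sum>i\<in>UNIV. real (length (snd (snd st) i)))"
    "real f \<le> Qflag * w + real ?N" "fst st \<le> D0 \<Longrightarrow> ?N \<le> g"
    "w \<le> 1 / Del1\<^sup>2 + 2 / D0\<^sup>2 + 32 / (3 * ln (real T)) * real g"
    using inv unfolding count_inv_def w_def by auto
  show ?thesis
  proof (cases "real (count' st x) > batch_size (fst st)")
    case False
    then have "next_state st x e = (fst st, count' st x, snd (snd st))"
      unfolding next_state_def using True by simp
    moreover have "32 / (3 * ln (real T)) * real g \<le> 32 / (3 * ln (real T)) * real (g + of_bool (flagged st x \<and> fst st \<le> D0))"
      using T_pos by (intro mult_left_mono) auto
    ultimately show ?thesis
      unfolding count_inv_def using I True N unfolding w_def by auto
  next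
    case reset: True
    then have st': "next_state st x e = (fst st / sqrt 2, 0, \<lambda>_. [])"
      unfolding next_state_def using True by simp
    have w': "1 / (fst st / sqrt 2)\<^sup>2 = 2 * w" unfolding w_def by (simp add: power_divide)
    have w'': "a / (fst st / sqrt 2)\<^sup>2 = a * (2 * w)" for a unfolding w_def by (simp add: power_divide)
    have "(\<Sum>i\<in>UNIV. real (length (snd (snd st) i))) \<le> Qexp * w"
      using total_data_bound[OF ok t] unfolding w_def by simp
    then have c1: "real X \<le> Qexp * (2 * w)" using I(1) by simp
    \<comment> \<open>The 1 is the flagged round that triggers the reset, paid by
      \<open>1 \<le> Del1\<^sup>2 * w\<close>.\<close>
    have "real f + 1 \<le> Qflag * w + (3 * ln (real T) / 16 * w + Del1\<^sup>2 * w)" using I(2) N' w by linarith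
    also have "\<dots> = Qflag * (2 * w)" unfolding Qflag_def by (simp add: algebra_simps)
    finally have c2: "real f + 1 \<le> Qflag * (2 * w)" .
    define g' where "g' = g + of_bool (flagged st x \<and> fst st \<le> D0)"
    have c3: "2 * w \<le> 1 / Del1\<^sup>2 + 2 / D0\<^sup>2 + 32 / (3 * ln (real T)) * real g'"
    proof (cases "fst st \<le> D0")
      case True
      then have "count' st x \<le> g'" unfolding g'_def N using I(3) by simp
      then have "3 * ln (real T) / 16 * w \<le> real g'"
        using reset unfolding batch_size_def w_def by simp
      then have "2 * w \<le> 32 / (3 * ln (real T)) * real g'" using T_pos by (simp add: field_simps)
      then show ?thesis by (simp add: add_increasing)
    next
      case False
      then have "w \<le> 1 / D0\<^sup>2"
        unfolding w_def using D0 Del by (intro divide_left_mono power_mono) auto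
      moreover have "0 \<le> 32 / (3 * ln (real T)) * real g'" using T_pos by simp
      moreover have "0 \<le> 1 / Del1\<^sup>2" by simp
      ultimately show ?thesis by linarith
    qed
    show ?thesis
      unfolding count_inv_def st' fst_conv snd_conv w'' w' g'_def[symmetric]
      using c1 c2 c3 True by (auto split: if_splits)
  qed
qed

definition bounded_ctx :: "(nat \<Rightarrow> ((real, 'd) vec, 'k) vec \<times> ('n \<times> 'k \<Rightarrow> real)) \<Rightarrow> bool" where
  "bounded_ctx \<omega> \<longleftrightarrow> (\<forall>t\<in>{1..T}. \<forall>j. norm (fst (\<omega> t) $ j) \<le> Bx)"

definition "explN \<omega> t = (\<Sum>s<t. of_bool (edges (hist \<omega> s) (fst (\<omega> (Suc s))) \<noteq> {}) :: nat)"
definition "flagN \<omega> t = (\<Sum>s<t. of_bool (flagged (hist \<omega> s) (fst (\<omega> (Suc s)))) :: nat)"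
definition "fineN D0 \<omega> t = (\<Sum>s<t. of_bool (flagged (hist \<omega> s) (fst (\<omega> (Suc s))) \<and> fst (hist \<omega> s) \<le> D0) :: nat)"

lemma hist_invariants:
  assumes "bounded_ctx \<omega>" "t \<le> T" "D0 > 0"
  shows "state_ok t (hist \<omega> t) \<and> count_inv D0 (explN \<omega> t) (flagN \<omega> t) (fineN D0 \<omega> t) (hist \<omega> t)"
  using assms(2)
proof (induction t)
  case 0
  have "0 \<le> Qexp" unfolding Qexp_def using Lpot_nonneg by simp
  moreover have "0 \<le> Qflag" unfolding Qflag_def using T_pos by simp
  ultimately show ?case
    using Del1_pos batch_size_nonneg assms(3)
    by (simp add: state_ok_def count_inv_def explN_def flagN_def fineN_def det_mat)
next
  case (Suc t)
  have x: "norm (fst (\<omega> (Suc t)) $ j) \<le> Bx" for j using assms(1) Suc.prems unfolding bounded_ctx_def by auto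
  have IH: "state_ok t (hist \<omega> t)" "count_inv D0 (explN \<omega> t) (flagN \<omega> t) (fineN D0 \<omega> t) (hist \<omega> t)"
    using Suc by auto
  have t: "t \<le> T" using Suc.prems by simp
  show ?case
    using state_ok_next[OF IH(1) x] count_inv_next[OF IH(2) IH(1) t assms(3)]
    unfolding hist_Suc explN_def flagN_def fineN_def by simp
qed

end

section \<open>Measurability of the trajectory\<close>

lemma measurable_into_finite:
  fixes f :: "'a \<Rightarrow> 'b::finite"
  assumes "\<And>b. Measurable.pred M (\<lambda>w. f w = b)"
  shows "f \<in> measurable M (count_space UNIV)"
proof (subst measurable_count_space_eq2)
  show "f \<in> space M \<rightarrow> UNIV \<and> (\<forall>a\<in>UNIV. f -` {a} \<inter> space M \<in> sets M)"
  proof (intro conjI ballI)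
    fix a :: 'b
    have "f -` {a} \<inter> space M = {w \<in> space M. f w = a}" by auto
    then show "f -` {a} \<inter> space M \<in> sets M" using assms[of a] by (simp add: pred_def)
  qed simp
qed simp

lemma borel_measurable_desc_vals:
  fixes f :: "'a \<Rightarrow> 'k::{finite,linorder} \<Rightarrow> real"
  assumes [measurable]: "\<And>j. (\<lambda>w. f w j) \<in> borel_measurable M" and q: "q < CARD('k)"
  shows "(\<lambda>w. desc_vals (f w) ! q) \<in> borel_measurable M"
proof (subst borel_measurable_iff_greater, intro allI)
  fix a
  have "a < desc_vals (f w) ! q \<longleftrightarrow> q < (\<Sum>j\<in>UNIV. of_bool (a < f w j))" for w
    using desc_vals_nth_iff[of "\<lambda>z. a < z" q "f w"] q by (simp add: of_bool_def sum.If_cases)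
  moreover have "{w \<in> space M. q < (\<Sum>j\<in>UNIV. of_bool (a < f w j) :: nat)} \<in> sets M"
    unfolding of_bool_def by measurable
  ultimately show "{w \<in> space M. a < desc_vals (f w) ! q} \<in> sets M" by simp
qed

lemma pred_small_gap:
  fixes U :: "'a \<Rightarrow> 'n::{finite,linorder} \<Rightarrow> 'k::{finite,linorder} \<Rightarrow> real"
  assumes [measurable]: "\<And>i j. (\<lambda>w. U w i j) \<in> borel_measurable M" "del \<in> borel_measurable M"
  shows "Measurable.pred M (\<lambda>w. small_gap n (U w) i (del w))"
proof -
  have "Measurable.pred M (\<lambda>w. m + 1 < CARD('k) \<and> m < n \<and>
      desc_vals (U w i) ! m - desc_vals (U w i) ! (m + 1) \<le> 2 * del w)" for m
  proof (cases "m + 1 < CARD('k)")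
    case True
    then have [measurable]: "(\<lambda>w. desc_vals (U w i) ! m) \<in> borel_measurable M"
      "(\<lambda>w. desc_vals (U w i) ! (m + 1)) \<in> borel_measurable M"
      by (auto intro!: borel_measurable_desc_vals)
    show ?thesis by measurable
  qed simp
  then show ?thesis unfolding small_gap_iff by (rule pred_intros_countable)
qed

lemma measurable_gale_shapley:
  fixes U :: "'a \<Rightarrow> 'n::{finite,linorder} \<Rightarrow> 'k::{finite,linorder} \<Rightarrow> real"
  assumes [measurable]: "\<And>i j. (\<lambda>w. U w i j) \<in> borel_measurable M"
  shows "(\<lambda>w. gale_shapley arank (U w)) \<in> measurable M (count_space UNIV)"
proof -
  \<comment> \<open>Factors the run through the preference order by choosing any utility that
    induces it; \<open>gale_shapley_cong\<close> makes the choice irrelevant.\<close>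
  define G where "G P = gale_shapley arank (SOME U' :: 'n \<Rightarrow> 'k \<Rightarrow> real. pbetter U' = P)" for P
  have "gale_shapley arank (U w) = G (pbetter (U w))" for w
    unfolding G_def by (rule gale_shapley_cong) (rule someI[of "\<lambda>U'. pbetter U' = pbetter (U w)", symmetric], rule refl)
  moreover have "(\<lambda>w. pbetter (U w)) \<in> measurable M (count_space UNIV)"
  proof (rule measurable_into_finite)
    fix P
    have "(\<lambda>w. pbetter (U w) = P) = (\<lambda>w. \<forall>i j j'. pbetter (U w) i j j' = P i j j')"
      by (auto simp: fun_eq_iff)
    moreover have "Measurable.pred M (\<lambda>w. \<forall>i j j'. pbetter (U w) i j j' = P i j j')"
      unfolding pbetter_def by measurable
    ultimately show "Measurable.pred M (\<lambda>w. pbetter (U w) = P)" by simp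
  qed
  ultimately show ?thesis
    by (simp add: measurable_compose[of "\<lambda>w. pbetter (U w)" M "count_space UNIV" G "count_space UNIV"])
qed

lemma borel_measurable_outer:
  assumes [measurable]: "x \<in> borel_measurable M"
  shows "(\<lambda>w. outer (x w)) \<in> borel_measurable M"
  unfolding outer_def by (intro borel_measurable_vec_lambda) measurable

lemma borel_measurable_util [measurable (raw)]:
  assumes [measurable]: "x \<in> borel_measurable M"
  shows "(\<lambda>w. util \<theta> (x w) i j) \<in> borel_measurable M"
  unfolding util_def by measurable

lemma pred_stable:
  fixes U :: "'a \<Rightarrow> 'n::{finite,linorder} \<Rightarrow> 'k::{finite,linorder} \<Rightarrow> real"
  assumes [measurable]: "\<And>i j. (\<lambda>w. U w i j) \<in> borel_measurable M"
  shows "Measurable.pred M (\<lambda>w. stable arank (U w) \<mu>)"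
proof -
  have "Measurable.pred M (\<lambda>w. case \<mu> i of None \<Rightarrow> True | Some j' \<Rightarrow> U w i j > U w i j')" for i j
    by (cases "\<mu> i") auto
  note [measurable] = this
  show ?thesis unfolding stable_def by measurable
qed

lemma borel_measurable_match_val:
  assumes [measurable]: "\<And>i j. (\<lambda>w. U w i j) \<in> borel_measurable M"
  shows "(\<lambda>w. match_val (U w) \<mu> i) \<in> borel_measurable M"
  unfolding match_val_def by (cases "\<mu> i") auto

lemma borel_measurable_Ustar:
  fixes \<theta> :: "'n::{finite,linorder} \<Rightarrow> (real, 'd::finite) vec" and arank :: "'k::{finite,linorder} \<Rightarrow> 'n \<Rightarrow> nat"
  assumes NK: "CARD('n) \<le> CARD('k)" and inj: "\<And>j. inj (arank j)"
    and [measurable]: "x \<in> borel_measurable M"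
  shows "(\<lambda>w. Ustar arank \<theta> (x w) i) \<in> borel_measurable M"
proof (subst borel_measurable_iff_greater, intro allI)
  fix a
  have "a < Ustar arank \<theta> (x w) i \<longleftrightarrow>
      (\<exists>\<mu>. stable arank (util \<theta> (x w)) \<mu> \<and> a < match_val (util \<theta> (x w)) \<mu> i)" for w
  proof -
    have "stable arank (util \<theta> (x w)) (gale_shapley arank (util \<theta> (x w)))"
      by (rule gale_shapley_stable[OF NK inj])
    then have "{match_val (util \<theta> (x w)) \<mu> i |\<mu>. stable arank (util \<theta> (x w)) \<mu>} \<noteq> {}" by blast
    from Max_gr_iff[OF finite_stable_vals this] show ?thesis unfolding Ustar_def by blast
  qed
  moreover have "{w \<in> space M. \<exists>\<mu>. stable arank (util \<theta> (x w)) \<mu> \<and> a < match_val (util \<theta> (x w)) \<mu> i} \<in> sets M"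
  proof -
    have [measurable]: "Measurable.pred M (\<lambda>w. stable arank (util \<theta> (x w)) \<mu>)"
      "(\<lambda>w. match_val (util \<theta> (x w)) \<mu> i) \<in> borel_measurable M" for \<mu>
      by (auto intro!: pred_stable borel_measurable_match_val)
    show ?thesis by measurable
  qed
  ultimately show "{w \<in> space M. a < Ustar arank \<theta> (x w) i} \<in> sets M" by simp
qed

lemma pred_delta_min:
  fixes \<theta> :: "'n::{finite,linorder} \<Rightarrow> (real, 'd::finite) vec"
    and x :: "'a \<Rightarrow> ((real, 'd) vec, 'k::{finite,linorder}) vec"
  assumes [measurable]: "x \<in> borel_measurable M"
  shows "Measurable.pred M (\<lambda>w. delta_min \<theta> (x w) \<le> a)"
proof (cases "\<exists>j j'::'k. j \<noteq> j'")
  case True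
  have "delta_min \<theta> (x w) \<le> a \<longleftrightarrow> (\<exists>i j j'. j \<noteq> j' \<and> \<bar>\<theta> i \<bullet> (x w $ j - x w $ j')\<bar> \<le> a)" for w
  proof -
    have ne: "{\<bar>\<theta> i \<bullet> (x w $ j - x w $ j')\<bar> | i j j'. j \<noteq> j'} \<noteq> {}" using True by blast
    show ?thesis unfolding delta_min_def Min_le_iff[OF finite_delta_min_set ne] by auto
  qed
  then show ?thesis by simp
next
  \<comment> \<open>With a single arm the set under \<open>Min\<close> is empty, so
    \<open>delta_min\<close> is a fixed value and the predicate is constant.\<close>
  case False
  then have "{\<bar>\<theta> i \<bullet> (x w $ j - x w $ j')\<bar> | i j j'. j \<noteq> j'} = {}" for w by blast
  then show ?thesis unfolding delta_min_def by simp
qed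

context barb_env
begin

definition mstate :: "'a measure \<Rightarrow> ('a \<Rightarrow> ('n, 'd) barb_state) \<Rightarrow> bool" where
  "mstate M S \<longleftrightarrow> (\<lambda>w. fst (S w)) \<in> borel_measurable M \<and>
    (\<lambda>w. fst (snd (S w))) \<in> measurable M (count_space UNIV) \<and>
    (\<forall>i. (\<lambda>w. gram lam (snd (snd (S w)) i)) \<in> borel_measurable M) \<and>
    (\<forall>i. (\<lambda>w. resp (snd (snd (S w)) i)) \<in> borel_measurable M)"

lemma mstateD:
  assumes "mstate M S"
  shows "(\<lambda>w. fst (S w)) \<in> borel_measurable M"
    and "(\<lambda>w. fst (snd (S w))) \<in> measurable M (count_space UNIV)"
    and "(\<lambda>w. gram lam (snd (snd (S w)) i)) \<in> borel_measurable M"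
    and "(\<lambda>w. resp (snd (snd (S w)) i)) \<in> borel_measurable M"
  using assms unfolding mstate_def by auto

lemma mstate_const: "mstate M (\<lambda>_. st)"
  unfolding mstate_def by simp

lemma mstate_compose:
  assumes "mstate M S" "f \<in> measurable M' M"
  shows "mstate M' (\<lambda>w. S (f w))"
  using mstateD[OF assms(1), THEN measurable_compose[OF assms(2)]] unfolding mstate_def by simp

definition reset :: "('n, 'd) barb_state \<Rightarrow> ((real, 'd) vec, 'k) vec \<Rightarrow> bool" where
  "reset st x \<longleftrightarrow> edges st x = {} \<and> real (count' st x) > batch_size (fst st)"

context
  fixes M :: "'a measure" and S :: "'a \<Rightarrow> ('n, 'd) barb_state" and x :: "'a \<Rightarrow> ((real, 'd) vec, 'k) vec"
  assumes mS: "mstate M S" and x [measurable]: "x \<in> borel_measurable M"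
begin

lemmas [measurable] = mstateD[OF mS]

lemma measurable_gram_inv_mult:
  assumes "b \<in> borel_measurable M"
  shows "(\<lambda>w. gram_inv lam (snd (snd (S w)) i) *v b w) \<in> borel_measurable M"
  by (intro borel_measurable_matrix_inv_mult assms gram_invertible lam_pos mstateD[OF mS])

lemma measurable_wnorm:
  assumes [measurable]: "b \<in> borel_measurable M"
  shows "(\<lambda>w. wnorm (gram_inv lam (snd (snd (S w)) i)) (b w)) \<in> borel_measurable M"
proof -
  note [measurable] = measurable_gram_inv_mult[OF assms]
  show ?thesis unfolding wnorm_def by measurable
qed

lemma measurable_edges: "(\<lambda>w. edges (S w) (x w)) \<in> measurable M (count_space UNIV)"
proof (rule measurable_into_finite)
  fix E
  have "(\<lambda>w. edges (S w) (x w) = E) =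
    (\<lambda>w. \<forall>i j. (wnorm (gram_inv lam (snd (snd (S w)) i)) (x w $ j) > fst (S w) / eta) = ((i, j) \<in> E))"
    unfolding edges_def by (auto simp: fun_eq_iff)
  moreover have [measurable]: "(\<lambda>w. wnorm (gram_inv lam (snd (snd (S w)) i)) (x w $ j)) \<in> borel_measurable M" for i j
    by (rule measurable_wnorm) measurable
  ultimately show "Measurable.pred M (\<lambda>w. edges (S w) (x w) = E)" by simp
qed

lemma pred_edges_empty: "Measurable.pred M (\<lambda>w. edges (S w) (x w) = {})"
  using measurable_compose[OF measurable_edges, of "\<lambda>E. E = {}" "count_space UNIV"] by simp

lemma measurable_Uhat: "(\<lambda>w. Uhat (S w) (x w) i j) \<in> borel_measurable M"
proof -
  have [measurable]: "(\<lambda>w. gram_inv lam (snd (snd (S w)) i) *v resp (snd (snd (S w)) i)) \<in> borel_measurable M" for i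
    by (rule measurable_gram_inv_mult) measurable
  show ?thesis unfolding Uhat_def ridge_est_eq by measurable
qed

lemma measurable_mu: "(\<lambda>w. mu (S w) (x w)) \<in> measurable M (count_space UNIV)"
proof -
  have 1: "(\<lambda>w. mcm (edges (S w) (x w))) \<in> measurable M (count_space UNIV)"
    by (rule measurable_compose[OF measurable_edges]) simp
  have 2: "(\<lambda>w. gale_shapley arank (Uhat (S w) (x w))) \<in> measurable M (count_space UNIV)"
    by (rule measurable_gale_shapley[OF measurable_Uhat])
  show ?thesis unfolding mu_def using 1 2 pred_edges_empty by measurable
qed

lemma pred_flagged: "Measurable.pred M (\<lambda>w. flagged (S w) (x w))"
proof -
  have "Measurable.pred M (\<lambda>w. small_gap CARD('n) (Uhat (S w) (x w)) i (fst (S w)))" for i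
    by (rule pred_small_gap[OF measurable_Uhat]) measurable
  note [measurable] = this pred_edges_empty
  show ?thesis unfolding flagged_def by measurable
qed

lemma measurable_count': "(\<lambda>w. count' (S w) (x w)) \<in> measurable M (count_space UNIV)"
proof -
  note [measurable] = pred_flagged
  show ?thesis unfolding count'_def by measurable
qed

lemma pred_accurate: "Measurable.pred M (\<lambda>w. accurate (S w))"
proof -
  have "(\<lambda>w. noise_sum lam (\<theta> i) (snd (snd (S w)) i)) \<in> borel_measurable M" for i
    unfolding noise_sum_def
    by (intro borel_measurable_add borel_measurable_diff borel_measurable_matrix_vector_mult) measurable
  then have [measurable]: "(\<lambda>w. wnorm (gram_inv lam (snd (snd (S w)) i)) (noise_sum lam (\<theta> i) (snd (snd (S w)) i))) \<in> borel_measurable M" for i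
    by (rule measurable_wnorm)
  show ?thesis unfolding accurate_def by measurable
qed

lemma pred_reset: "Measurable.pred M (\<lambda>w. reset (S w) (x w))"
proof -
  note [measurable] = measurable_count' pred_edges_empty
  show ?thesis unfolding reset_def batch_size_def by measurable
qed

lemma mstate_next:
  assumes e [measurable]: "\<And>p. (\<lambda>w. e w p) \<in> borel_measurable M"
  shows "mstate M (\<lambda>w. next_state (S w) (x w) (e w))"
proof -
  note [measurable] = measurable_count' pred_edges_empty pred_reset
  have g: "(\<lambda>w. gram lam (data' (S w) (x w) (e w) i)) \<in> borel_measurable M"
    and r: "(\<lambda>w. resp (data' (S w) (x w) (e w) i)) \<in> borel_measurable M" for i
  proof -
    \<comment> \<open>The matching is random but has finitely many values, so it suffices that the
      update is measurable for each fixed matching \<open>m\<close>.\<close>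
    define F where "F m w = gram lam (snd (snd (S w)) i) + (case m i of None \<Rightarrow> 0 | Some j \<Rightarrow> outer (x w $ j))" for m :: "('n,'k) matching" and w
    define H where "H m w = resp (snd (snd (S w)) i) + (case m i of None \<Rightarrow> 0 | Some j \<Rightarrow> (util \<theta> (x w) i j + e w (i, j)) *\<^sub>R (x w $ j))" for m :: "('n,'k) matching" and w
    have o: "(\<lambda>w. outer (x w $ j)) \<in> borel_measurable M" for j by (rule borel_measurable_outer) measurable
    have mF: "F m \<in> borel_measurable M" for m
      unfolding F_def by (cases "m i") (use o in \<open>auto intro!: borel_measurable_add mstateD[OF mS]\<close>)
    have "(\<lambda>w. F (mu (S w) (x w)) w) \<in> borel_measurable M"
      by (rule measurable_compose_countable'[where f=F and I=UNIV, OF mF measurable_mu]) (rule countable_finite, rule finite)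
    moreover have "gram lam (data' (S w) (x w) (e w) i) = F (mu (S w) (x w)) w" for w
      unfolding F_def data'_def by (simp split: option.split)
    ultimately show "(\<lambda>w. gram lam (data' (S w) (x w) (e w) i)) \<in> borel_measurable M" by simp
    have mH: "H m \<in> borel_measurable M" for m
      unfolding H_def by (cases "m i") auto
    have "(\<lambda>w. H (mu (S w) (x w)) w) \<in> borel_measurable M"
      by (rule measurable_compose_countable'[where f=H and I=UNIV, OF mH measurable_mu]) (rule countable_finite, rule finite)
    moreover have "resp (data' (S w) (x w) (e w) i) = H (mu (S w) (x w)) w" for w
      unfolding H_def data'_def by (simp split: option.split)
    ultimately show "(\<lambda>w. resp (data' (S w) (x w) (e w) i)) \<in> borel_measurable M" by simp
  qed
  note [measurable] = g r
  have n: "next_state (S w) (x w) (e w) =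
    (if edges (S w) (x w) = {} then
       if reset (S w) (x w) then (fst (S w) / sqrt 2, 0, \<lambda>_. []) else (fst (S w), count' (S w) (x w), snd (snd (S w)))
     else (fst (S w), fst (snd (S w)), data' (S w) (x w) (e w)))" for w
    unfolding next_state_def reset_def by simp
  have "(\<lambda>w. fst (next_state (S w) (x w) (e w))) =
      (\<lambda>w. if edges (S w) (x w) = {} then if reset (S w) (x w) then fst (S w) / sqrt 2 else fst (S w) else fst (S w))"
    unfolding n by (auto simp: fun_eq_iff)
  then have 1: "(\<lambda>w. fst (next_state (S w) (x w) (e w))) \<in> borel_measurable M" by simp
  have "(\<lambda>w. fst (snd (next_state (S w) (x w) (e w)))) =
      (\<lambda>w. if edges (S w) (x w) = {} then if reset (S w) (x w) then 0 else count' (S w) (x w) else fst (snd (S w)))"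
    unfolding n by (auto simp: fun_eq_iff)
  then have 2: "(\<lambda>w. fst (snd (next_state (S w) (x w) (e w)))) \<in> measurable M (count_space UNIV)" by simp
  have "(\<lambda>w. gram lam (snd (snd (next_state (S w) (x w) (e w))) i)) =
      (\<lambda>w. if edges (S w) (x w) = {} then if reset (S w) (x w) then mat lam else gram lam (snd (snd (S w)) i)
           else gram lam (data' (S w) (x w) (e w) i))" for i
    unfolding n by (auto simp: fun_eq_iff)
  then have 3: "(\<lambda>w. gram lam (snd (snd (next_state (S w) (x w) (e w))) i)) \<in> borel_measurable M" for i by simp
  have "(\<lambda>w. resp (snd (snd (next_state (S w) (x w) (e w))) i)) =
      (\<lambda>w. if edges (S w) (x w) = {} then if reset (S w) (x w) then 0 else resp (snd (snd (S w)) i)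
           else resp (data' (S w) (x w) (e w) i))" for i
    unfolding n by (auto simp: fun_eq_iff)
  then have 4: "(\<lambda>w. resp (snd (snd (next_state (S w) (x w) (e w))) i)) \<in> borel_measurable M" for i by simp
  show ?thesis unfolding mstate_def using 1 2 3 4 by blast
qed

end

end

section \<open>Resampling one coordinate of a product measure\<close>

text \<open>Takes the place of conditioning on all coordinates except \<open>s\<close>. The outer
  integral stays on the full product space, so expressions in the history keep their form and the
  step can be repeated for every round.\<close>

lemma nn_integral_PiM_resample:
  assumes fin: "finite I" and s: "s \<in> I" and P: "prob_space P"
    and f [measurable]: "f \<in> borel_measurable (PiM I (\<lambda>_. P))"
  shows "(\<integral>\<^sup>+\<omega>. f \<omega> \<partial>(PiM I (\<lambda>_. P))) = (\<integral>\<^sup>+\<omega>. (\<integral>\<^sup>+z. f (fun_upd \<omega> s z) \<partial>P) \<partial>(PiM I (\<lambda>_. P)))"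
proof -
  interpret P: prob_space P by fact
  interpret product_sigma_finite "\<lambda>_. P" by unfold_locales
  define J where "J = I - {s}"
  have I: "I = insert s J" "finite J" "s \<notin> J" using s fin unfolding J_def by auto
  have f': "f \<in> borel_measurable (PiM (insert s J) (\<lambda>_. P))" using f I by simp
  have upd: "(\<lambda>(\<omega>, z). fun_upd \<omega> s z) \<in> measurable (PiM I (\<lambda>_. P) \<Otimes>\<^sub>M P) (PiM I (\<lambda>_. P))"
    using measurable_add_dim[of s I "\<lambda>_. P"] s by (simp add: insert_absorb)
  have "(\<lambda>\<omega>. \<integral>\<^sup>+z. f (fun_upd \<omega> s z) \<partial>P) \<in> borel_measurable (PiM I (\<lambda>_. P))"
    using P.borel_measurable_nn_integral_fst[OF measurable_compose[OF upd f]] by simp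
  then have g: "(\<lambda>\<omega>. \<integral>\<^sup>+z. f (fun_upd \<omega> s z) \<partial>P) \<in> borel_measurable (PiM (insert s J) (\<lambda>_. P))" using I by simp
  have "(\<integral>\<^sup>+\<omega>. (\<integral>\<^sup>+z. f (fun_upd \<omega> s z) \<partial>P) \<partial>(PiM (insert s J) (\<lambda>_. P)))
    = (\<integral>\<^sup>+\<omega>. (\<integral>\<^sup>+z'. (\<integral>\<^sup>+z. f (fun_upd \<omega> s z) \<partial>P) \<partial>P) \<partial>(PiM J (\<lambda>_. P)))"
    by (subst product_nn_integral_insert[OF I(2,3) g]) simp
  also have "\<dots> = (\<integral>\<^sup>+\<omega>. (\<integral>\<^sup>+z. f (fun_upd \<omega> s z) \<partial>P) \<partial>(PiM J (\<lambda>_. P)))"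
    by (simp add: P.emeasure_space_1)
  also have "\<dots> = (\<integral>\<^sup>+\<omega>. f \<omega> \<partial>(PiM (insert s J) (\<lambda>_. P)))"
    by (rule product_nn_integral_insert[OF I(2,3) f', symmetric])
  finally show ?thesis using I by simp
qed

section \<open>The stochastic environment\<close>

locale barb_prob = barb_env \<theta> arank mcm Bth Bx R lam Del1 T N d
  for \<theta> :: "('n::{finite,linorder}) \<Rightarrow> (real, 'd::finite) vec"
    and arank :: "('k::{finite,linorder}) \<Rightarrow> 'n \<Rightarrow> nat"
    and mcm :: "('n \<times> 'k) set \<Rightarrow> ('n, 'k) matching"
    and Bth Bx R lam Del1 :: real and T N d :: nat +
  fixes Dx :: "(((real, 'd) vec, 'k) vec) measure" and \<nu> :: "real measure" and c Del0 :: real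
  assumes Dx_prob: "prob_space Dx" and Dx_sets: "sets Dx = sets borel"
    and ctx_bound: "AE x in Dx. \<forall>j. norm (x $ j) \<le> Bx"
    and nu_prob: "prob_space \<nu>" and nu_sets: "sets \<nu> = sets borel"
    and nu_int: "integrable \<nu> (\<lambda>z. z)" and nu_mean: "(\<integral>z. z \<partial>\<nu>) = 0"
    and nu_subg: "\<And>s. integrable \<nu> (\<lambda>z. exp (s * z)) \<and>
                       (\<integral>z. exp (s * z) \<partial>\<nu>) \<le> exp (s\<^sup>2 * R\<^sup>2 / 2)"
    and c_pos: "c > 0"
    and cdf: "\<And>Del. 0 < Del \<Longrightarrow> Del \<le> Del0 \<Longrightarrow>
                 measure Dx {x \<in> space Dx. delta_min \<theta> x \<le> Del} \<le> c * Del"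
begin

definition EM :: "('n \<times> 'k \<Rightarrow> real) measure" where "EM = PiM UNIV (\<lambda>_. \<nu>)"
definition RM :: "(((real, 'd) vec, 'k) vec \<times> ('n \<times> 'k \<Rightarrow> real)) measure" where
  "RM = round_measure Dx \<nu>"
definition M :: "(nat \<Rightarrow> ((real, 'd) vec, 'k) vec \<times> ('n \<times> 'k \<Rightarrow> real)) measure" where
  "M = PiM {1..T} (\<lambda>_. RM)"

lemma RM_eq: "RM = Dx \<Otimes>\<^sub>M EM"
  unfolding RM_def round_measure_def EM_def ..

sublocale Dx: prob_space Dx by (rule Dx_prob)
sublocale nu: prob_space \<nu> by (rule nu_prob)

sublocale EM: prob_space EM
  unfolding EM_def by (rule prob_space_PiM) (rule nu_prob)

sublocale RM: prob_space RM
proof -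
  interpret pair_prob_space Dx EM ..
  show "prob_space RM" unfolding RM_eq by (rule prob_space_axioms)
qed

sublocale M: prob_space M
  unfolding M_def by (rule prob_space_PiM) (rule RM.prob_space_axioms)

lemma measurable_nu [simp]: "measurable \<nu> A = measurable borel A"
  by (rule measurable_cong_sets) (simp_all add: nu_sets)

lemma measurable_to_nu [simp]: "measurable A \<nu> = measurable A borel"
  by (rule measurable_cong_sets) (simp_all add: nu_sets)

lemma measurable_to_Dx [simp]: "measurable A Dx = measurable A borel"
  by (rule measurable_cong_sets) (simp_all add: Dx_sets)

lemma measurable_RM_ctx [measurable]: "fst \<in> borel_measurable RM"
  using measurable_fst[of Dx EM] unfolding RM_eq by simp

lemma measurable_EM_noise [measurable]: "(\<lambda>e. e p) \<in> borel_measurable EM"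
  using measurable_component_singleton[of p UNIV "\<lambda>_. \<nu>"] unfolding EM_def by simp

lemma measurable_RM_noise [measurable]: "(\<lambda>z. snd z p) \<in> borel_measurable RM"
  unfolding RM_eq by measurable

lemma measurable_coord: "s \<in> {1..T} \<Longrightarrow> (\<lambda>\<omega>. \<omega> s) \<in> measurable M RM"
  unfolding M_def by (rule measurable_component_singleton)

lemma measurable_ctx: "s \<in> {1..T} \<Longrightarrow> (\<lambda>\<omega>. fst (\<omega> s)) \<in> borel_measurable M"
  by (rule measurable_compose[OF measurable_coord measurable_RM_ctx])

lemma measurable_noise: "s \<in> {1..T} \<Longrightarrow> (\<lambda>\<omega>. snd (\<omega> s) p) \<in> borel_measurable M"
  by (rule measurable_compose[OF measurable_coord measurable_RM_noise])

lemma mstate_hist: "t \<le> T \<Longrightarrow> mstate M (\<lambda>\<omega>. hist \<omega> t)"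
proof (induction t)
  case 0
  then show ?case by (simp add: mstate_const)
next
  case (Suc t)
  then show ?case
    unfolding hist_Suc by (intro mstate_next measurable_ctx measurable_noise) auto
qed

lemma distr_coord: "s \<in> {1..T} \<Longrightarrow> distr M RM (\<lambda>\<omega>. \<omega> s) = RM"
  unfolding M_def by (rule distr_PiM_component[where M="\<lambda>_. RM"]) (auto intro: RM.prob_space_axioms)

lemma distr_RM_ctx: "distr RM Dx fst = Dx"
  unfolding RM_eq by (rule EM.distr_pair_fst)

lemma distr_EM_noise: "distr EM \<nu> (\<lambda>e. e p) = \<nu>"
  unfolding EM_def by (rule distr_PiM_component[where M="\<lambda>_. \<nu>"]) (auto intro: nu_prob)

lemma resample:
  assumes "f \<in> borel_measurable M" "s \<in> {1..T}"
  shows "(\<integral>\<^sup>+\<omega>. f \<omega> \<partial>M) = (\<integral>\<^sup>+\<omega>. (\<integral>\<^sup>+z. f (fun_upd \<omega> s z) \<partial>RM) \<partial>M)"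
  using assms unfolding M_def by (intro nn_integral_PiM_resample RM.prob_space_axioms) auto

lemma nn_integral_RM:
  assumes "f \<in> borel_measurable RM"
  shows "(\<integral>\<^sup>+z. f z \<partial>RM) = (\<integral>\<^sup>+x. (\<integral>\<^sup>+e. f (x, e) \<partial>EM) \<partial>Dx)"
  using EM.nn_integral_fst[of f Dx] assms unfolding RM_eq by simp

lemma nn_integral_EM_noise:
  assumes "g \<in> borel_measurable borel"
  shows "(\<integral>\<^sup>+e. g (e p) \<partial>EM) = (\<integral>\<^sup>+z. g z \<partial>\<nu>)"
  using assms by (subst distr_EM_noise[of p, symmetric], subst nn_integral_distr) auto

lemma hist_upd: "t < s \<Longrightarrow> hist (fun_upd \<omega> s z) t = hist \<omega> t"
  by (rule hist_cong) auto

lemma AE_bounded_ctx: "AE \<omega> in M. bounded_ctx \<omega>"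
proof -
  have "AE z in RM. \<forall>j. norm (fst z $ j) \<le> Bx"
    by (rule AE_distrD[where M'=Dx], simp, unfold distr_RM_ctx, rule ctx_bound)
  then have "AE \<omega> in M. \<forall>j. norm (fst (\<omega> t) $ j) \<le> Bx" if "t \<in> {1..T}" for t
    unfolding M_def using that RM.prob_space_axioms by (intro AE_PiM_component) auto
  then show ?thesis unfolding bounded_ctx_def by (intro AE_finite_allI) auto
qed

subsection \<open>The self-normalised supermartingale\<close>

definition TL :: "'n \<Rightarrow> (real, 'd) vec \<Rightarrow> ('n, 'd) barb_state \<Rightarrow> real" where
  "TL i u st = tilt R lam (noise_sum lam (\<theta> i) (snd (snd st) i)) (gram lam (snd (snd st) i)) u"

text \<open>The direction \<open>u\<close> may vary with the sample point, which gives the joint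
  measurability needed for Fubini.\<close>

lemma measurable_TL:
  assumes mS: "mstate A S" and u [measurable]: "u \<in> borel_measurable A"
  shows "(\<lambda>w. TL i (u w) (S w)) \<in> borel_measurable A"
proof -
  note [measurable] = mstateD[OF mS]
  have [measurable]: "(\<lambda>w. noise_sum lam (\<theta> i) (snd (snd (S w)) i)) \<in> borel_measurable A"
    unfolding noise_sum_def
    by (intro borel_measurable_add borel_measurable_diff borel_measurable_matrix_vector_mult) measurable
  have [measurable]: "(\<lambda>w. gram lam (snd (snd (S w)) i) *v u w) \<in> borel_measurable A"
    by (intro borel_measurable_matrix_vector_mult) measurable
  show ?thesis unfolding TL_def tilt_def by measurable
qed

lemma TL_nonneg: "0 \<le> TL i u st"
  unfolding TL_def tilt_def by simp

lemma nn_integral_subgaussian: "(\<integral>\<^sup>+z. ennreal (exp (a * z - R\<^sup>2 / 2 * a\<^sup>2)) \<partial>\<nu>) \<le> 1"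
proof -
  have "(\<integral>\<^sup>+z. ennreal (exp (a * z - R\<^sup>2 / 2 * a\<^sup>2)) \<partial>\<nu>)
      = (\<integral>\<^sup>+z. ennreal (exp (- (R\<^sup>2 / 2 * a\<^sup>2))) * ennreal (exp (a * z)) \<partial>\<nu>)"
    by (simp add: ennreal_mult'[symmetric] exp_add[symmetric])
  also have "\<dots> = ennreal (exp (- (R\<^sup>2 / 2 * a\<^sup>2))) * (\<integral>\<^sup>+z. ennreal (exp (a * z)) \<partial>\<nu>)"
    by (rule nn_integral_cmult) simp
  also have "(\<integral>\<^sup>+z. ennreal (exp (a * z)) \<partial>\<nu>) = ennreal (\<integral>z. exp (a * z) \<partial>\<nu>)"
    using nu_subg[of a] by (intro nn_integral_eq_integral) auto
  also have "ennreal (exp (- (R\<^sup>2 / 2 * a\<^sup>2))) * ennreal (\<integral>z. exp (a * z) \<partial>\<nu>)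
      \<le> ennreal (exp (- (R\<^sup>2 / 2 * a\<^sup>2))) * ennreal (exp (a\<^sup>2 * R\<^sup>2 / 2))"
    using nu_subg[of a] by (intro mult_left_mono ennreal_leI) auto
  also have "\<dots> = 1" by (simp add: ennreal_mult'[symmetric] exp_minus mult.commute)
  finally show ?thesis .
qed

text \<open>The matching is determined by \<open>st\<close> and \<open>x\<close>, so the noise
  enters through at most one factor \<open>exp (a * z - R\<^sup>2 / 2 * a\<^sup>2)\<close>, whose
  mean is at most 1 by subgaussianity. A round that ends the batch empties the data and sets the
  value to 1, which the indicator pays.\<close>

lemma TL_next_conditional:
  "(\<integral>\<^sup>+e. ennreal (TL i u (next_state st x e)) \<partial>EM) \<le> ennreal (TL i u st) + of_bool (reset st x)"
proof (cases "edges st x = {}")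
  case True
  have "TL i u (next_state st x e) = (if reset st x then 1 else TL i u st)" for e
    using True unfolding TL_def next_state_def reset_def tilt_def
    by (simp add: mat_mult_vec power2_norm_eq_inner)
  then show ?thesis by (simp add: EM.emeasure_space_1 add_increasing)
next
  case False
  show ?thesis
  proof (cases "mu st x i")
    case None
    then have "TL i u (next_state st x e) = TL i u st" for e
      using False unfolding TL_def next_state_def data'_def by simp
    then show ?thesis by (simp add: EM.emeasure_space_1)
  next
    case (Some j)
    let ?a = "u \<bullet> (x $ j)"
    have "TL i u (next_state st x e) = TL i u st * exp (?a * e (i, j) - R\<^sup>2 / 2 * ?a\<^sup>2)" for e
      using False Some unfolding TL_def next_state_def data'_def tilt_def
      by (simp add: util_def matrix_vector_mult_add_rdistrib outer_mult_vec inner_add_right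
          inner_commute[of "x $ j" u] power2_eq_square algebra_simps flip: exp_add)
    then have "(\<integral>\<^sup>+e. ennreal (TL i u (next_state st x e)) \<partial>EM) =
        (\<integral>\<^sup>+e. ennreal (TL i u st) * ennreal (exp (?a * e (i, j) - R\<^sup>2 / 2 * ?a\<^sup>2)) \<partial>EM)"
      by (simp add: ennreal_mult'[OF TL_nonneg])
    also have "\<dots> = ennreal (TL i u st) * (\<integral>\<^sup>+e. ennreal (exp (?a * e (i, j) - R\<^sup>2 / 2 * ?a\<^sup>2)) \<partial>EM)"
      by (rule nn_integral_cmult) simp
    also have "(\<integral>\<^sup>+e. ennreal (exp (?a * e (i, j) - R\<^sup>2 / 2 * ?a\<^sup>2)) \<partial>EM)
       = (\<integral>\<^sup>+z. ennreal (exp (?a * z - R\<^sup>2 / 2 * ?a\<^sup>2)) \<partial>\<nu>)"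
      by (rule nn_integral_EM_noise) simp
    also have "ennreal (TL i u st) * \<dots> \<le> ennreal (TL i u st) * 1"
      by (intro mult_left_mono nn_integral_subgaussian) simp
    finally show ?thesis by (simp add: add_increasing2)
  qed
qed

definition "resetN \<omega> t = (\<Sum>s<t. of_bool (reset (hist \<omega> s) (fst (\<omega> (Suc s)))) :: nat)"

lemma hist_gap: "fst (hist \<omega> t) = Del1 / sqrt 2 ^ resetN \<omega> t"
proof (induction t)
  case (Suc t)
  have "fst (hist \<omega> (Suc t)) = (if reset (hist \<omega> t) (fst (\<omega> (Suc t))) then fst (hist \<omega> t) / sqrt 2 else fst (hist \<omega> t))"
    unfolding hist_Suc next_state_def reset_def by simp
  then show ?case using Suc unfolding resetN_def by simp
qed (simp add: resetN_def)

text \<open>Iterates \<open>TL_next_conditional\<close>. \<open>resample\<close> turns round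
  \<open>Suc t\<close> into a fresh draw that \<open>hist \<omega> t\<close> does not see; once its
  noise is integrated out, a second use of \<open>resample\<close> returns the reset indicator to
  the actual round, where it increments \<open>resetN\<close>.\<close>

lemma expectation_TL:
  assumes "t \<le> T"
  shows "(\<integral>\<^sup>+\<omega>. ennreal (TL i u (hist \<omega> t)) \<partial>M) \<le> 1 + (\<integral>\<^sup>+\<omega>. of_nat (resetN \<omega> t) \<partial>M)"
  using assms
proof (induction t)
  case 0
  then show ?case
    by (simp add: TL_def tilt_def mat_mult_vec power2_norm_eq_inner M.emeasure_space_1)
next
  case (Suc t)
  have s: "Suc t \<in> {1..T}" and t: "t \<le> T" using Suc by auto
  note ms = mstate_hist[OF t]
  have mTL: "(\<lambda>\<omega>. ennreal (TL i u (hist \<omega> s))) \<in> borel_measurable M" if "s \<le> T" for s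
    using measurable_TL[OF mstate_hist[OF that], of "\<lambda>_. u"] by simp
  have pr: "Measurable.pred M (\<lambda>\<omega>. reset (hist \<omega> s) (fst (\<omega> (Suc s))))" if "s < T" for s
    using that by (intro pred_reset mstate_hist measurable_ctx) auto
  have [measurable]: "Measurable.pred M (\<lambda>\<omega>. reset (hist \<omega> t) (fst (\<omega> (Suc t))))" using pr Suc by simp
  have mr: "(\<lambda>\<omega>. of_bool (reset (hist \<omega> t) (fst (\<omega> (Suc t)))) :: ennreal) \<in> borel_measurable M"
    unfolding of_bool_def by measurable
  have "(\<integral>\<^sup>+\<omega>. ennreal (TL i u (hist \<omega> (Suc t))) \<partial>M)
    = (\<integral>\<^sup>+\<omega>. (\<integral>\<^sup>+z. ennreal (TL i u (hist (fun_upd \<omega> (Suc t) z) (Suc t))) \<partial>RM) \<partial>M)"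
    by (rule resample[OF mTL[OF Suc.prems] s])
  also have "\<dots> = (\<integral>\<^sup>+\<omega>. (\<integral>\<^sup>+z. ennreal (TL i u (next_state (hist \<omega> t) (fst z) (snd z))) \<partial>RM) \<partial>M)"
    unfolding hist_Suc by (simp add: hist_upd)
  also have "\<dots> \<le> (\<integral>\<^sup>+\<omega>. ennreal (TL i u (hist \<omega> t)) + (\<integral>\<^sup>+z. of_bool (reset (hist \<omega> t) (fst z)) \<partial>RM) \<partial>M)"
  proof (rule nn_integral_mono)
    fix \<omega>
    let ?st = "hist \<omega> t"
    have m1: "(\<lambda>z. ennreal (TL i u (next_state ?st (fst z) (snd z)))) \<in> borel_measurable RM"
      using measurable_TL[OF mstate_next[OF mstate_const measurable_RM_ctx measurable_RM_noise], of "\<lambda>_. u" i ?st] by simp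
    have [measurable]: "Measurable.pred Dx (\<lambda>x. reset ?st x)"
      by (rule pred_reset[OF mstate_const]) (simp add: measurable_ident_sets[OF Dx_sets])
    have [measurable]: "Measurable.pred RM (\<lambda>z. reset ?st (fst z))"
      by (rule pred_reset[OF mstate_const measurable_RM_ctx])
    have "(\<integral>\<^sup>+z. ennreal (TL i u (next_state ?st (fst z) (snd z))) \<partial>RM)
      = (\<integral>\<^sup>+x. (\<integral>\<^sup>+e. ennreal (TL i u (next_state ?st x e)) \<partial>EM) \<partial>Dx)"
      by (subst nn_integral_RM[OF m1]) simp
    also have "\<dots> \<le> (\<integral>\<^sup>+x. ennreal (TL i u ?st) + of_bool (reset ?st x) \<partial>Dx)"
      by (intro nn_integral_mono TL_next_conditional)
    also have "\<dots> = ennreal (TL i u ?st) + (\<integral>\<^sup>+x. of_bool (reset ?st x) \<partial>Dx)"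
      by (subst nn_integral_add) (auto simp: Dx.emeasure_space_1 of_bool_def)
    also have "(\<integral>\<^sup>+x. of_bool (reset ?st x) \<partial>Dx) = (\<integral>\<^sup>+x. of_bool (reset ?st x) \<partial>(distr RM Dx fst))"
      unfolding distr_RM_ctx ..
    also have "\<dots> = (\<integral>\<^sup>+z. of_bool (reset ?st (fst z)) \<partial>RM)"
      by (subst nn_integral_distr) (auto simp: of_bool_def)
    finally show "(\<integral>\<^sup>+z. ennreal (TL i u (next_state ?st (fst z) (snd z))) \<partial>RM)
      \<le> ennreal (TL i u ?st) + (\<integral>\<^sup>+z. of_bool (reset ?st (fst z)) \<partial>RM)" .
  qed
  also have "\<dots> = (\<integral>\<^sup>+\<omega>. ennreal (TL i u (hist \<omega> t)) \<partial>M) + (\<integral>\<^sup>+\<omega>. (\<integral>\<^sup>+z. of_bool (reset (hist \<omega> t) (fst z)) \<partial>RM) \<partial>M)"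
  proof (rule nn_integral_add)
    show "(\<lambda>\<omega>. ennreal (TL i u (hist \<omega> t))) \<in> borel_measurable M" by (rule mTL[OF t])
    have "Measurable.pred (M \<Otimes>\<^sub>M RM) (\<lambda>p. reset (hist (fst p) t) (fst (snd p)))"
      by (intro pred_reset mstate_compose[OF ms]) simp_all
    then have "(\<lambda>p. of_bool (reset (hist (fst p) t) (fst (snd p))) :: ennreal) \<in> borel_measurable (M \<Otimes>\<^sub>M RM)"
      unfolding of_bool_def by measurable
    from RM.borel_measurable_nn_integral_fst[OF this]
    show "(\<lambda>\<omega>. \<integral>\<^sup>+z. of_bool (reset (hist \<omega> t) (fst z)) \<partial>RM) \<in> borel_measurable M" by simp
  qed
  also have "(\<integral>\<^sup>+\<omega>. (\<integral>\<^sup>+z. of_bool (reset (hist \<omega> t) (fst z)) \<partial>RM) \<partial>M)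
     = (\<integral>\<^sup>+\<omega>. of_bool (reset (hist \<omega> t) (fst (\<omega> (Suc t)))) \<partial>M)"
    by (subst resample[OF mr s]) (simp add: hist_upd)
  also have "(\<integral>\<^sup>+\<omega>. ennreal (TL i u (hist \<omega> t)) \<partial>M) + \<dots> \<le>
      1 + (\<integral>\<^sup>+\<omega>. of_nat (resetN \<omega> t) \<partial>M) + (\<integral>\<^sup>+\<omega>. of_bool (reset (hist \<omega> t) (fst (\<omega> (Suc t)))) \<partial>M)"
    using Suc.IH t by (intro add_mono) auto
  also have "\<dots> = 1 + (\<integral>\<^sup>+\<omega>. of_nat (resetN \<omega> t) + of_bool (reset (hist \<omega> t) (fst (\<omega> (Suc t)))) \<partial>M)"
  proof -
    have "(\<lambda>\<omega>. of_nat (resetN \<omega> t) :: ennreal) \<in> borel_measurable M"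
      unfolding resetN_def of_nat_sum
    proof (intro borel_measurable_sum)
      fix s assume "s \<in> {..<t}"
      then have [measurable]: "Measurable.pred M (\<lambda>\<omega>. reset (hist \<omega> s) (fst (\<omega> (Suc s))))" using pr t by simp
      show "(\<lambda>\<omega>. of_nat (of_bool (reset (hist \<omega> s) (fst (\<omega> (Suc s))))) :: ennreal) \<in> borel_measurable M"
        unfolding of_bool_def by measurable
    qed
    then show ?thesis using mr by (simp add: nn_integral_add add.assoc)
  qed
  also have "(\<lambda>\<omega>. of_nat (resetN \<omega> t) + of_bool (reset (hist \<omega> t) (fst (\<omega> (Suc t)))) :: ennreal)
     = (\<lambda>\<omega>. of_nat (resetN \<omega> (Suc t)))"
    unfolding resetN_def by simp
  finally show ?case .
qed

end

section \<open>Number of batches and failure probability of the estimates\<close>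

context barb_prob
begin

definition "D0 = real T powr (- 1 / 3)"
definition "Wmax = 1 / Del1\<^sup>2 + 2 / D0\<^sup>2 + 32 / (3 * ln (real T)) * real T"
definition "Crho = log 2 (Del1\<^sup>2 * Wmax)"

lemma D0_pos: "D0 > 0"
  unfolding D0_def using T_pos by simp

lemma fineN_le: "fineN a \<omega> t \<le> t"
proof -
  have "fineN a \<omega> t \<le> (\<Sum>s<t. 1)" unfolding fineN_def by (intro sum_mono) simp
  then show ?thesis by simp
qed

text \<open>\<open>Wmax\<close> is the bound of \<open>count_inv\<close> with the number of fine
  flagged rounds replaced by \<open>T\<close>. By \<open>hist_gap\<close> the inverse squared gap is
  \<open>2 ^ resetN \<omega> t / Del1\<^sup>2\<close>, so the bound holds on every path with bounded
  contexts.\<close>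

lemma resetN_bound:
  assumes "bounded_ctx \<omega>" "t \<le> T"
  shows "real (resetN \<omega> t) \<le> Crho"
proof -
  have "1 / (fst (hist \<omega> t))\<^sup>2 \<le> 1 / Del1\<^sup>2 + 2 / D0\<^sup>2 + 32 / (3 * ln (real T)) * real (fineN D0 \<omega> t)"
    using hist_invariants[OF assms D0_pos] unfolding count_inv_def by blast
  also have "\<dots> \<le> Wmax"
    unfolding Wmax_def using fineN_le[of D0 \<omega> t] assms(2) T_pos by (intro add_left_mono mult_left_mono) auto
  finally have 1: "1 / (fst (hist \<omega> t))\<^sup>2 \<le> Wmax" .
  have "(sqrt 2 ^ resetN \<omega> t)\<^sup>2 = (2::real) ^ resetN \<omega> t"
    by (simp add: power_mult[symmetric] mult.commute) (simp add: power_mult)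
  then have "(2::real) ^ resetN \<omega> t = Del1\<^sup>2 * (1 / (fst (hist \<omega> t))\<^sup>2)"
    unfolding hist_gap using Del1_pos by (simp add: power_divide)
  also have "\<dots> \<le> Del1\<^sup>2 * Wmax" using 1 by (intro mult_left_mono) auto
  finally have "log 2 (2 ^ resetN \<omega> t) \<le> log 2 (Del1\<^sup>2 * Wmax)" by (intro log_mono) auto
  then show ?thesis unfolding Crho_def by (simp add: log_nat_power)
qed

lemma Crho_nonneg: "0 \<le> Crho"
proof -
  have "Wmax \<ge> 1 / Del1\<^sup>2" unfolding Wmax_def using T_pos by simp
  then have "Del1\<^sup>2 * Wmax \<ge> 1" using Del1_pos by (simp add: field_simps)
  then show ?thesis unfolding Crho_def by simp
qed

definition "Pbad = real N * (1 + Crho) / real T"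

text \<open>Markov's inequality for the mixture. On the failure event some player's mixture integral
  is at least \<open>T ^ d * G\<close>, while by Fubini and \<open>expectation_TL\<close> the
  expected sum over all players is at most \<open>N * (1 + Crho) * G\<close>. The mass
  \<open>G\<close> cancels.\<close>

lemma prob_inaccurate:
  assumes t: "t \<le> T"
  shows "measure M {\<omega> \<in> space M. \<not> accurate (hist \<omega> t)} \<le> Pbad"
proof -
  note ms = mstate_hist[OF t]
  define G where "G = gauss_mass TYPE((real, 'd) vec) (R\<^sup>2 * lam / 2)"
  define W where "W u = ennreal (exp (- (R\<^sup>2 * lam / 2) * (norm u)\<^sup>2))" for u :: "(real, 'd) vec"
  have G: "G \<noteq> 0" "G \<noteq> \<top>"
    using gauss_mass_pos[where 'a="(real, 'd) vec"] gauss_mass_finite[where 'a="(real, 'd) vec" and a="R\<^sup>2 * lam / 2"] R_pos lam_pos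
    unfolding G_def by (auto simp: zero_less_iff_neq_zero)
  have W [measurable]: "W \<in> borel_measurable borel" unfolding W_def by measurable
  have pa [measurable]: "Measurable.pred M (\<lambda>\<omega>. accurate (hist \<omega> t))"
    by (rule pred_accurate[OF ms measurable_ctx[of 1]]) (use T2 in auto)
  define B where "B = {\<omega> \<in> space M. \<not> accurate (hist \<omega> t)}"
  have B [measurable]: "B \<in> sets M" unfolding B_def by measurable
  have mTL2: "(\<lambda>p. ennreal (TL i (snd p) (hist (fst p) t)) * W (snd p)) \<in> borel_measurable (M \<Otimes>\<^sub>M lborel)" for i
  proof -
    have "(\<lambda>p. TL i (snd p) (hist (fst p) t)) \<in> borel_measurable (M \<Otimes>\<^sub>M lborel)"
      by (rule measurable_TL[OF mstate_compose[OF ms]]) auto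
    then show ?thesis by measurable
  qed
  interpret pair_sigma_finite M "lborel :: (real, 'd) vec measure" ..
  have mI: "(\<lambda>\<omega>. \<integral>\<^sup>+u. ennreal (TL i u (hist \<omega> t)) * W u \<partial>lborel) \<in> borel_measurable M" for i
    using lborel.borel_measurable_nn_integral_fst[OF mTL2[of i]] by simp
  have "ennreal (real T ^ d) * G * emeasure M B = (\<integral>\<^sup>+\<omega>. ennreal (real T ^ d) * G * indicator B \<omega> \<partial>M)"
    by (subst nn_integral_cmult) auto
  also have "\<dots> \<le> (\<integral>\<^sup>+\<omega>. (\<Sum>i\<in>UNIV. \<integral>\<^sup>+u. ennreal (TL i u (hist \<omega> t)) * W u \<partial>lborel) \<partial>M)"
  proof (rule nn_integral_mono_AE, use AE_bounded_ctx in eventually_elim)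
    fix \<omega> assume b: "bounded_ctx \<omega>"
    show "ennreal (real T ^ d) * G * indicator B \<omega> \<le> (\<Sum>i\<in>UNIV. \<integral>\<^sup>+u. ennreal (TL i u (hist \<omega> t)) * W u \<partial>lborel)"
    proof (cases "\<omega> \<in> B")
      case True
      define st where "st = hist \<omega> t"
      have ok: "state_ok t st" unfolding st_def using hist_invariants[OF b t D0_pos] by blast
      obtain i where i: "(wnorm (gram_inv lam (snd (snd st) i)) (noise_sum lam (\<theta> i) (snd (snd st) i)))\<^sup>2 > R\<^sup>2 * conf"
        using True unfolding B_def accurate_def st_def by (auto simp: not_le)
      have "ennreal (real T ^ CARD('d)) * G \<le> (\<integral>\<^sup>+u. ennreal (TL i u st) * W u \<partial>lborel)"
        unfolding G_def W_def TL_def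
      proof (rule gauss_mixture_bad[OF lam_pos R_pos, where B=Bx])
        show "T > 0" using T2 by simp
        show "norm (fst p) \<le> Bx" if "p \<in> set (snd (snd st) i)" for p using ok that unfolding state_ok_def by blast
        show "length (snd (snd st) i) \<le> T" using ok t unfolding state_ok_def by (meson order_trans)
        show "R\<^sup>2 * (real CARD('d) * ln ((1 + real T * Bx\<^sup>2 / lam) * (real T)\<^sup>2))
          < (wnorm (gram_inv lam (snd (snd st) i)) (noise_sum lam (\<theta> i) (snd (snd st) i)))\<^sup>2"
          using i unfolding conf_def d_eq[symmetric] by simp
      qed
      also have "\<dots> \<le> (\<Sum>i\<in>UNIV. \<integral>\<^sup>+u. ennreal (TL i u st) * W u \<partial>lborel)"
        by (rule member_le_sum) auto
      finally show ?thesis using True unfolding st_def d_eq[symmetric] by simp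
    qed simp
  qed
  also have "\<dots> = (\<Sum>i\<in>UNIV. \<integral>\<^sup>+\<omega>. (\<integral>\<^sup>+u. ennreal (TL i u (hist \<omega> t)) * W u \<partial>lborel) \<partial>M)"
    by (rule nn_integral_sum) (rule mI)
  also have "\<dots> \<le> (\<Sum>i\<in>(UNIV::'n set). ennreal (1 + Crho) * G)"
  proof (rule sum_mono)
    fix i
    have "(\<integral>\<^sup>+\<omega>. (\<integral>\<^sup>+u. ennreal (TL i u (hist \<omega> t)) * W u \<partial>lborel) \<partial>M)
       = (\<integral>\<^sup>+u. (\<integral>\<^sup>+\<omega>. ennreal (TL i u (hist \<omega> t)) * W u \<partial>M) \<partial>lborel)"
      by (rule Fubini'[symmetric]) (use mTL2[of i] in \<open>simp add: split_beta'\<close>)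
    also have "\<dots> = (\<integral>\<^sup>+u. (\<integral>\<^sup>+\<omega>. ennreal (TL i u (hist \<omega> t)) \<partial>M) * W u \<partial>lborel)"
    proof (rule nn_integral_cong)
      fix u
      have "(\<lambda>\<omega>. ennreal (TL i u (hist \<omega> t))) \<in> borel_measurable M"
        using measurable_TL[OF ms, of "\<lambda>_. u"] by simp
      then show "(\<integral>\<^sup>+\<omega>. ennreal (TL i u (hist \<omega> t)) * W u \<partial>M) = (\<integral>\<^sup>+\<omega>. ennreal (TL i u (hist \<omega> t)) \<partial>M) * W u"
        by (rule nn_integral_multc)
    qed
    also have "\<dots> \<le> (\<integral>\<^sup>+u. ennreal (1 + Crho) * W u \<partial>lborel)"
    proof (intro nn_integral_mono mult_right_mono)
      fix u
      have "(\<integral>\<^sup>+\<omega>. of_nat (resetN \<omega> t) \<partial>M) \<le> (\<integral>\<^sup>+\<omega>. ennreal Crho \<partial>M)"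
      proof (rule nn_integral_mono_AE, use AE_bounded_ctx in eventually_elim)
        fix \<omega> assume "bounded_ctx \<omega>"
        then show "of_nat (resetN \<omega> t) \<le> ennreal Crho"
          using resetN_bound[OF _ t] by (simp add: ennreal_of_nat_eq_real_of_nat ennreal_leI)
      qed
      also have "\<dots> = ennreal Crho" by (simp add: M.emeasure_space_1)
      finally have "1 + (\<integral>\<^sup>+\<omega>. of_nat (resetN \<omega> t) \<partial>M) \<le> 1 + ennreal Crho" by (intro add_left_mono)
      also have "\<dots> = ennreal (1 + Crho)" using Crho_nonneg by (simp add: ennreal_plus)
      finally show "(\<integral>\<^sup>+\<omega>. ennreal (TL i u (hist \<omega> t)) \<partial>M) \<le> ennreal (1 + Crho)"
        using expectation_TL[OF t, of i u] order_trans by blast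
    qed simp
    also have "\<dots> = ennreal (1 + Crho) * G"
      unfolding G_def gauss_mass_def W_def by (rule nn_integral_cmult) simp
    finally show "(\<integral>\<^sup>+\<omega>. (\<integral>\<^sup>+u. ennreal (TL i u (hist \<omega> t)) * W u \<partial>lborel) \<partial>M) \<le> ennreal (1 + Crho) * G" .
  qed
  also have "\<dots> = ennreal (real N * (1 + Crho)) * G"
    using Crho_nonneg by (simp add: N_eq[symmetric] ennreal_mult ennreal_of_nat_eq_real_of_nat mult.assoc)
  finally have "G * (ennreal (real T ^ d) * emeasure M B) \<le> G * ennreal (real N * (1 + Crho))"
    by (simp add: mult_ac)
  then have "ennreal (real T ^ d) * emeasure M B \<le> ennreal (real N * (1 + Crho))"
    using G by (simp add: ennreal_mult_le_mult_iff)
  then have "ennreal (real T ^ d * measure M B) \<le> ennreal (real N * (1 + Crho))"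
    by (simp add: M.emeasure_eq_measure ennreal_mult)
  then have 1: "real T ^ d * measure M B \<le> real N * (1 + Crho)"
    using Crho_nonneg by (subst (asm) ennreal_le_iff) auto
  \<comment> \<open>From here only one power of \<open>T\<close> is kept.\<close>
  have "d \<ge> 1" using d_eq by (simp add: Suc_leI)
  then have "real T ^ 1 \<le> real T ^ d" using T2 by (intro power_increasing) auto
  then have "real T * measure M B \<le> real T ^ d * measure M B" by (intro mult_right_mono) auto
  then show ?thesis using 1 T_pos unfolding Pbad_def B_def by (simp add: field_simps)
qed

subsection \<open>The noise has mean zero\<close>

text \<open>The index \<open>t\<close> refers to round \<open>Suc t\<close>, named after the state
  in which it starts; \<open>bad\<close> and \<open>fine_flag\<close> follow the same
  convention.\<close>

definition matched :: "nat \<Rightarrow> 'n \<Rightarrow> 'k \<Rightarrow> (nat \<Rightarrow> ((real, 'd) vec, 'k) vec \<times> ('n \<times> 'k \<Rightarrow> real)) \<Rightarrow> bool" where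
  "matched t i j \<omega> \<longleftrightarrow> mu (hist \<omega> t) (fst (\<omega> (Suc t))) i = Some j"

lemma pred_matched:
  assumes "t < T"
  shows "Measurable.pred M (matched t i j)"
proof -
  have "(\<lambda>\<omega>. mu (hist \<omega> t) (fst (\<omega> (Suc t)))) \<in> measurable M (count_space UNIV)"
    using assms by (intro measurable_mu mstate_hist measurable_ctx) auto
  from measurable_compose[OF this, of "\<lambda>m. m i = Some j" "count_space UNIV"] show ?thesis
    unfolding matched_def[abs_def] by simp
qed

text \<open>The matching of a round depends on the past and on the current contexts, both
  independent of the current noise. Stated for nonnegative integrands so that it applies to the
  positive and negative parts of the noise before integrability is known.\<close>

lemma nn_integral_matched_noise:
  assumes t: "t < T" and g [measurable]: "g \<in> borel_measurable borel"
  shows "(\<integral>\<^sup>+\<omega>. of_bool (matched t i j \<omega>) * g (snd (\<omega> (Suc t)) (i, j)) \<partial>M)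
    = (\<integral>\<^sup>+\<omega>. of_bool (matched t i j \<omega>) \<partial>M) * (\<integral>\<^sup>+z. g z \<partial>\<nu>)"
proof -
  have s: "Suc t \<in> {1..T}" and tT: "t \<le> T" using t by auto
  let ?Q = "\<lambda>st x. mu st x i = Some j"
  have pQ: "Measurable.pred A (\<lambda>w. ?Q (S w) (x w))" if "mstate A S" "x \<in> borel_measurable A" for A S x
    using measurable_compose[OF measurable_mu[OF that], of "\<lambda>m. m i = Some j" "count_space UNIV"] by simp
  note [measurable] = pred_matched[OF t, of i j] measurable_noise[OF s]
  have bM: "(\<lambda>\<omega>. of_bool (matched t i j \<omega>) :: ennreal) \<in> borel_measurable M"
    unfolding of_bool_def by measurable
  have bM2: "(\<lambda>\<omega>. of_bool (matched t i j \<omega>) * g (snd (\<omega> (Suc t)) (i, j))) \<in> borel_measurable M"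
    using bM by measurable
  have mt: "matched t i j (fun_upd \<omega> (Suc t) z) \<longleftrightarrow> ?Q (hist \<omega> t) (fst z)" for \<omega> z
    unfolding matched_def by (simp add: hist_upd)
  have inner: "(\<integral>\<^sup>+z. of_bool (?Q st (fst z)) * g (snd z (i, j)) \<partial>RM)
     = (\<integral>\<^sup>+z. of_bool (?Q st (fst z)) \<partial>RM) * (\<integral>\<^sup>+z. g z \<partial>\<nu>)" for st
  proof -
    have [measurable]: "Measurable.pred RM (\<lambda>z. ?Q st (fst z))" by (rule pQ[OF mstate_const measurable_RM_ctx])
    have [measurable]: "Measurable.pred Dx (\<lambda>x. ?Q st x)"
      by (rule pQ[OF mstate_const]) (simp add: measurable_ident_sets[OF Dx_sets])
    have [measurable]: "(\<lambda>z. g (snd z (i, j))) \<in> borel_measurable RM"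
      by (rule measurable_compose[OF measurable_RM_noise g])
    have [measurable]: "(\<lambda>e. g (e (i, j))) \<in> borel_measurable EM"
      by (rule measurable_compose[OF measurable_EM_noise g])
    have "(\<integral>\<^sup>+z. of_bool (?Q st (fst z)) * g (snd z (i, j)) \<partial>RM)
      = (\<integral>\<^sup>+x. (\<integral>\<^sup>+e. of_bool (?Q st x) * g (e (i, j)) \<partial>EM) \<partial>Dx)"
      by (subst nn_integral_RM) (auto simp: of_bool_def)
    also have "\<dots> = (\<integral>\<^sup>+x. of_bool (?Q st x) * (\<integral>\<^sup>+z. g z \<partial>\<nu>) \<partial>Dx)"
      by (intro nn_integral_cong) (simp add: nn_integral_cmult nn_integral_EM_noise[OF g])
    also have "\<dots> = (\<integral>\<^sup>+x. of_bool (?Q st x) \<partial>Dx) * (\<integral>\<^sup>+z. g z \<partial>\<nu>)"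
      by (rule nn_integral_multc) (simp add: of_bool_def)
    also have "(\<integral>\<^sup>+x. of_bool (?Q st x) \<partial>Dx) = (\<integral>\<^sup>+x. of_bool (?Q st x) \<partial>(distr RM Dx fst))"
      unfolding distr_RM_ctx ..
    also have "\<dots> = (\<integral>\<^sup>+z. of_bool (?Q st (fst z)) \<partial>RM)"
      by (subst nn_integral_distr) (auto simp: of_bool_def)
    finally show ?thesis .
  qed
  have "(\<integral>\<^sup>+\<omega>. of_bool (matched t i j \<omega>) * g (snd (\<omega> (Suc t)) (i, j)) \<partial>M)
    = (\<integral>\<^sup>+\<omega>. (\<integral>\<^sup>+z. of_bool (?Q (hist \<omega> t) (fst z)) * g (snd z (i, j)) \<partial>RM) \<partial>M)"
    by (subst resample[OF bM2 s]) (simp add: mt)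
  also have "\<dots> = (\<integral>\<^sup>+\<omega>. (\<integral>\<^sup>+z. of_bool (?Q (hist \<omega> t) (fst z)) \<partial>RM) * (\<integral>\<^sup>+z. g z \<partial>\<nu>) \<partial>M)"
    unfolding inner ..
  also have "\<dots> = (\<integral>\<^sup>+\<omega>. (\<integral>\<^sup>+z. of_bool (?Q (hist \<omega> t) (fst z)) \<partial>RM) \<partial>M) * (\<integral>\<^sup>+z. g z \<partial>\<nu>)"
  proof (rule nn_integral_multc)
    have "Measurable.pred (M \<Otimes>\<^sub>M RM) (\<lambda>p. ?Q (hist (fst p) t) (fst (snd p)))"
      by (intro pQ mstate_compose[OF mstate_hist[OF tT]]) simp_all
    then have "(\<lambda>p. of_bool (?Q (hist (fst p) t) (fst (snd p))) :: ennreal) \<in> borel_measurable (M \<Otimes>\<^sub>M RM)"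
      unfolding of_bool_def by measurable
    from RM.borel_measurable_nn_integral_fst[OF this]
    show "(\<lambda>\<omega>. \<integral>\<^sup>+z. of_bool (?Q (hist \<omega> t) (fst z)) \<partial>RM) \<in> borel_measurable M" by simp
  qed
  also have "(\<integral>\<^sup>+\<omega>. (\<integral>\<^sup>+z. of_bool (?Q (hist \<omega> t) (fst z)) \<partial>RM) \<partial>M) = (\<integral>\<^sup>+\<omega>. of_bool (matched t i j \<omega>) \<partial>M)"
    by (subst resample[OF bM s]) (simp add: mt)
  finally show ?thesis .
qed

lemma matched_noise_mean:
  assumes t: "t < T"
  shows "integrable M (\<lambda>\<omega>. of_bool (matched t i j \<omega>) * snd (\<omega> (Suc t)) (i, j))"
    and "(\<integral>\<omega>. of_bool (matched t i j \<omega>) * snd (\<omega> (Suc t)) (i, j) \<partial>M) = 0"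
proof -
  have s: "Suc t \<in> {1..T}" using t by auto
  note [measurable] = pred_matched[OF t, of i j] measurable_noise[OF s]
  let ?f = "\<lambda>\<omega>. of_bool (matched t i j \<omega>) * snd (\<omega> (Suc t)) (i, j) :: real"
  have f [measurable]: "?f \<in> borel_measurable M" unfolding of_bool_def by measurable
  define K where "K = (\<integral>\<^sup>+\<omega>. of_bool (matched t i j \<omega>) \<partial>M)"
  have "K \<le> (\<integral>\<^sup>+\<omega>. 1 \<partial>M)" unfolding K_def by (intro nn_integral_mono) simp
  then have K: "K \<le> 1" by (simp add: M.emeasure_space_1)
  \<comment> \<open>As \<open>h 0 = 0\<close>, the indicator can be moved out of \<open>h\<close>.
    Since \<open>ennreal\<close> truncates at 0, the identity and its negative give the positive and
    negative parts, and the absolute value gives integrability.\<close>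
  have part: "(\<integral>\<^sup>+\<omega>. ennreal (h (?f \<omega>)) \<partial>M) = K * (\<integral>\<^sup>+z. ennreal (h z) \<partial>\<nu>)"
    if h [measurable]: "h \<in> borel_measurable borel" "h 0 = (0::real)" for h :: "real \<Rightarrow> real"
  proof -
    have "(\<lambda>\<omega>. ennreal (h (?f \<omega>))) = (\<lambda>\<omega>. of_bool (matched t i j \<omega>) * ennreal (h (snd (\<omega> (Suc t)) (i, j))))"
      using h(2) by (auto simp: fun_eq_iff)
    then show ?thesis
      unfolding K_def using nn_integral_matched_noise[OF t, of "\<lambda>z. ennreal (h z)" i j] by simp
  qed
  have "(\<integral>\<^sup>+\<omega>. ennreal \<bar>?f \<omega>\<bar> \<partial>M) = K * (\<integral>\<^sup>+z. ennreal \<bar>z\<bar> \<partial>\<nu>)"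
    by (rule part) auto
  also have "\<dots> \<le> 1 * (\<integral>\<^sup>+z. ennreal \<bar>z\<bar> \<partial>\<nu>)" using K by (intro mult_right_mono) auto
  also have "\<dots> < \<infinity>" using nu_int by (simp add: integrable_iff_bounded)
  finally show i: "integrable M ?f" using f by (intro integrableI_bounded) auto
  have "enn2real (\<integral>\<^sup>+z. ennreal z \<partial>\<nu>) = enn2real (\<integral>\<^sup>+z. ennreal (- z) \<partial>\<nu>)"
    using real_lebesgue_integral_def[OF nu_int] nu_mean by simp
  moreover have "(\<integral>\<^sup>+\<omega>. ennreal (?f \<omega>) \<partial>M) = K * (\<integral>\<^sup>+z. ennreal z \<partial>\<nu>)"
    using part[of "\<lambda>z. z"] by simp
  moreover have "(\<integral>\<^sup>+\<omega>. ennreal (- ?f \<omega>) \<partial>M) = K * (\<integral>\<^sup>+z. ennreal (- z) \<partial>\<nu>)"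
    using part[of "\<lambda>z. - z"] by simp
  ultimately show "(\<integral>\<omega>. ?f \<omega> \<partial>M) = 0"
    using real_lebesgue_integral_def[OF i] by (simp add: enn2real_mult)
qed

subsection \<open>The regret bound\<close>

lemma integral_of_bool:
  assumes [measurable]: "Measurable.pred M P"
  shows "integrable M (\<lambda>\<omega>. of_bool (P \<omega>) :: real)"
    and "(\<integral>\<omega>. of_bool (P \<omega>) \<partial>M) = measure M {\<omega> \<in> space M. P \<omega>}"
proof -
  have m: "(\<lambda>\<omega>. of_bool (P \<omega>) :: real) \<in> borel_measurable M" unfolding of_bool_def by measurable
  then show "integrable M (\<lambda>\<omega>. of_bool (P \<omega>) :: real)"
    by (rule M.integrable_const_bound[where B=1, rotated]) auto
  have "(\<integral>\<omega>. of_bool (P \<omega>) \<partial>M) = (\<integral>\<omega>. indicator {\<omega> \<in> space M. P \<omega>} \<omega> \<partial>M :: real)"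
    by (intro Bochner_Integration.integral_cong) (auto simp: indicator_def)
  then show "(\<integral>\<omega>. of_bool (P \<omega>) \<partial>M) = measure M {\<omega> \<in> space M. P \<omega>}" by simp
qed

lemma prob_small_delta_min:
  assumes "s \<in> {1..T}" "0 < a" "a \<le> Del0"
  shows "measure M {\<omega> \<in> space M. delta_min \<theta> (fst (\<omega> s)) \<le> a} \<le> c * a"
proof -
  have pD: "Measurable.pred Dx (\<lambda>x. delta_min \<theta> x \<le> a)"
    by (rule pred_delta_min) (simp add: measurable_ident_sets[OF Dx_sets])
  then have A: "{x \<in> space Dx. delta_min \<theta> x \<le> a} \<in> sets Dx" by (simp add: pred_def)
  have f: "(\<lambda>\<omega>. fst (\<omega> s)) \<in> measurable M Dx" using measurable_ctx[OF assms(1)] by simp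
  have "distr M Dx (\<lambda>\<omega>. fst (\<omega> s)) = distr (distr M RM (\<lambda>\<omega>. \<omega> s)) Dx fst"
    by (subst distr_distr) (auto simp: comp_def intro: measurable_coord[OF assms(1)])
  also have "\<dots> = Dx" unfolding distr_coord[OF assms(1)] distr_RM_ctx ..
  finally have d: "distr M Dx (\<lambda>\<omega>. fst (\<omega> s)) = Dx" .
  have "measure Dx {x \<in> space Dx. delta_min \<theta> x \<le> a} =
      measure M ((\<lambda>\<omega>. fst (\<omega> s)) -` {x \<in> space Dx. delta_min \<theta> x \<le> a} \<inter> space M)"
    by (subst d[symmetric], rule measure_distr[OF f A])
  also have "(\<lambda>\<omega>. fst (\<omega> s)) -` {x \<in> space Dx. delta_min \<theta> x \<le> a} \<inter> space M = {\<omega> \<in> space M. delta_min \<theta> (fst (\<omega> s)) \<le> a}"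
    using measurable_space[OF f] by auto
  finally show ?thesis using cdf[OF assms(2,3)] by simp
qed

definition "bad t \<omega> \<longleftrightarrow> \<not> accurate (hist \<omega> t)"
definition "fine_flag t \<omega> \<longleftrightarrow> flagged (hist \<omega> t) (fst (\<omega> (Suc t))) \<and> fst (hist \<omega> t) \<le> D0"

lemma pred_bad: "t \<le> T \<Longrightarrow> Measurable.pred M (bad t)"
  unfolding bad_def[abs_def]
  using pred_accurate[OF mstate_hist measurable_ctx[of 1]] T2 by simp

lemma pred_fine_flag:
  assumes t: "t < T"
  shows "Measurable.pred M (fine_flag t)"
proof -
  have [measurable]: "Measurable.pred M (\<lambda>\<omega>. flagged (hist \<omega> t) (fst (\<omega> (Suc t))))"
    using t by (intro pred_flagged mstate_hist measurable_ctx) auto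
  have [measurable]: "(\<lambda>\<omega>. fst (hist \<omega> t)) \<in> borel_measurable M"
    using t by (intro mstateD mstate_hist) auto
  show ?thesis unfolding fine_flag_def[abs_def] by measurable
qed

lemma prob_fine_flag:
  assumes t: "t < T" and D0: "4 * D0 \<le> Del0"
  shows "measure M {\<omega> \<in> space M. fine_flag t \<omega>} \<le> Pbad + c * (4 * D0)"
proof -
  have s: "Suc t \<in> {1..T}" using t by auto
  note [measurable] = pred_bad[of t] pred_fine_flag[OF t] pred_delta_min[OF measurable_ctx[OF s], of \<theta> "4 * D0"]
  have [measurable]: "Measurable.pred M (bad t)" using pred_bad t by simp
  have "measure M {\<omega> \<in> space M. fine_flag t \<omega>} \<le>
      measure M ({\<omega> \<in> space M. bad t \<omega>} \<union> {\<omega> \<in> space M. delta_min \<theta> (fst (\<omega> (Suc t))) \<le> 4 * D0})"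
  proof (rule M.finite_measure_mono_AE, use AE_bounded_ctx in eventually_elim, rule impI)
    fix \<omega> assume b: "bounded_ctx \<omega>" and "\<omega> \<in> {\<omega> \<in> space M. fine_flag t \<omega>}"
    then have w: "\<omega> \<in> space M" and f: "flagged (hist \<omega> t) (fst (\<omega> (Suc t)))" "fst (hist \<omega> t) \<le> D0"
      unfolding fine_flag_def by auto
    have "state_ok t (hist \<omega> t)" using hist_invariants[OF b _ D0_pos] t by simp
    then have "fst (hist \<omega> t) > 0" unfolding state_ok_def by simp
    then show "\<omega> \<in> {\<omega> \<in> space M. bad t \<omega>} \<union> {\<omega> \<in> space M. delta_min \<theta> (fst (\<omega> (Suc t))) \<le> 4 * D0}"
      using flagged_delta_min[OF _ f(1)] f(2) w unfolding bad_def by force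
  qed measurable
  also have "\<dots> \<le> measure M {\<omega> \<in> space M. bad t \<omega>} + measure M {\<omega> \<in> space M. delta_min \<theta> (fst (\<omega> (Suc t))) \<le> 4 * D0}"
    by (rule measure_Un_le) measurable
  also have "\<dots> \<le> Pbad + c * (4 * D0)"
    using prob_inaccurate[of t] t prob_small_delta_min[OF s, of "4 * D0"] D0 D0_pos unfolding bad_def by (intro add_mono) auto
  finally show ?thesis .
qed

text \<open>The factor 2 adds the current batch to the finished ones; each side contributes at most
  \<open>Qexp + Qflag\<close> over the squared gap.\<close>

definition "Qtot = 2 * (Qexp + Qflag)"

lemma Qtot_nonneg: "0 \<le> Qtot"
  unfolding Qtot_def Qexp_def Qflag_def using Lpot_nonneg T_pos by simp

text \<open>The last clause of \<open>count_inv\<close> trades the random final gap for the number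
  of fine flagged rounds. The bound is linear in indicators of single rounds, so its expectation
  needs only their probabilities.\<close>

lemma cumulative_regret_path:
  assumes b: "bounded_ctx \<omega>"
  shows "(\<Sum>t<T. Ustar arank \<theta> (fst (\<omega> (Suc t))) i
        - match_val (util \<theta> (fst (\<omega> (Suc t)))) (mu (hist \<omega> t) (fst (\<omega> (Suc t)))) i)
    \<le> Qtot * (1 / Del1\<^sup>2 + 2 / D0\<^sup>2 + 32 / (3 * ln (real T)) * (\<Sum>t<T. of_bool (fine_flag t \<omega>)))
      + (\<Sum>t<T. of_bool (bad t \<omega>))"
proof -
  have ok: "state_ok t (hist \<omega> t)" if "t \<le> T" for t using hist_invariants[OF b that D0_pos] by blast
  have inv: "count_inv D0 (explN \<omega> T) (flagN \<omega> T) (fineN D0 \<omega> T) (hist \<omega> T)"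
    using hist_invariants[OF b order_refl D0_pos] by blast
  have "(\<Sum>t<T. Ustar arank \<theta> (fst (\<omega> (Suc t))) i
        - match_val (util \<theta> (fst (\<omega> (Suc t)))) (mu (hist \<omega> t) (fst (\<omega> (Suc t)))) i)
     \<le> (\<Sum>t<T. of_bool (edges (hist \<omega> t) (fst (\<omega> (Suc t))) \<noteq> {})
          + of_bool (flagged (hist \<omega> t) (fst (\<omega> (Suc t)))) + of_bool (bad t \<omega>))"
  proof (rule sum_mono)
    fix t assume t: "t \<in> {..<T}"
    have "norm (fst (\<omega> (Suc t)) $ j) \<le> Bx" for j using b t unfolding bounded_ctx_def by auto
    moreover have "fst (hist \<omega> t) > 0" using ok[of t] t unfolding state_ok_def by simp
    ultimately show "Ustar arank \<theta> (fst (\<omega> (Suc t))) i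
        - match_val (util \<theta> (fst (\<omega> (Suc t)))) (mu (hist \<omega> t) (fst (\<omega> (Suc t)))) i
       \<le> of_bool (edges (hist \<omega> t) (fst (\<omega> (Suc t))) \<noteq> {})
          + of_bool (flagged (hist \<omega> t) (fst (\<omega> (Suc t)))) + of_bool (bad t \<omega>)"
      unfolding bad_def by (rule round_regret)
  qed
  also have "\<dots> = real (explN \<omega> T) + real (flagN \<omega> T) + (\<Sum>t<T. of_bool (bad t \<omega>))"
    unfolding explN_def flagN_def by (simp add: sum.distrib)
  also have "real (explN \<omega> T) + real (flagN \<omega> T) \<le> Qtot * (1 / (fst (hist \<omega> T))\<^sup>2)"
  proof -
    have "real (explN \<omega> T) \<le> 2 * Qexp / (fst (hist \<omega> T))\<^sup>2"
      using inv total_data_bound[OF ok order_refl] unfolding count_inv_def by simp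
    moreover have "real (flagN \<omega> T) \<le> 2 * Qflag / (fst (hist \<omega> T))\<^sup>2"
    proof -
      have "real (fst (snd (hist \<omega> T))) \<le> (3 * ln (real T) / 16) / (fst (hist \<omega> T))\<^sup>2"
        using ok[of T] unfolding state_ok_def batch_size_def by simp
      also have "\<dots> \<le> Qflag / (fst (hist \<omega> T))\<^sup>2"
        unfolding Qflag_def by (intro divide_right_mono) auto
      finally show ?thesis using inv unfolding count_inv_def by simp
    qed
    ultimately show ?thesis unfolding Qtot_def by (simp add: add_divide_distrib distrib_left)
  qed
  also have "Qtot * (1 / (fst (hist \<omega> T))\<^sup>2) \<le> Qtot * (1 / Del1\<^sup>2 + 2 / D0\<^sup>2 + 32 / (3 * ln (real T)) * real (fineN D0 \<omega> T))"
    using inv Qtot_nonneg unfolding count_inv_def by (intro mult_left_mono) auto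
  also have "real (fineN D0 \<omega> T) = (\<Sum>t<T. of_bool (fine_flag t \<omega>))"
    unfolding fineN_def fine_flag_def by simp
  finally show ?thesis by simp
qed

text \<open>At most one term of the sum is nonzero. Spreading the noise over fixed arms lets
  \<open>matched_noise_mean\<close> apply to each of them.\<close>

lemma barb_obs_eq:
  "barb_obs T R lam Bth Bx Del1 arank mcm \<theta> \<omega> (Suc t) i =
    match_val (util \<theta> (fst (\<omega> (Suc t)))) (mu (hist \<omega> t) (fst (\<omega> (Suc t)))) i
    + (\<Sum>j\<in>UNIV. of_bool (matched t i j \<omega>) * snd (\<omega> (Suc t)) (i, j))"
proof -
  have "barb_obs T R lam Bth Bx Del1 arank mcm \<theta> \<omega> (Suc t) i =
    (case mu (hist \<omega> t) (fst (\<omega> (Suc t))) i of None \<Rightarrow> 0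
      | Some j \<Rightarrow> util \<theta> (fst (\<omega> (Suc t))) i j + snd (\<omega> (Suc t)) (i, j))"
    unfolding barb_obs_def using barb_round_eq[of "fst (\<omega> (Suc t))" "snd (\<omega> (Suc t))" "hist \<omega> t"] by simp
  then show ?thesis unfolding match_val_def matched_def by (simp split: option.split)
qed

lemma integrable_Ustar:
  assumes "s \<in> {1..T}"
  shows "integrable M (\<lambda>\<omega>. Ustar arank \<theta> (fst (\<omega> s)) i)"
proof (rule M.integrable_const_bound[where B="1/2"])
  show "(\<lambda>\<omega>. Ustar arank \<theta> (fst (\<omega> s)) i) \<in> borel_measurable M"
    by (rule borel_measurable_Ustar[OF NK rank_strict measurable_ctx[OF assms]])
  show "AE \<omega> in M. norm (Ustar arank \<theta> (fst (\<omega> s)) i) \<le> 1 / 2"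
    using AE_bounded_ctx
  proof eventually_elim
    fix \<omega> assume b: "bounded_ctx \<omega>"
    obtain \<mu> where "stable arank (util \<theta> (fst (\<omega> s))) \<mu>"
      and \<mu>: "Ustar arank \<theta> (fst (\<omega> s)) i = match_val (util \<theta> (fst (\<omega> s))) \<mu> i"
      by (rule Ustar_attained[OF NK rank_strict])
    then show "norm (Ustar arank \<theta> (fst (\<omega> s)) i) \<le> 1 / 2"
      using match_val_bound[of "fst (\<omega> s)" \<mu> i] b assms unfolding bounded_ctx_def by auto
  qed
qed

lemma integrable_match_val:
  assumes t: "t < T"
  shows "integrable M (\<lambda>\<omega>. match_val (util \<theta> (fst (\<omega> (Suc t)))) (mu (hist \<omega> t) (fst (\<omega> (Suc t)))) i)"
proof (rule M.integrable_const_bound[where B="1/2"])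
  have s: "Suc t \<in> {1..T}" using t by auto
  have m: "(\<lambda>\<omega>. match_val (util \<theta> (fst (\<omega> (Suc t)))) m i) \<in> borel_measurable M" for m
    by (intro borel_measurable_match_val borel_measurable_util measurable_ctx s)
  have "(\<lambda>\<omega>. mu (hist \<omega> t) (fst (\<omega> (Suc t)))) \<in> measurable M (count_space UNIV)"
    using t s by (intro measurable_mu mstate_hist measurable_ctx) auto
  then show "(\<lambda>\<omega>. match_val (util \<theta> (fst (\<omega> (Suc t)))) (mu (hist \<omega> t) (fst (\<omega> (Suc t)))) i) \<in> borel_measurable M"
    by (rule measurable_compose_countable'[where I=UNIV and
          f="\<lambda>m \<omega>. match_val (util \<theta> (fst (\<omega> (Suc t)))) m i", OF m]) (rule countable_finite, rule finite)
  show "AE \<omega> in M. norm (match_val (util \<theta> (fst (\<omega> (Suc t)))) (mu (hist \<omega> t) (fst (\<omega> (Suc t)))) i) \<le> 1 / 2"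
    using AE_bounded_ctx
  proof eventually_elim
    fix \<omega> assume "bounded_ctx \<omega>"
    then show "norm (match_val (util \<theta> (fst (\<omega> (Suc t)))) (mu (hist \<omega> t) (fst (\<omega> (Suc t)))) i) \<le> 1 / 2"
      using match_val_bound[of "fst (\<omega> (Suc t))"] s unfolding bounded_ctx_def by auto
  qed
qed

lemma regret_eq:
  "barb_regret T R lam Bth Bx Del1 arank mcm \<theta> Dx \<nu> i =
    (\<integral>\<omega>. (\<Sum>t<T. Ustar arank \<theta> (fst (\<omega> (Suc t))) i
        - match_val (util \<theta> (fst (\<omega> (Suc t)))) (mu (hist \<omega> t) (fst (\<omega> (Suc t)))) i) \<partial>M)"
proof -
  have sh: "(\<Sum>t\<in>{1..T}. f t) = (\<Sum>t<T. f (Suc t))" for f :: "nat \<Rightarrow> real"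
    using sum.atLeast1_atMost_eq[of f T] by simp
  define U where "U t \<omega> = Ustar arank \<theta> (fst (\<omega> (Suc t))) i" for t and \<omega> :: "nat \<Rightarrow> ((real, 'd) vec, 'k) vec \<times> ('n \<times> 'k \<Rightarrow> real)"
  define V where "V t \<omega> = match_val (util \<theta> (fst (\<omega> (Suc t)))) (mu (hist \<omega> t) (fst (\<omega> (Suc t)))) i" for t \<omega>
  define E where "E t \<omega> = (\<Sum>j\<in>UNIV. of_bool (matched t i j \<omega>) * snd (\<omega> (Suc t)) (i, j))" for t \<omega>
  have U: "integrable M (U t)" if "t < T" for t
    unfolding U_def[abs_def] using that by (intro integrable_Ustar) auto
  have V: "integrable M (V t)" if "t < T" for t
    unfolding V_def[abs_def] using that by (rule integrable_match_val)
  have E: "integrable M (E t)" if "t < T" for t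
    unfolding E_def[abs_def] using that by (intro Bochner_Integration.integrable_sum matched_noise_mean(1))
  have E0: "(\<integral>\<omega>. E t \<omega> \<partial>M) = 0" if "t < T" for t
  proof -
    have "(\<integral>\<omega>. E t \<omega> \<partial>M) = (\<Sum>j\<in>UNIV. \<integral>\<omega>. of_bool (matched t i j \<omega>) * snd (\<omega> (Suc t)) (i, j) \<partial>M)"
      unfolding E_def using that by (intro Bochner_Integration.integral_sum matched_noise_mean(1))
    then show ?thesis unfolding matched_noise_mean(2)[OF that] by simp
  qed
  have "barb_regret T R lam Bth Bx Del1 arank mcm \<theta> Dx \<nu> i =
     (\<integral>\<omega>. (\<Sum>t<T. U t \<omega>) \<partial>M) - (\<integral>\<omega>. (\<Sum>t<T. V t \<omega> + E t \<omega>) \<partial>M)"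
    unfolding barb_regret_def Let_def sh barb_obs_eq U_def V_def E_def M_def RM_def ..
  also have "(\<integral>\<omega>. (\<Sum>t<T. U t \<omega>) \<partial>M) = (\<Sum>t<T. \<integral>\<omega>. U t \<omega> \<partial>M)"
    using U by (intro Bochner_Integration.integral_sum) auto
  also have "(\<integral>\<omega>. (\<Sum>t<T. V t \<omega> + E t \<omega>) \<partial>M) = (\<Sum>t<T. \<integral>\<omega>. V t \<omega> + E t \<omega> \<partial>M)"
    using V E by (intro Bochner_Integration.integral_sum) auto
  also have "\<dots> = (\<Sum>t<T. \<integral>\<omega>. V t \<omega> \<partial>M)"
    using V E E0 by (intro sum.cong) auto
  also have "(\<Sum>t<T. \<integral>\<omega>. U t \<omega> \<partial>M) - (\<Sum>t<T. \<integral>\<omega>. V t \<omega> \<partial>M) = (\<Sum>t<T. \<integral>\<omega>. U t \<omega> - V t \<omega> \<partial>M)"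
    using U V by (simp add: sum_subtractf)
  also have "\<dots> = (\<integral>\<omega>. (\<Sum>t<T. U t \<omega> - V t \<omega>) \<partial>M)"
    using U V by (intro Bochner_Integration.integral_sum[symmetric]) auto
  finally show ?thesis unfolding U_def V_def .
qed

lemma regret_bound:
  assumes D0: "4 * D0 \<le> Del0"
  shows "barb_regret T R lam Bth Bx Del1 arank mcm \<theta> Dx \<nu> i \<le>
    Qtot * (1 / Del1\<^sup>2 + 2 / D0\<^sup>2 + 32 / (3 * ln (real T)) * (real T * (Pbad + c * (4 * D0)))) + real T * Pbad"
proof -
  let ?A = "1 / Del1\<^sup>2 + 2 / D0\<^sup>2" and ?B = "32 / (3 * ln (real T))"
  have fi: "integrable M (\<lambda>\<omega>. of_bool (fine_flag t \<omega>) :: real)" and bi: "integrable M (\<lambda>\<omega>. of_bool (bad t \<omega>) :: real)" if "t < T" for t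
    using that pred_fine_flag pred_bad by (auto intro!: integral_of_bool(1))
  have int: "integrable M (\<lambda>\<omega>. Qtot * (?A + ?B * (\<Sum>t<T. of_bool (fine_flag t \<omega>))) + (\<Sum>t<T. of_bool (bad t \<omega>)))"
    using fi bi by (intro Bochner_Integration.integrable_add integrable_mult_right Bochner_Integration.integrable_sum) auto
  have "barb_regret T R lam Bth Bx Del1 arank mcm \<theta> Dx \<nu> i \<le>
     (\<integral>\<omega>. Qtot * (?A + ?B * (\<Sum>t<T. of_bool (fine_flag t \<omega>))) + (\<Sum>t<T. of_bool (bad t \<omega>)) \<partial>M)"
    unfolding regret_eq
  proof (rule integral_mono_AE[OF _ int])
    show "integrable M (\<lambda>\<omega>. \<Sum>t<T. Ustar arank \<theta> (fst (\<omega> (Suc t))) i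
        - match_val (util \<theta> (fst (\<omega> (Suc t)))) (mu (hist \<omega> t) (fst (\<omega> (Suc t)))) i)"
      by (intro Bochner_Integration.integrable_sum Bochner_Integration.integrable_diff integrable_Ustar integrable_match_val) auto
  qed (use AE_bounded_ctx cumulative_regret_path in \<open>auto elim!: AE_mp\<close>)
  also have "\<dots> = Qtot * (?A + ?B * (\<Sum>t<T. \<integral>\<omega>. of_bool (fine_flag t \<omega>) \<partial>M)) + (\<Sum>t<T. \<integral>\<omega>. of_bool (bad t \<omega>) \<partial>M)"
  proof -
    define F where "F \<omega> = (\<Sum>t<T. of_bool (fine_flag t \<omega>) :: real)" for \<omega>
    define B where "B \<omega> = (\<Sum>t<T. of_bool (bad t \<omega>) :: real)" for \<omega>
    have f: "integrable M F" and b: "integrable M B"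
      unfolding F_def[abs_def] B_def[abs_def] using fi bi by (intro Bochner_Integration.integrable_sum; simp)+
    have "(\<integral>\<omega>. Qtot * (?A + ?B * F \<omega>) + B \<omega> \<partial>M) = Qtot * (?A + ?B * (\<integral>\<omega>. F \<omega> \<partial>M)) + (\<integral>\<omega>. B \<omega> \<partial>M)"
      using f b by (simp add: M.prob_space)
    then have "(\<integral>\<omega>. Qtot * (?A + ?B * (\<Sum>t<T. of_bool (fine_flag t \<omega>))) + (\<Sum>t<T. of_bool (bad t \<omega>)) \<partial>M)
      = Qtot * (?A + ?B * (\<integral>\<omega>. (\<Sum>t<T. of_bool (fine_flag t \<omega>)) \<partial>M)) + (\<integral>\<omega>. (\<Sum>t<T. of_bool (bad t \<omega>)) \<partial>M)"
      unfolding F_def B_def .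
    also have "(\<integral>\<omega>. (\<Sum>t<T. of_bool (fine_flag t \<omega>)) \<partial>M) = (\<Sum>t<T. \<integral>\<omega>. of_bool (fine_flag t \<omega>) \<partial>M :: real)"
      using fi by (intro Bochner_Integration.integral_sum) auto
    also have "(\<integral>\<omega>. (\<Sum>t<T. of_bool (bad t \<omega>)) \<partial>M) = (\<Sum>t<T. \<integral>\<omega>. of_bool (bad t \<omega>) \<partial>M :: real)"
      using bi by (intro Bochner_Integration.integral_sum) auto
    finally show ?thesis .
  qed
  also have "\<dots> \<le> Qtot * (?A + ?B * (real T * (Pbad + c * (4 * D0)))) + real T * Pbad"
  proof (intro add_mono mult_left_mono Qtot_nonneg order_refl)
    have "(\<Sum>t<T. \<integral>\<omega>. of_bool (fine_flag t \<omega>) \<partial>M) \<le> (\<Sum>t<T. Pbad + c * (4 * D0))"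
      using prob_fine_flag[OF _ D0] by (intro sum_mono) (simp add: integral_of_bool(2)[OF pred_fine_flag])
    then show "(\<Sum>t<T. \<integral>\<omega>. of_bool (fine_flag t \<omega>) \<partial>M) \<le> real T * (Pbad + c * (4 * D0))" by simp
    have "(\<Sum>t<T. \<integral>\<omega>. of_bool (bad t \<omega>) \<partial>M) \<le> (\<Sum>t<T. Pbad)"
      using prob_inaccurate[folded bad_def] by (intro sum_mono) (simp add: integral_of_bool(2)[OF pred_bad])
    then show "(\<Sum>t<T. \<integral>\<omega>. of_bool (bad t \<omega>) \<partial>M) \<le> real T * Pbad" by simp
    show "0 \<le> ?B" using T_pos by simp
  qed
  finally show ?thesis .
qed

end

text \<open>Each \<open>K\<close> is a coefficient independent of the horizon: \<open>K2\<close>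
  bounds \<open>T * Pbad\<close> over \<open>ln T\<close>, \<open>K3\<close> the bracket of
  \<open>regret_bound\<close> over \<open>T powr (2 / 3)\<close>, \<open>K5\<close> and
  \<open>K6\<close> bound \<open>Lpot\<close> and \<open>eta\<^sup>2\<close> over
  \<open>ln T\<close>, and \<open>K4\<close> bounds \<open>Qtot\<close> over
  \<open>(ln T)\<^sup>2\<close>.\<close>

definition barb_const :: "nat \<Rightarrow> nat \<Rightarrow> real \<Rightarrow> real \<Rightarrow> real \<Rightarrow> real \<Rightarrow> real \<Rightarrow> real \<Rightarrow> real" where
  "barb_const N d Bth Bx R lam Del1 c =
    (let b = ln (1 + Bx\<^sup>2 / lam);
         K2 = real N * (1 + (ln (1 + 13 * Del1\<^sup>2) + 1) / ln 2);
         K3 = 1 / Del1\<^sup>2 + 2 + 32 / 3 * (K2 + 4 * c);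
         K5 = ln (fact d) + real d * (b + 1);
         K6 = 2 * (R\<^sup>2 * (real d * (b + 3)) + lam * Bth\<^sup>2);
         K4 = 2 * (real N * K5 * (Del1\<^sup>2 + K6) + 3 / 16 + Del1\<^sup>2)
     in K4 * K3 + K2)"

lemma le_mult_ge_one: "a \<le> a * x" if "0 \<le> a" "1 \<le> x" for a x :: real
  using that by (simp add: mult_le_cancel_left1)

section \<open>Growth of the regret bound in the horizon\<close>

context barb_prob
begin

lemma ln_growth: "ln (1 + real T * Bx\<^sup>2 / lam) \<le> ln (1 + Bx\<^sup>2 / lam) + ln (real T)"
proof -
  have "1 + real T * Bx\<^sup>2 / lam \<le> (1 + Bx\<^sup>2 / lam) * real T"
    using T2 by (simp add: algebra_simps)
  moreover have "0 < 1 + real T * Bx\<^sup>2 / lam" "0 < 1 + Bx\<^sup>2 / lam"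
    using lam_pos by (intro add_pos_nonneg; simp)+
  moreover have "ln ((1 + Bx\<^sup>2 / lam) * real T) = ln (1 + Bx\<^sup>2 / lam) + ln (real T)"
    using calculation T_pos by (intro ln_mult_pos) auto
  moreover have "ln (1 + real T * Bx\<^sup>2 / lam) \<le> ln ((1 + Bx\<^sup>2 / lam) * real T)"
    using calculation T_pos by (intro ln_mono) auto
  ultimately show ?thesis by simp
qed

text \<open>The two logarithms come from \<open>Lpot\<close> and \<open>eta\<^sup>2\<close>, whose
  product enters \<open>Qexp\<close>. As \<open>T \<ge> 3\<close> gives \<open>ln T \<ge> 1\<close>,
  lower-order terms are absorbed by multiplying them with powers of \<open>ln T\<close> and
  \<open>T powr (2 / 3)\<close>.\<close>

lemma regret_rate:
  assumes T3: "T \<ge> 3" and D0: "4 * D0 \<le> Del0"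
  shows "barb_regret T R lam Bth Bx Del1 arank mcm \<theta> Dx \<nu> i
    \<le> barb_const N d Bth Bx R lam Del1 c * real T powr (2 / 3) * (ln (real T)) ^ 2"
proof -
  define l where "l = ln (real T)"
  define r where "r = real T powr (2 / 3)"
  define b where "b = ln (1 + Bx\<^sup>2 / lam)"
  define K2 where "K2 = real N * (1 + (ln (1 + 13 * Del1\<^sup>2) + 1) / ln 2)"
  define K3 where "K3 = 1 / Del1\<^sup>2 + 2 + 32 / 3 * (K2 + 4 * c)"
  define K5 where "K5 = ln (fact d) + real d * (b + 1)"
  define K6 where "K6 = 2 * (R\<^sup>2 * (real d * (b + 3)) + lam * Bth\<^sup>2)"
  define K4 where "K4 = 2 * (real N * K5 * (Del1\<^sup>2 + K6) + 3 / 16 + Del1\<^sup>2)"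
  have C: "barb_const N d Bth Bx R lam Del1 c = K4 * K3 + K2"
    unfolding barb_const_def Let_def K4_def K3_def K2_def K5_def K6_def b_def ..
  have l: "l \<ge> 1"
  proof -
    have "exp 1 \<le> real T" using exp_le T3 by linarith
    then show ?thesis unfolding l_def using T_pos by (simp add: ln_ge_iff)
  qed
  have ll: "l \<le> l\<^sup>2" "1 \<le> l\<^sup>2" using l by (auto simp: power2_eq_square intro: order_trans)
  have r: "r \<ge> 1" unfolding r_def using T2 by (intro ge_one_powr_ge_zero) auto
  have rT: "r \<le> real T"
  proof -
    have "r \<le> real T powr 1" unfolding r_def using T2 by (intro powr_mono) auto
    then show ?thesis using T_pos by simp
  qed
  have D0r: "1 / D0\<^sup>2 = r"
  proof -
    have "D0\<^sup>2 = real T powr (- (2 / 3))"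
      unfolding D0_def using T_pos by (simp add: powr_power)
    then show ?thesis unfolding r_def by (simp add: powr_minus field_simps)
  qed
  have TD0: "real T * D0 = r"
  proof -
    have "real T powr 1 * real T powr (- 1 / 3) = real T powr (1 + - 1 / 3)" by (rule powr_add[symmetric])
    then show ?thesis unfolding D0_def r_def using T_pos by simp
  qed
  have b0: "b \<ge> 0" unfolding b_def using lam_pos by simp
  have K2: "K2 \<ge> 0"
    unfolding K2_def by (intro mult_nonneg_nonneg add_nonneg_nonneg divide_nonneg_nonneg) auto
  have K3: "K3 \<ge> 0" unfolding K3_def using K2 c_pos by simp
  have K5: "K5 \<ge> 0" unfolding K5_def using b0 by (intro add_nonneg_nonneg mult_nonneg_nonneg ln_ge_zero) auto
  have K6: "K6 \<ge> 0" unfolding K6_def using b0 lam_pos by simp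
  have lg: "ln (1 + real T * Bx\<^sup>2 / lam) \<le> (b + 1) * l"
  proof -
    have "b \<le> b * l" using b0 l by (rule le_mult_ge_one)
    then show ?thesis using ln_growth unfolding b_def[symmetric] l_def[symmetric] by (simp add: algebra_simps)
  qed

  have "Crho \<le> (ln (1 + 13 * Del1\<^sup>2) + 1) / ln 2 * l"
  proof -
    have "32 / (3 * l) * real T \<le> 32 / 3 * real T"
    proof -
      have "32 / (3 * l) \<le> 32 / 3" using l by (simp add: field_simps)
      then show ?thesis by (intro mult_right_mono) auto
    qed
    \<comment> \<open>Both terms are linear in \<open>T\<close> at most, with coefficients 2 and
      \<open>32 / 3\<close>; 13 rounds up their sum.\<close>
    then have "2 / D0\<^sup>2 + 32 / (3 * l) * real T \<le> 13 * real T"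
      using D0r rT T_pos by simp
    then have "Del1\<^sup>2 * (2 / D0\<^sup>2 + 32 / (3 * l) * real T) \<le> Del1\<^sup>2 * (13 * real T)"
      by (intro mult_left_mono) auto
    moreover have "Del1\<^sup>2 * Wmax = 1 + Del1\<^sup>2 * (2 / D0\<^sup>2 + 32 / (3 * l) * real T)"
      unfolding Wmax_def l_def[symmetric] using Del1_pos by (simp add: algebra_simps)
    ultimately have W: "Del1\<^sup>2 * Wmax \<le> (1 + 13 * Del1\<^sup>2) * real T"
      using T2 by (simp add: algebra_simps)
    have "Del1\<^sup>2 * Wmax > 0"
      unfolding Wmax_def using Del1_pos T_pos D0_pos by (intro mult_pos_pos add_pos_nonneg) auto
    then have "ln (Del1\<^sup>2 * Wmax) \<le> ln ((1 + 13 * Del1\<^sup>2) * real T)" using W by simp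
    also have "\<dots> = ln (1 + 13 * Del1\<^sup>2) + l"
      unfolding l_def using T_pos by (intro ln_mult_pos) (auto intro: add_pos_nonneg)
    also have "\<dots> \<le> (ln (1 + 13 * Del1\<^sup>2) + 1) * l"
    proof -
      have "ln (1 + 13 * Del1\<^sup>2) \<le> ln (1 + 13 * Del1\<^sup>2) * l" using l by (intro le_mult_ge_one) auto
      then show ?thesis by (simp add: algebra_simps)
    qed
    finally show ?thesis unfolding Crho_def log_def by (simp add: divide_right_mono)
  qed
  then have "1 + Crho \<le> (1 + (ln (1 + 13 * Del1\<^sup>2) + 1) / ln 2) * l" using l by (simp add: algebra_simps)
  then have "real N * (1 + Crho) \<le> K2 * l"
    unfolding K2_def by (metis mult.assoc mult_left_mono of_nat_0_le_iff)
  then have TP: "real T * Pbad \<le> K2 * l" unfolding Pbad_def using T_pos by simp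

  have inner: "1 / Del1\<^sup>2 + 2 / D0\<^sup>2 + 32 / (3 * ln (real T)) * (real T * (Pbad + c * (4 * D0))) \<le> K3 * r"
  proof -
    have "real T * (Pbad + c * (4 * D0)) = real T * Pbad + 4 * c * r"
      unfolding TD0[symmetric] by (simp add: algebra_simps)
    \<comment> \<open>The second term is inflated by \<open>l\<close> so that the factor
      \<open>1 / l\<close> from the stopping rule cancels throughout and the bracket carries no
      logarithm.\<close>
    also have "\<dots> \<le> K2 * l + 4 * c * r * l"
      using TP l c_pos r by (intro add_mono le_mult_ge_one) auto
    also have "\<dots> = (K2 + 4 * c * r) * l" by (simp add: algebra_simps)
    finally have "32 / (3 * l) * (real T * (Pbad + c * (4 * D0))) \<le> 32 / (3 * l) * ((K2 + 4 * c * r) * l)"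
      using l by (intro mult_left_mono) auto
    also have "\<dots> = 32 / 3 * (K2 + 4 * c * r)" using l by simp
    also have "\<dots> \<le> 32 / 3 * ((K2 + 4 * c) * r)"
      using le_mult_ge_one[OF K2 r] by (simp add: algebra_simps)
    finally have 1: "32 / (3 * l) * (real T * (Pbad + c * (4 * D0))) \<le> 32 / 3 * ((K2 + 4 * c) * r)" .
    have "1 / Del1\<^sup>2 \<le> 1 / Del1\<^sup>2 * r" using r by (intro le_mult_ge_one) auto
    moreover have "2 / D0\<^sup>2 = 2 * r" using D0r by simp
    ultimately have "1 / Del1\<^sup>2 + 2 / D0\<^sup>2 + 32 / (3 * l) * (real T * (Pbad + c * (4 * D0)))
        \<le> 1 / Del1\<^sup>2 * r + 2 * r + 32 / 3 * ((K2 + 4 * c) * r)"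
      using 1 by linarith
    also have "\<dots> = K3 * r" unfolding K3_def by (simp add: distrib_right)
    finally show ?thesis unfolding l_def .
  qed

  have Lp: "Lpot \<le> K5 * l"
  proof -
    have "ln (fact d) \<le> ln (fact d) * l" using l by (intro le_mult_ge_one ln_ge_zero) auto
    moreover have "real d * ln (1 + real T * Bx\<^sup>2 / lam) \<le> real d * ((b + 1) * l)"
      using lg by (intro mult_left_mono) auto
    ultimately show ?thesis unfolding Lpot_def K5_def by (simp add: algebra_simps)
  qed
  have et: "eta\<^sup>2 \<le> K6 * l"
  proof -
    have p: "1 + real T * Bx\<^sup>2 / lam > 0" using lam_pos by (intro add_pos_nonneg) auto
    have "ln ((1 + real T * Bx\<^sup>2 / lam) * (real T)\<^sup>2) = ln (1 + real T * Bx\<^sup>2 / lam) + 2 * l"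
      unfolding l_def using p T_pos by (simp add: ln_mult_pos ln_realpow)
    also have "\<dots> \<le> (b + 3) * l" using lg by (simp add: algebra_simps)
    finally have cf: "conf \<le> real d * (b + 3) * l" unfolding conf_def by (simp add: mult_left_mono mult.assoc)
    have "eta\<^sup>2 \<le> 2 * ((R * sqrt conf)\<^sup>2 + (sqrt lam * Bth)\<^sup>2)"
    proof -
      have "0 \<le> (R * sqrt conf - sqrt lam * Bth)\<^sup>2" by simp
      then show ?thesis unfolding eta_eq by (simp add: power2_eq_square algebra_simps)
    qed
    also have "\<dots> = 2 * (R\<^sup>2 * conf + lam * Bth\<^sup>2)"
      using conf_pos lam_pos by (simp add: power_mult_distrib)
    also have "\<dots> \<le> 2 * (R\<^sup>2 * (real d * (b + 3) * l) + lam * Bth\<^sup>2 * l)"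
      using cf l lam_pos by (intro mult_left_mono add_mono le_mult_ge_one) auto
    also have "\<dots> = K6 * l" unfolding K6_def by (simp add: algebra_simps)
    finally show ?thesis .
  qed
  have Qt: "Qtot \<le> K4 * l\<^sup>2"
  proof -
    have "Del1\<^sup>2 + eta\<^sup>2 \<le> (Del1\<^sup>2 + K6) * l"
    proof -
      have "Del1\<^sup>2 \<le> Del1\<^sup>2 * l" using l by (intro le_mult_ge_one) auto
      then show ?thesis using et by (simp add: algebra_simps)
    qed
    then have "Lpot * (Del1\<^sup>2 + eta\<^sup>2) \<le> (K5 * l) * ((Del1\<^sup>2 + K6) * l)"
      using Lp K5 l by (intro mult_mono) auto
    then have "real N * (Lpot * (Del1\<^sup>2 + eta\<^sup>2)) \<le> real N * ((K5 * l) * ((Del1\<^sup>2 + K6) * l))"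
      by (intro mult_left_mono) auto
    then have 1: "Qexp \<le> real N * K5 * (Del1\<^sup>2 + K6) * l\<^sup>2"
      unfolding Qexp_def by (simp add: power2_eq_square mult_ac)
    have "3 * l / 16 + Del1\<^sup>2 \<le> 3 / 16 * l\<^sup>2 + Del1\<^sup>2 * l\<^sup>2"
      using ll by (intro add_mono le_mult_ge_one) auto
    then have "Qflag \<le> (3 / 16 + Del1\<^sup>2) * l\<^sup>2" unfolding Qflag_def l_def[symmetric] by (simp add: algebra_simps)
    then show ?thesis using 1 unfolding Qtot_def K4_def by (simp add: algebra_simps)
  qed
  have "barb_regret T R lam Bth Bx Del1 arank mcm \<theta> Dx \<nu> i \<le>
    Qtot * (1 / Del1\<^sup>2 + 2 / D0\<^sup>2 + 32 / (3 * ln (real T)) * (real T * (Pbad + c * (4 * D0)))) + real T * Pbad"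
    by (rule regret_bound[OF D0])
  also have "\<dots> \<le> Qtot * (K3 * r) + K2 * l"
    by (intro add_mono mult_left_mono inner TP Qtot_nonneg)
  also have "\<dots> \<le> (K4 * l\<^sup>2) * (K3 * r) + K2 * (r * l\<^sup>2)"
  proof (intro add_mono mult_right_mono mult_left_mono Qt K2)
    show "0 \<le> K3 * r" using K3 r by simp
    have "1 * l \<le> r * l\<^sup>2" using r ll l by (intro mult_mono) auto
    then show "l \<le> r * l\<^sup>2" by simp
  qed
  also have "\<dots> = (K4 * K3 + K2) * r * l\<^sup>2" by (simp add: algebra_simps)
  finally show ?thesis unfolding C r_def l_def .
qed

end

theorem theorem3p2:
  fixes \<theta> :: "('n::{finite,linorder}) \<Rightarrow> (real, 'd::finite) vec"
    and arank :: "('k::{finite,linorder}) \<Rightarrow> 'n \<Rightarrow> nat"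
    and mcm :: "('n \<times> 'k) set \<Rightarrow> ('n, 'k) matching"
    and Dx :: "(((real, 'd) vec, 'k) vec) measure"
    and \<nu> :: "real measure"
    and Bth Bx R lam Del1 c Del0 :: real
  assumes NK: "CARD('n) \<le> CARD('k)"
    and rank_strict: "\<And>j. inj (arank j)"
    and theta_bound: "\<And>i. norm (\<theta> i) \<le> Bth"
    and Dx_prob: "prob_space Dx" and Dx_sets: "sets Dx = sets borel"
    and ctx_bound: "AE x in Dx. \<forall>j. norm (x $ j) \<le> Bx"
    and By: "2 * Bth * Bx \<le> 1"
    and nu_prob: "prob_space \<nu>" and nu_sets: "sets \<nu> = sets borel"
    and nu_int: "integrable \<nu> (\<lambda>z. z)" and nu_mean: "(\<integral>z. z \<partial>\<nu>) = 0"
    and R_pos: "R > 0"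
    and nu_subg: "\<And>s. integrable \<nu> (\<lambda>z. exp (s * z)) \<and>
                       (\<integral>z. exp (s * z) \<partial>\<nu>) \<le> exp (s\<^sup>2 * R\<^sup>2 / 2)"
    and lam_pos: "lam > 0" and Del1_pos: "Del1 > 0"
    and mcm_spec: "\<And>E. max_card_matching E (mcm E)"
    and Del0_pos: "Del0 > 0" and c_pos: "c > 0"
    and cdf: "\<And>Del. 0 < Del \<Longrightarrow> Del \<le> Del0 \<Longrightarrow>
                 measure Dx {x \<in> space Dx. delta_min \<theta> x \<le> Del} \<le> c * Del"
  shows "\<exists>C (p::nat) T0. \<forall>T \<ge> T0. \<forall>i.
           barb_regret T R lam Bth Bx Del1 arank mcm \<theta> Dx \<nu> i
             \<le> C * real T powr (2/3) * (ln (real T)) ^ p"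
proof -
  \<comment> \<open>The 3 ensures \<open>ln T \<ge> 1\<close>; the cube is exactly what makes
    \<open>4 * D0 \<le> Del0\<close>, so that the assumption on the distribution of
    \<open>delta_min\<close> applies at \<open>4 * D0\<close>.\<close>
  define T0 :: nat where "T0 = max 3 (nat \<lceil>(4 / Del0) ^ 3\<rceil>)"
  show ?thesis
  proof (intro exI allI impI)
    fix T i assume "T0 \<le> T"
    then have T3: "T \<ge> 3" and TD: "(4 / Del0) ^ 3 \<le> real T" unfolding T0_def by (auto simp: nat_le_iff ceiling_le_iff)
    interpret barb_prob \<theta> arank mcm Bth Bx R lam Del1 T "CARD('n)" "CARD('d)" Dx \<nu> c Del0
    proof (intro barb_prob.intro barb_env.intro barb_prob_axioms.intro)
      show "2 \<le> T" using T3 by simp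
    qed (fact refl assms)+
    have "4 * D0 \<le> Del0"
    proof -
      have "((4 / Del0) ^ 3) powr (1 / 3) \<le> real T powr (1 / 3)"
        using TD Del0_pos by (intro powr_mono2) auto
      moreover have "((4 / Del0) ^ 3) powr (1 / 3) = 4 / Del0"
        using Del0_pos by (simp add: powr_powr flip: powr_numeral)
      ultimately have "4 / Del0 \<le> real T powr (1 / 3)" by simp
      moreover have "real T powr (1 / 3) > 0" using T3 by simp
      moreover have D0: "D0 = 1 / real T powr (1 / 3)" unfolding D0_def by (simp add: powr_minus_divide)
      ultimately show ?thesis unfolding D0 using Del0_pos by (simp add: field_simps)
    qed
    from regret_rate[OF T3 this]
    show "barb_regret T R lam Bth Bx Del1 arank mcm \<theta> Dx \<nu> i
       \<le> barb_const CARD('n) CARD('d) Bth Bx R lam Del1 c * real T powr (2/3) * (ln (real T)) ^ 2" .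
  qed
qed

end
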